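(* Let $n,p$ be positive integers. The rectangular Capelli-Deruyts bitableau $\mathbf{K}_n^p\in\mathbf{U}(gl(n))$ equals the commutative polynomial in the Capelli generators $\mathbf{H}_n^{(j)}$ given by $$\mathbf{K}_n^p=(-1)^{n\binom{p}{2}}\ \mathbf{C}_n(p-1)\cdots\mathbf{C}_n(1)\ \mathbf{C}_n(0),$$ where $\mathbf{C}_n(q)=\sum_{j=0}^{n}(-1)^{n-j}(q)_{n-j}\ \mathbf{H}_n^{(j)}$ for $q\in\mathbb{N}$.
   Context: $(q)_k=q(q-1)\cdots(q-k+1)$ is the falling factorial. The Capelli elements are $\mathbf{H}_n^{(0)}=\mathbf{1}$ and, for $1\le k\le n$, $\mathbf{H}_n^{(k)}=\sum_{1\le i_1<\cdots<i_k\le n}\mathbf{cdet}\big[e_{i_r,i_s}+\delta_{rs}(k-r)\big]_{r,s=1,\dots,k}\in\mathbf{U}(gl(n))$, where $\mathbf{cdet}[a_{rs}]=\sum_\sigma(-1)^{|\sigma|}a_{\sigma(1),1}a_{\sigma(2),2}\cdots a_{\sigma(k),k}$ is the column determinant and $e_{i,j}$ are the elementary matrices. They are central in $\mathbf{U}(gl(n))$ (Capelli). Capelli bitableaux. Let $\mathcal{A}_0=\{\alpha_1,\dots,\alpha_{m}\}$ ($m$ sufficiently large) be a set of virtual symbols, with $|\alpha_s|=0\in\mathbb{Z}_2$, and $\mathcal{L}=\{1,\dots,n\}$ the proper symbols, with $|i|=1\in\mathbb{Z}_2$. Let $gl(m|n)$ be the complex Lie superalgebra with basis $e_{a,b}$,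 $a,b\in\mathcal{A}_0\cup\mathcal{L}$, of parity $|a|+|b|$, and superbracket $[e_{a,b},e_{c,d}]=\delta_{bc}e_{a,d}-(-1)^{(|a|+|b|)(|c|+|d|)}\delta_{ad}e_{c,b}$. The enveloping algebra $\mathbf{U}(gl(n))$ is the subalgebra of $\mathbf{U}(gl(m|n))$ generated by the $e_{i,j}$, $i,j\in\mathcal{L}$. A product $e_{a_r,b_r}\cdots e_{a_1,b_1}$ is irregular if there are $i\le r$ and $\gamma\in\mathcal{A}_0$ with $\#\{j\le i: b_j=\gamma\}>\#\{j<i: a_j=\gamma\}$. Let $\mathbf{Irr}$ be the left ideal of $\mathbf{U}(gl(m|n))$ generated by the irregular products. It is known that $\mathbf{U}(gl(n))\cap\mathbf{Irr}=0$, that $Virt(m,n)=\mathbf{U}(gl(n))\oplus\mathbf{Irr}$ is a subalgebra, and that $\mathbf{Irr}$ is a two-sided ideal of it; the Capelli devirtualization epimorphism $\mathfrak{p}:Virt(m,n)\to\mathbf{U}(gl(n))$ is the projection with kernel $\mathbf{Irr}$. For Young tableaux $S=(s_{ij})$, $T=(t_{ij})$ of the same shape $\lambda=(\lambda_1\ge\dots\ge\lambda_p)$ with entries in $\mathcal{L}$, the Capelli bitableau is $$[S|T]=\mathfrak{p}\Big(\prod_{i=1}^{p}\big(e_{s_{i1},\alpha_i}e_{s_{i2},\alpha_i}\cdots e_{s_{i\lambda_i},\alpha_i}\big)\cdot\prod_{i=1}^{p}\big(e_{\alpha_i,t_{i1}}e_{\alpha_i,t_{i2}}\cdots e_{\alpha_i,t_{i\lambda_i}}\big)\Big),$$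 with products ordered from left to right by increasing $i$ and $\alpha_1,\dots,\alpha_p$ distinct virtual symbols (the argument lies in $Virt(m,n)$ and the result does not depend on the choice of the $\alpha_i$). $\mathbf{K}_n^p=[S|T]$ where $S$ and $T$ have $p$ rows, every row of $S$ is $n\ (n-1)\ \cdots\ 2\ 1$ and every row of $T$ is $1\ 2\ \cdots\ n$. *)

theory Defs
  imports
    "HOL-Library.Poly_Mapping"
    "HOL-Combinatorics.Permutations"
    "HOL-Algebra.QuotRing"
    "HOL-Algebra.Generated_Rings"
begin

section \<open>Symbols and the Lie superalgebra bracket\<close>

datatype symb = Virtual nat | Proper nat

fun parity :: "symb \<Rightarrow> nat" where
  "parity (Virtual s) = 0"
| "parity (Proper i) = 1"

definition virtual_symbols :: "nat \<Rightarrow> symb set" where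
  "virtual_symbols m = Virtual ` {1..m}"

definition proper_symbols :: "nat \<Rightarrow> symb set" where
  "proper_symbols n = Proper ` {1..n}"

definition symbols :: "nat \<Rightarrow> nat \<Rightarrow> symb set" where
  "symbols m n = virtual_symbols m \<union> proper_symbols n"

text \<open>
  A wrapper around lists whose addition is concatenation: with these exponents, the convolution
  product of finitely supported functions is the product of the free associative algebra.
\<close>

datatype 'a fword = FWord (letters: "'a list")

instantiation fword :: (type) monoid_add
begin

definition zero_fword :: "'a fword" where
  "zero_fword = FWord []"

definition plus_fword :: "'a fword \<Rightarrow> 'a fword \<Rightarrow> 'a fword" where
  "plus_fword u v = FWord (letters u @ letters v)"

instance
  by standard (simp_all add: zero_fword_def plus_fword_def)

end

text \<open>The letter \<open>(a, b)\<close> stands for the basis element \<open>e\<close> with indices \<open>a, b\<close>.\<close>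

type_synonym free_elem = "(symb \<times> symb) fword \<Rightarrow>\<^sub>0 complex"

definition free_scalar :: "complex \<Rightarrow> free_elem" where
  "free_scalar c = Poly_Mapping.single 0 c"

definition free_gen :: "symb \<Rightarrow> symb \<Rightarrow> free_elem" where
  "free_gen a b = Poly_Mapping.single (FWord [(a, b)]) 1"

definition bracket_sign :: "symb \<Rightarrow> symb \<Rightarrow> symb \<Rightarrow> symb \<Rightarrow> free_elem" where
  "bracket_sign a b c d = (- 1) ^ ((parity a + parity b) * (parity c + parity d))"

definition gl_bracket :: "symb \<Rightarrow> symb \<Rightarrow> symb \<Rightarrow> symb \<Rightarrow> free_elem" where
  "gl_bracket a b c d =
     (if b = c then free_gen a d else 0)
     - bracket_sign a b c d * (if a = d then free_gen c b else 0)"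

section \<open>The enveloping algebras\<close>

definition free_alg :: "nat \<Rightarrow> nat \<Rightarrow> free_elem ring" where
  "free_alg m n =
     \<lparr>carrier = {f. \<forall>w \<in> Poly_Mapping.keys f. set (letters w) \<subseteq> symbols m n \<times> symbols m n},
      mult = (*), one = 1, zero = 0, add = (+)\<rparr>"

definition env_relators :: "nat \<Rightarrow> nat \<Rightarrow> free_elem set" where
  "env_relators m n =
     {free_gen a b * free_gen c d - bracket_sign a b c d * (free_gen c d * free_gen a b)
        - gl_bracket a b c d | a b c d.
      a \<in> symbols m n \<and> b \<in> symbols m n \<and> c \<in> symbols m n \<and> d \<in> symbols m n}"

definition env_ideal :: "nat \<Rightarrow> nat \<Rightarrow> free_elem set" where
  "env_ideal m n = genideal (free_alg m n) (env_relators m n)"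

text \<open>\<open>Ugl m n\<close> is the enveloping algebra of \<open>gl(m|n)\<close>; its elements are cosets.\<close>

definition Ugl :: "nat \<Rightarrow> nat \<Rightarrow> free_elem set ring" where
  "Ugl m n = free_alg m n Quot env_ideal m n"

definition env_class :: "nat \<Rightarrow> nat \<Rightarrow> free_elem \<Rightarrow> free_elem set" where
  "env_class m n x = env_ideal m n +>\<^bsub>free_alg m n\<^esub> x"

definition env_gen :: "nat \<Rightarrow> nat \<Rightarrow> symb \<Rightarrow> symb \<Rightarrow> free_elem set" where
  "env_gen m n a b = env_class m n (free_gen a b)"

text \<open>
  The complex subalgebra of \<open>Ugl m n\<close> generated by the \<open>env_gen m n a b\<close> with proper
  \<open>a, b\<close>; adjoining the scalars to the generators makes the generated subring a subalgebra.
\<close>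

definition Ugl_proper :: "nat \<Rightarrow> nat \<Rightarrow> free_elem set set" where
  "Ugl_proper m n = generate_ring (Ugl m n)
     (range (\<lambda>c. env_class m n (free_scalar c))
      \<union> {env_gen m n a b | a b. a \<in> proper_symbols n \<and> b \<in> proper_symbols n})"

definition list_mult :: "('a, 'b) ring_scheme \<Rightarrow> 'a list \<Rightarrow> 'a" where
  "list_mult R xs = foldr (\<otimes>\<^bsub>R\<^esub>) xs \<one>\<^bsub>R\<^esub>"

definition e_word :: "nat \<Rightarrow> nat \<Rightarrow> (symb \<times> symb) list \<Rightarrow> free_elem set" where
  "e_word m n w = list_mult (Ugl m n) (map (\<lambda>(a, b). env_gen m n a b) w)"

section \<open>Irregular products and devirtualization\<close>

text \<open>
  The factors of a product are numbered from right to left, hence the reversal: with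
  \<open>v = rev w\<close>, the pair with index \<open>j\<close> is \<open>v ! (j - 1)\<close>.
\<close>

definition irregular :: "nat \<Rightarrow> (symb \<times> symb) list \<Rightarrow> bool" where
  "irregular m w \<longleftrightarrow>
     (\<exists>i \<in> {1..length w}. \<exists>\<gamma> \<in> virtual_symbols m.
        card {j \<in> {1..i}. snd (rev w ! (j - 1)) = \<gamma>}
        > card {j \<in> {1..<i}. fst (rev w ! (j - 1)) = \<gamma>})"

definition left_ideal :: "'a set \<Rightarrow> ('a, 'b) ring_scheme \<Rightarrow> bool" where
  "left_ideal I R \<longleftrightarrow> additive_subgroup I R \<and> (\<forall>r \<in> carrier R. \<forall>x \<in> I. r \<otimes>\<^bsub>R\<^esub> x \<in> I)"

definition Irr :: "nat \<Rightarrow> nat \<Rightarrow> free_elem set set" where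
  "Irr m n = (\<lambda>I. left_ideal I (Ugl m n)) hull
     {e_word m n w | w. set w \<subseteq> symbols m n \<times> symbols m n \<and> irregular m w}"

text \<open>
  The projection onto the first summand of the direct sum of \<open>Ugl_proper m n\<close> and \<open>Irr m n\<close>,
  meaningful on the elements of that sum.
\<close>

definition devirt :: "nat \<Rightarrow> nat \<Rightarrow> free_elem set \<Rightarrow> free_elem set" where
  "devirt m n x = (THE u. u \<in> Ugl_proper m n \<and> x \<ominus>\<^bsub>Ugl m n\<^esub> u \<in> Irr m n)"

section \<open>Capelli bitableaux\<close>

text \<open>
  Tableaux are lists of rows; \<open>\<alpha> i\<close> is the index of the virtual symbol attached to the row
  \<open>i\<close>, rows being counted from 1.
\<close>

definition bitableau_word ::
    "(nat \<Rightarrow> nat) \<Rightarrow> nat list list \<Rightarrow> nat list list \<Rightarrow> (symb \<times> symb) list" where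
  "bitableau_word \<alpha> S T =
     concat (map (\<lambda>i. map (\<lambda>s. (Proper s, Virtual (\<alpha> i))) (S ! (i - 1))) [1..<Suc (length S)])
     @ concat (map (\<lambda>i. map (\<lambda>t. (Virtual (\<alpha> i), Proper t)) (T ! (i - 1))) [1..<Suc (length T)])"

definition capelli_bitableau ::
    "nat \<Rightarrow> nat \<Rightarrow> (nat \<Rightarrow> nat) \<Rightarrow> nat list list \<Rightarrow> nat list list \<Rightarrow> free_elem set" where
  "capelli_bitableau m n \<alpha> S T = devirt m n (e_word m n (bitableau_word \<alpha> S T))"

definition capelli_deruyts :: "nat \<Rightarrow> nat \<Rightarrow> (nat \<Rightarrow> nat) \<Rightarrow> nat \<Rightarrow> free_elem set" where
  "capelli_deruyts m n \<alpha> p =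
     capelli_bitableau m n \<alpha> (replicate p (rev [1..<Suc n])) (replicate p [1..<Suc n])"

section \<open>Capelli elements\<close>

definition cdet :: "('a, 'b) ring_scheme \<Rightarrow> nat \<Rightarrow> (nat \<Rightarrow> nat \<Rightarrow> 'a) \<Rightarrow> 'a" where
  "cdet R k A =
     (\<Oplus>\<^bsub>R\<^esub>\<sigma> \<in> {\<sigma>. \<sigma> permutes {1..k}}.
        [(sign \<sigma>)] \<cdot>\<^bsub>R\<^esub> list_mult R (map (\<lambda>s. A (\<sigma> s) s) [1..<Suc k]))"

definition capelli_matrix :: "nat \<Rightarrow> nat \<Rightarrow> nat set \<Rightarrow> nat \<Rightarrow> nat \<Rightarrow> free_elem set" where
  "capelli_matrix m n I r s =
     env_gen m n (Proper (sorted_list_of_set I ! (r - 1))) (Proper (sorted_list_of_set I ! (s - 1)))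
     \<oplus>\<^bsub>Ugl m n\<^esub>
     (if r = s then [(card I - r)] \<cdot>\<^bsub>Ugl m n\<^esub> \<one>\<^bsub>Ugl m n\<^esub> else \<zero>\<^bsub>Ugl m n\<^esub>)"

text \<open>An index sequence \<open>i\<^sub>1 < \<dots> < i\<^sub>k\<close> is given by the set \<open>I\<close> of its members.\<close>

definition capelli_elem :: "nat \<Rightarrow> nat \<Rightarrow> nat \<Rightarrow> free_elem set" where
  "capelli_elem m n k =
     (if k = 0 then \<one>\<^bsub>Ugl m n\<^esub>
      else (\<Oplus>\<^bsub>Ugl m n\<^esub>I \<in> {I. I \<subseteq> {1..n} \<and> card I = k}. cdet (Ugl m n) k (capelli_matrix m n I)))"

definition falling_factorial :: "nat \<Rightarrow> nat \<Rightarrow> int" where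
  "falling_factorial q k = (\<Prod>i<k. int q - int i)"

definition C_elem :: "nat \<Rightarrow> nat \<Rightarrow> nat \<Rightarrow> free_elem set" where
  "C_elem m n q =
     (\<Oplus>\<^bsub>Ugl m n\<^esub>j \<in> {0..n}.
        [((- 1) ^ (n - j) * falling_factorial q (n - j))] \<cdot>\<^bsub>Ugl m n\<^esub> capelli_elem m n j)"

end

theory Submission
  imports Defs "HOL-Library.Function_Algebras" "HOL-Library.Nat_Bijection"
begin

text \<open>
  Modulo \<open>Irr\<close>, the unit is killed by every \<open>e\<^bsub>a,\<gamma>\<^esub>\<close> with \<open>\<gamma>\<close> virtual. Let \<open>w\<close> be any vector killed by
  the \<open>e\<^bsub>i,\<gamma>\<^esub>\<close> and by \<open>e\<^bsub>\<gamma>,\<gamma>\<^esub>\<close>. Moving \<open>e\<^bsub>\<gamma>,1\<^esub>\<close>, then \<open>e\<^bsub>\<gamma>,2\<^esub>\<close>, and so on to the left through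
  \<open>D = e\<^bsub>n,\<gamma>\<^esub> \<dots> e\<^bsub>1,\<gamma>\<^esub>\<close> expands \<open>D e\<^bsub>\<gamma>,1\<^esub> \<dots> e\<^bsub>\<gamma>,n\<^esub> w\<close> along the columns of a determinant, and the result
  is the \<open>n\<close>-th Capelli element applied to \<open>w\<close>. Since \<open>e\<^bsub>i,j\<^esub> D = D (e\<^bsub>i,j\<^esub> + \<delta>\<^bsub>i,j\<^esub>)\<close>, pulling this element
  out to the left through the \<open>p - 1\<close> products belonging to the other rows shifts the diagonal of
  the determinant by \<open>- (p - 1)\<close>. The shifted determinant is \<open>C\<^sub>n(p - 1)\<close>, because the finite
  difference of a Capelli determinant in the shift is the sum of its principal minors of one size
  less. Induction on \<open>p\<close> gives the formula, with no appeal to centrality.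

  The devirtualization is well defined because \<open>U(gl(n))\<close> meets \<open>Irr\<close> in \<open>0\<close>: the superalgebra acts
  on the tensor product of an exterior algebra in variables \<open>z\<^bsub>\<gamma>,i\<^esub>\<close> with \<open>U(gl(n))\<close>; irregular products
  kill the vacuum \<open>1 \<otimes> 1\<close> for reasons of weight, whereas \<open>u \<in> U(gl(n))\<close> maps it to \<open>1 \<otimes> u\<close>.
\<close>

section \<open>Shifted Capelli determinants\<close>

text \<open>Write x for the e_{i,\<gamma>} and y for the e_{\<gamma>,i}. The Capelli diagonal is a
  weight: while e_{\<gamma>,r} moves left, e_{\<gamma>,\<gamma>} counts the factors e_{\<gamma>,s}
  to its right, and there are n - r of them. The sign collects reorderings: to meet its own x's, the
  y-block of row p + 1 passes p blocks of n odd factors, each at the price (-1)^(n n) = (-1)^n, and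
  0 + 1 + ... + (p - 1) = p choose 2. Two modules are used. The identity is computed in U/Irr, where
  w is the class of 1. The uniqueness of the devirtualization comes from the Fock space, whose
  coefficients are operators on U = U(gl(m|n)) itself: left multiplication detects the elements of
  the subalgebra U(gl(n)) by their value at the unit. A type cannot depend on m, n or an ideal, so
  the quotients are realized on linear complements inside \<open>free_elem\<close>. The commutation
  calculus takes place in an abstract ring, where a vector is represented by an operator whose
  values are multiples of it; an equation X w = Y w then says that X and Y agree on the
  vector.\<close>

definition capelli_entry :: "(nat \<Rightarrow> nat \<Rightarrow> 'r::ring_1) \<Rightarrow> int \<Rightarrow> nat set \<Rightarrow> nat \<Rightarrow> nat \<Rightarrow> 'r" where
  "capelli_entry E t I i j = E i j + (if i = j then of_int (t + int (card {k \<in> I. j < k})) else 0)"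

text \<open>For I = {i_1 < ... < i_k}, the count in \<open>capelli_entry\<close> at j = i_r is k -
  r, so t = 0 gives the column determinant of the Capelli element. Permuting I itself instead of the
  positions 1..k lets the minors for I - {i} keep the indices of I.\<close>

definition capelli_det :: "(nat \<Rightarrow> nat \<Rightarrow> 'r::ring_1) \<Rightarrow> int \<Rightarrow> nat set \<Rightarrow> 'r" where
  "capelli_det E t I =
     (\<Sum>\<sigma> | \<sigma> permutes I. of_int (sign \<sigma>) *
        prod_list (map (\<lambda>j. capelli_entry E t I (\<sigma> j) j) (sorted_list_of_set I)))"

text \<open>The factors need not commute, so a + b is replaced by a in one factor at a time,
  starting from the left; the summand for i is the change made at i. This direction is the one that
  fits the diagonal in \<open>capelli_det_step\<close>.\<close>

lemma prod_list_telescope: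
  fixes a b :: "'i::linorder \<Rightarrow> 'r::ring_1"
  assumes "sorted_wrt (<) L"
  shows "prod_list (map (\<lambda>j. a j + b j) L) - prod_list (map a L) =
    (\<Sum>i\<in>set L. prod_list (map (\<lambda>j. if j < i then a j else if j = i then b j else a j + b j) L))"
  using assms
proof (induction L)
  case (Cons x L)
  let ?f = "\<lambda>i j. if j < i then a j else if j = i then b j else a j + b j"
  have x: "x < y" if "y \<in> set L" for y
    using Cons.prems that by auto
  have "x \<notin> set L" using x by blast
  moreover have "prod_list (map (?f x) L) = prod_list (map (\<lambda>j. a j + b j) L)"
    using x by (intro arg_cong[of _ _ prod_list] map_cong) (auto dest: less_not_sym)
  moreover have "(\<Sum>i\<in>set L. ?f i x * prod_list (map (?f i) L)) =
      (\<Sum>i\<in>set L. a x * prod_list (map (?f i) L))"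
    using x by (intro sum.cong) auto
  ultimately have "(\<Sum>i\<in>set (x # L). prod_list (map (?f i) (x # L))) =
      b x * prod_list (map (\<lambda>j. a j + b j) L) + a x * (\<Sum>i\<in>set L. prod_list (map (?f i) L))"
    by (simp add: sum_distrib_left)
  then show ?case
    using Cons by (simp add: algebra_simps flip: Cons.IH)
qed simp

lemma prod_list_map_remove1:
  fixes f :: "'i \<Rightarrow> 'r::monoid_mult"
  assumes "f x = 1"
  shows "prod_list (map f (remove1 x L)) = prod_list (map f L)"
  using assms by (induction L) auto

lemma prod_list_eq_zero:
  fixes L :: "'r::semiring_1 list"
  assumes "0 \<in> set L"
  shows "prod_list L = 0"
  using assms by (induction L) auto

text \<open>Raising t by one adds 1 to each diagonal entry, so the telescoping leaves one summand
  per fixed point i of \<sigma>. There the columns j < i have shift t, but in I they count i among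
  the larger indices, so they are entries of I - {i} with shift t + 1; the columns j > i have that
  shift already. Summing over the \<sigma> that fix i gives the minor of I - {i}.\<close>

lemma capelli_det_step:
  fixes E :: "nat \<Rightarrow> nat \<Rightarrow> 'r::ring_1"
  assumes fin: "finite I"
  shows "capelli_det E (t + 1) I - capelli_det E t I = (\<Sum>i\<in>I. capelli_det E (t + 1) (I - {i}))"
proof -
  let ?L = "sorted_list_of_set I"
  let ?P = "\<lambda>\<sigma> i. prod_list (map (\<lambda>j. capelli_entry E (t + 1) (I - {i}) (\<sigma> j) j)
      (sorted_list_of_set (I - {i})))"
  have sorted: "sorted_wrt (<) ?L"
    by simp
  have diff: "prod_list (map (\<lambda>j. capelli_entry E (t + 1) I (\<sigma> j) j) ?L)
      - prod_list (map (\<lambda>j. capelli_entry E t I (\<sigma> j) j) ?L) =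
      (\<Sum>i | i \<in> I \<and> \<sigma> i = i. ?P \<sigma> i)" for \<sigma>
  proof -
    define a where "a j = capelli_entry E t I (\<sigma> j) j" for j
    define b :: "nat \<Rightarrow> 'r" where "b j = (if \<sigma> j = j then 1 else 0)" for j
    let ?f = "\<lambda>i j. if j < i then a j else if j = i then b j else a j + b j"
    have ab: "capelli_entry E (t + 1) I (\<sigma> j) j = a j + b j" for j
      by (simp add: a_def b_def capelli_entry_def)
    have "prod_list (map (?f i) ?L) = (if \<sigma> i = i then ?P \<sigma> i else 0)" if i: "i \<in> I" for i
    proof (cases "\<sigma> i = i")
      case True
      have "prod_list (map (?f i) ?L) = prod_list (map (?f i) (remove1 i ?L))"
        by (rule sym, rule prod_list_map_remove1) (simp add: b_def True)
      also have "map (?f i) (remove1 i ?L) =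
          map (\<lambda>j. capelli_entry E (t + 1) (I - {i}) (\<sigma> j) j) (remove1 i ?L)"
      proof (rule map_cong[OF refl])
        fix j assume j: "j \<in> set (remove1 i ?L)"
        then have "j \<noteq> i"
          using fin by auto
        moreover have "j < i \<Longrightarrow> {k \<in> I. j < k} = insert i {k \<in> I - {i}. j < k}"
          using i by auto
        then have "j < i \<Longrightarrow> card {k \<in> I. j < k} = Suc (card {k \<in> I - {i}. j < k})"
          using fin by simp
        moreover have "i < j \<Longrightarrow> {k \<in> I. j < k} = {k \<in> I - {i}. j < k}"
          by auto
        ultimately show "?f i j = capelli_entry E (t + 1) (I - {i}) (\<sigma> j) j"
          by (cases "j < i") (simp_all add: a_def b_def capelli_entry_def)
      qed
      also have "remove1 i ?L = sorted_list_of_set (I - {i})"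
        using fin i by (simp add: sorted_list_of_set_remove)
      finally show ?thesis using True by simp
    next
      case False
      have "0 \<in> set (map (?f i) ?L)"
        using False i fin by (auto simp: b_def image_iff intro!: bexI[of _ i])
      with False show ?thesis
        by (simp add: prod_list_eq_zero)
    qed
    then have "(\<Sum>i\<in>set ?L. prod_list (map (?f i) ?L)) = (\<Sum>i\<in>I. if \<sigma> i = i then ?P \<sigma> i else 0)"
      using fin by (intro sum.cong) auto
    also have "\<dots> = (\<Sum>i | i \<in> I \<and> \<sigma> i = i. ?P \<sigma> i)"
      using fin by (simp add: sum.inter_filter)
    finally show ?thesis
      using prod_list_telescope[OF sorted, of a b] by (simp add: ab flip: a_def)
  qed
  have perm: "{\<sigma>. \<sigma> permutes I \<and> \<sigma> i = i} = {\<sigma>. \<sigma> permutes (I - {i})}" if "i \<in> I" for i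
    using that by (auto simp: permutes_def)
  have "capelli_det E (t + 1) I - capelli_det E t I =
      (\<Sum>\<sigma> | \<sigma> permutes I. \<Sum>i | i \<in> I \<and> \<sigma> i = i. of_int (sign \<sigma>) * ?P \<sigma> i)"
    unfolding capelli_det_def
    by (simp add: sum_distrib_left[symmetric] diff[symmetric] right_diff_distrib sum_subtractf)
  also have "\<dots> = (\<Sum>i\<in>I. \<Sum>\<sigma> | \<sigma> permutes I \<and> \<sigma> i = i. of_int (sign \<sigma>) * ?P \<sigma> i)"
    using sum.swap_restrict[OF finite_permutations[OF fin] fin,
        of "\<lambda>\<sigma> i. of_int (sign \<sigma>) * ?P \<sigma> i" "\<lambda>\<sigma> i. \<sigma> i = i"] by simp
  also have "\<dots> = (\<Sum>i\<in>I. capelli_det E (t + 1) (I - {i}))"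
    unfolding capelli_det_def by (intro sum.cong refl) (simp add: perm)
  finally show ?thesis .
qed

section \<open>Falling factorials and the expansion in the shift\<close>

lemma falling_factorial_0 [simp]: "falling_factorial q 0 = 1"
  by (simp add: falling_factorial_def)

lemma falling_factorial_zero_left: "falling_factorial 0 d = (if d = 0 then 1 else 0)"
  by (cases d) (auto simp: falling_factorial_def)

text \<open>The discrete derivative of (q)_d is d (q)_{d-1}, the counterpart of
  \<open>capelli_det_step\<close>. For d = 0 the factor d makes the truncated d - 1
  harmless.\<close>

lemma falling_factorial_Suc_left:
  "falling_factorial (Suc q) d = falling_factorial q d + int d * falling_factorial q (d - 1)"
proof (cases d)
  case (Suc d')
  have "falling_factorial (Suc q) (Suc d') = (int q + 1) * falling_factorial q d'"
    unfolding falling_factorial_def prod.lessThan_Suc_shift by (simp add: algebra_simps)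
  moreover have "falling_factorial q (Suc d') = falling_factorial q d' * (int q - int d')"
    by (simp add: falling_factorial_def)
  ultimately show ?thesis
    using Suc by (simp add: algebra_simps)
qed simp

text \<open>A Newton expansion, by induction on q with \<open>capelli_det_step\<close> at t = - (q +
  1). A set J is reached through every i in I - J, hence card (I - J) times, which is the factor d
  in \<open>falling_factorial_Suc_left\<close>.\<close>

lemma capelli_det_neg:
  fixes E :: "nat \<Rightarrow> nat \<Rightarrow> 'r::ring_1"
  assumes "finite I"
  shows "capelli_det E (- int q) I =
    (\<Sum>J\<in>Pow I. of_int ((- 1) ^ card (I - J) * falling_factorial q (card (I - J))) * capelli_det E 0 J)"
  using assms
proof (induction q arbitrary: I)
  case 0
  have "(\<Sum>J\<in>Pow I. of_int ((- 1) ^ card (I - J) * falling_factorial 0 (card (I - J))) * capelli_det E 0 J)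
      = (\<Sum>J\<in>Pow I. if J = I then capelli_det E 0 J else 0)"
    using 0 by (intro sum.cong) (auto simp: falling_factorial_zero_left)
  then show ?case
    using 0 by simp
next
  case (Suc q)
  let ?c = "\<lambda>q d. (- 1) ^ d * falling_factorial q d"
  have "(\<Sum>i\<in>I. capelli_det E (- int q) (I - {i})) =
      (\<Sum>i\<in>I. \<Sum>J\<in>Pow (I - {i}). of_int (?c q (card (I - {i} - J))) * capelli_det E 0 J)"
    using Suc by (intro sum.cong) auto
  also have "\<dots> = (\<Sum>i\<in>I. \<Sum>J | J \<in> Pow I \<and> i \<notin> J. of_int (?c q (card (I - J) - 1)) * capelli_det E 0 J)"
  proof (intro sum.cong refl)
    fix i J assume "i \<in> I" "J \<in> {J \<in> Pow I. i \<notin> J}"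
    moreover have "I - {i} - J = I - J - {i}" by auto
    ultimately show "of_int (?c q (card (I - {i} - J))) * capelli_det E 0 J =
        of_int (?c q (card (I - J) - 1)) * capelli_det E 0 J"
      using Suc.prems by simp
  qed auto
  also have "\<dots> = (\<Sum>J\<in>Pow I. \<Sum>i | i \<in> I \<and> i \<notin> J. of_int (?c q (card (I - J) - 1)) * capelli_det E 0 J)"
    using Suc.prems by (intro sum.swap_restrict) auto
  also have "\<dots> = (\<Sum>J\<in>Pow I. of_int (int (card (I - J)) * ?c q (card (I - J) - 1)) * capelli_det E 0 J)"
    by (intro sum.cong refl) (simp add: set_diff_eq[symmetric] mult.assoc)
  finally have "capelli_det E (- int (Suc q)) I =
      (\<Sum>J\<in>Pow I. of_int (?c q (card (I - J)) - int (card (I - J)) * ?c q (card (I - J) - 1)) * capelli_det E 0 J)"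
    using capelli_det_step[OF Suc.prems, of E "- int (Suc q)"] Suc
    by (simp add: algebra_simps sum_subtractf)
  moreover have "?c q d - int d * ?c q (d - 1) = ?c (Suc q) d" for d
    by (cases d) (simp_all add: falling_factorial_Suc_left algebra_simps)
  ultimately show ?case
    by (simp only:)
qed

text \<open>With the sets grouped by size, the inner sums are the Capelli elements and the whole is
  C_n(q).\<close>

lemma capelli_det_neg_card:
  fixes E :: "nat \<Rightarrow> nat \<Rightarrow> 'r::ring_1"
  shows "capelli_det E (- int q) {1..n} =
    (\<Sum>j\<in>{0..n}. of_int ((- 1) ^ (n - j) * falling_factorial q (n - j)) *
       (\<Sum>I | I \<subseteq> {1..n} \<and> card I = j. capelli_det E 0 I))"
proof -
  let ?c = "\<lambda>d. of_int ((- 1) ^ d * falling_factorial q d) :: 'r"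
  have "capelli_det E (- int q) {1..n} = (\<Sum>I\<in>Pow {1..n}. ?c (n - card I) * capelli_det E 0 I)"
    unfolding capelli_det_neg[OF finite_atLeastAtMost]
    by (intro sum.cong refl) (simp add: card_Diff_subset finite_subset[OF _ finite_atLeastAtMost])
  also have "\<dots> = (\<Sum>j\<in>{0..n}. \<Sum>I | I \<in> Pow {1..n} \<and> card I = j. ?c (n - card I) * capelli_det E 0 I)"
    by (rule sum.group[symmetric]) (auto dest: card_mono[rotated])
  also have "\<dots> = (\<Sum>j\<in>{0..n}. ?c (n - j) * (\<Sum>I | I \<subseteq> {1..n} \<and> card I = j. capelli_det E 0 I))"
    by (simp add: sum_distrib_left)
  finally show ?thesis .
qed

section \<open>Representations of the Lie superalgebra\<close>

lemma prod_list_anticommute: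
  fixes z :: "'r::ring_1"
  assumes "\<And>l. l \<in> set L \<Longrightarrow> z * f l = - (f l * z)"
  shows "z * prod_list (map f L) = (- 1) ^ length L * (prod_list (map f L) * z)"
  using assms
proof (induction L)
  case (Cons a L)
  have "z * prod_list (map f (a # L)) = - (f a * (z * prod_list (map f L)))"
    using Cons.prems[of a] by (simp flip: mult.assoc)
  also have "\<dots> = (- 1) ^ length (a # L) * (prod_list (map f (a # L)) * z)"
    using Cons by (simp add: minus_one_power_iff mult.assoc)
  finally show ?case .
qed simp

lemma prod_list_commute:
  fixes z :: "'r::monoid_mult"
  assumes "\<And>l. l \<in> set L \<Longrightarrow> z * f l = f l * z"
  shows "z * prod_list (map f L) = prod_list (map f L) * z"
  using assms
proof (induction L)
  case (Cons a L)
  have "z * prod_list (map f (a # L)) = f a * (z * prod_list (map f L))"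
    using Cons.prems[of a] by (simp flip: mult.assoc)
  then show ?case
    using Cons by (simp add: mult.assoc)
qed simp

text \<open>The sign is needed in rings of operators too, whereas \<open>bracket_sign\<close> has
  its values in \<open>free_elem\<close>.\<close>

definition super_sign :: "symb \<Rightarrow> symb \<Rightarrow> symb \<Rightarrow> symb \<Rightarrow> 'r::ring_1" where
  "super_sign a b c d = (- 1) ^ ((parity a + parity b) * (parity c + parity d))"

lemma super_sign_simps [simp]:
  "super_sign (Virtual g) (Virtual h) c d = 1"
  "super_sign (Proper i) (Proper j) c d = 1"
  "super_sign a b (Virtual g) (Virtual h) = 1"
  "super_sign a b (Proper i) (Proper j) = 1"
  "super_sign (Virtual g) (Proper i) (Virtual h) (Proper j) = - 1"
  "super_sign (Virtual g) (Proper i) (Proper j) (Virtual h) = - 1"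
  "super_sign (Proper i) (Virtual g) (Virtual h) (Proper j) = - 1"
  "super_sign (Proper i) (Virtual g) (Proper j) (Virtual h) = - 1"
  by (simp_all add: super_sign_def)

lemma in_symbols_iff [simp]:
  "Virtual g \<in> symbols m n \<longleftrightarrow> g \<in> {1..m}"
  "Proper i \<in> symbols m n \<longleftrightarrow> i \<in> {1..n}"
  by (auto simp: symbols_def virtual_symbols_def proper_symbols_def)

text \<open>Serves both for the operators on quotients of the free algebra and for the Fock space.
  Without 2-torsion, the anticommutation of an odd x with itself yields x x = 0.\<close>

locale gl_super =
  fixes m n :: nat and e :: "symb \<Rightarrow> symb \<Rightarrow> 'r::ring_1"
  assumes bracket: "\<lbrakk>a \<in> symbols m n; b \<in> symbols m n; c \<in> symbols m n; d \<in> symbols m n\<rbrakk> \<Longrightarrow>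
      e a b * e c d - super_sign a b c d * (e c d * e a b) =
      (if b = c then e a d else 0) - super_sign a b c d * (if a = d then e c b else 0)"
    and two_torsion_free: "z + z = (0::'r) \<Longrightarrow> z = 0"
begin

abbreviation x :: "nat \<Rightarrow> nat \<Rightarrow> 'r" where "x g i \<equiv> e (Proper i) (Virtual g)"
abbreviation y :: "nat \<Rightarrow> nat \<Rightarrow> 'r" where "y g i \<equiv> e (Virtual g) (Proper i)"
abbreviation E :: "nat \<Rightarrow> nat \<Rightarrow> 'r" where "E i j \<equiv> e (Proper i) (Proper j)"
abbreviation G :: "nat \<Rightarrow> nat \<Rightarrow> 'r" where "G g h \<equiv> e (Virtual g) (Virtual h)"

lemma x_y:
  assumes "g \<in> {1..m}" "h \<in> {1..m}" "i \<in> {1..n}" "j \<in> {1..n}"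
  shows "x g i * y h j = (if g = h then E i j else 0) + (if i = j then G h g else 0) - y h j * x g i"
  using bracket[of "Proper i" "Virtual g" "Virtual h" "Proper j"] assms
  by (simp add: algebra_simps)

lemma x_x:
  assumes "g \<in> {1..m}" "h \<in> {1..m}" "i \<in> {1..n}" "j \<in> {1..n}"
  shows "x g i * x h j = - (x h j * x g i)"
  using bracket[of "Proper i" "Virtual g" "Proper j" "Virtual h"] assms
  by (simp add: eq_neg_iff_add_eq_0)

lemma y_y:
  assumes "g \<in> {1..m}" "h \<in> {1..m}" "i \<in> {1..n}" "j \<in> {1..n}"
  shows "y g i * y h j = - (y h j * y g i)"
  using bracket[of "Virtual g" "Proper i" "Virtual h" "Proper j"] assms
  by (simp add: eq_neg_iff_add_eq_0)

lemma E_x: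
  assumes "g \<in> {1..m}" "i \<in> {1..n}" "j \<in> {1..n}" "k \<in> {1..n}"
  shows "E i j * x g k = x g k * E i j + (if j = k then x g i else 0)"
  using bracket[of "Proper i" "Proper j" "Proper k" "Virtual g"] assms
  by (simp add: algebra_simps)

lemma G_x:
  assumes "g \<in> {1..m}" "i \<in> {1..n}"
  shows "G g g * x g i = x g i * G g g - x g i"
  using bracket[of "Virtual g" "Virtual g" "Proper i" "Virtual g"] assms
  by (simp add: algebra_simps)

lemma G_y:
  assumes "g \<in> {1..m}" "h \<in> {1..m}" "h' \<in> {1..m}" "i \<in> {1..n}"
  shows "G h h' * y g i = y g i * G h h' + (if h' = g then y h i else 0)"
  using bracket[of "Virtual h" "Virtual h'" "Virtual g" "Proper i"] assms
  by (simp add: algebra_simps)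

section \<open>Products of odd generators with one virtual symbol\<close>

definition xs :: "nat \<Rightarrow> nat list \<Rightarrow> 'r" where
  "xs g L = prod_list (map (x g) L)"

definition ys :: "nat \<Rightarrow> nat list \<Rightarrow> 'r" where
  "ys g L = prod_list (map (y g) L)"

lemma xs_simps [simp]: "xs g [] = 1" "xs g (i # L) = x g i * xs g L" "xs g (L @ L') = xs g L * xs g L'"
  and ys_simps [simp]: "ys g [] = 1" "ys g (i # L) = y g i * ys g L"
  by (simp_all add: xs_def ys_def)

lemma x_xs:
  assumes "g \<in> {1..m}" "i \<in> {1..n}" "set L \<subseteq> {1..n}"
  shows "x g i * xs g L = (- 1) ^ length L * (xs g L * x g i)"
  unfolding xs_def using assms by (intro prod_list_anticommute x_x) auto

text \<open>A repeated factor moves next to its twin, up to sign, and x x = 0.\<close>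

lemma xs_not_distinct:
  assumes "g \<in> {1..m}" "set L \<subseteq> {1..n}" "\<not> distinct L"
  shows "xs g L = 0"
proof -
  obtain L1 L2 L3 i where L: "L = L1 @ [i] @ L2 @ [i] @ L3"
    using not_distinct_decomp[OF assms(3)] by blast
  have i: "i \<in> {1..n}"
    using assms(2) L by auto
  have "x g i * x g i = 0"
    by (rule two_torsion_free, subst eq_neg_iff_add_eq_0[symmetric], rule x_x[OF assms(1,1) i i])
  moreover have "x g i * xs g L2 = (- 1) ^ length L2 * (xs g L2 * x g i)"
    using assms(1,2) i L by (intro x_xs) auto
  ultimately have "x g i * xs g L2 * x g i = 0"
    by (simp add: mult.assoc)
  moreover have "xs g L = xs g L1 * (x g i * xs g L2 * x g i) * xs g L3"
    by (simp add: L mult.assoc)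
  ultimately show ?thesis
    by simp
qed

lemma E_xs:
  assumes "g \<in> {1..m}" "i \<in> {1..n}" "j \<in> {1..n}" "set L \<subseteq> {1..n}" "distinct L"
  shows "E i j * xs g L = xs g L * E i j +
    (if j \<in> set L then xs g (map (\<lambda>k. if k = j then i else k) L) else 0)"
  using assms(4,5)
proof (induction L)
  case (Cons k L)
  have [simp]: "map (\<lambda>l. if l = h then i else l) L = L" if "h \<notin> set L" for h
    using that by (intro map_idI) auto
  have "E i j * xs g (k # L) = (x g k * E i j + (if j = k then x g i else 0)) * xs g L"
    using E_x[of g i j k] assms Cons.prems by (simp flip: mult.assoc)
  also have "\<dots> = x g k * (E i j * xs g L) + (if j = k then x g i * xs g L else 0)"
    by (simp add: algebra_simps)
  also have "\<dots> = xs g (k # L) * E i j +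
      (if j \<in> set (k # L) then xs g (map (\<lambda>k. if k = j then i else k) (k # L)) else 0)"
    using Cons by (auto simp: algebra_simps)
  finally show ?case .
qed simp

text \<open>\<open>E i j\<close> acts as a derivation that replaces j by i. For i \<noteq> j the
  result contains i twice and vanishes; for i = j the full product comes back once.\<close>

lemma E_xs_full:
  assumes "g \<in> {1..m}" "i \<in> {1..n}" "j \<in> {1..n}"
  shows "E i j * xs g (rev [1..<Suc n]) = xs g (rev [1..<Suc n]) * (E i j + (if i = j then 1 else 0))"
proof (cases "i = j")
  case True
  then have "map (\<lambda>k. if k = j then i else k) (rev [1..<Suc n]) = rev [1..<Suc n]"
    by (intro map_idI) auto
  then show ?thesis
    using E_xs[of g i j "rev [1..<Suc n]"] assms True
    by (simp add: distrib_left atLeastLessThanSuc_atLeastAtMost add.commute del: upt_Suc)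
next
  case False
  let ?f = "\<lambda>k. if k = j then i else k"
  have "?f i = ?f j" "i \<in> set (rev [1..<Suc n])" "j \<in> set (rev [1..<Suc n])"
    using assms by auto
  then have "\<not> inj_on ?f (set (rev [1..<Suc n]))"
    using False inj_onD[of ?f "set (rev [1..<Suc n])" i j] by auto
  then have "\<not> distinct (map ?f (rev [1..<Suc n]))"
    by (simp add: distinct_map del: upt_Suc)
  then have "xs g (map ?f (rev [1..<Suc n])) = 0"
    using assms by (intro xs_not_distinct) auto
  then show ?thesis
    using E_xs[of g i j "rev [1..<Suc n]"] assms False
    by (simp add: atLeastLessThanSuc_atLeastAtMost del: upt_Suc)
qed

text \<open>Each diagonal entry gains 1 on its way through the product and the other entries are
  unchanged. Read from right to left: a determinant that leaves through one row of x's has its shift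
  lowered by 1.\<close>

lemma capelli_det_xs_full:
  assumes "g \<in> {1..m}"
  shows "capelli_det E t {1..n} * xs g (rev [1..<Suc n]) =
    xs g (rev [1..<Suc n]) * capelli_det E (t + 1) {1..n}"
proof -
  let ?D = "xs g (rev [1..<Suc n])"
  have entry: "capelli_entry E t {1..n} i j * ?D = ?D * capelli_entry E (t + 1) {1..n} i j"
    if "i \<in> {1..n}" "j \<in> {1..n}" for i j
  proof -
    define s :: 'r where "s = (if i = j then of_int (t + int (card {k \<in> {1..n}. j < k})) else 0)"
    have "s * ?D = ?D * s"
      by (cases "i = j") (simp_all only: s_def simp_thms if_True if_False mult_of_int_commute
        mult_zero_left mult_zero_right)
    moreover have "capelli_entry E t {1..n} i j = E i j + s"
      and "capelli_entry E (t + 1) {1..n} i j = E i j + (if i = j then 1 else 0) + s"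
      by (simp_all add: capelli_entry_def s_def)
    ultimately show ?thesis
      using E_xs_full[OF assms that] by (simp only: distrib_left distrib_right)
  qed
  have prod: "prod_list (map (\<lambda>j. capelli_entry E t {1..n} (\<sigma> j) j) L) * ?D =
      ?D * prod_list (map (\<lambda>j. capelli_entry E (t + 1) {1..n} (\<sigma> j) j) L)"
    if "\<sigma> permutes {1..n}" "set L \<subseteq> {1..n}" for \<sigma> L
    using that(2)
  proof (induction L)
    case (Cons j L)
    let ?a = "\<lambda>t j. capelli_entry E t {1..n} (\<sigma> j) j"
    have "prod_list (map (?a t) (j # L)) * ?D = ?a t j * (prod_list (map (?a t) L) * ?D)"
      by (simp add: mult.assoc del: upt_Suc)
    also have "\<dots> = (?a t j * ?D) * prod_list (map (?a (t + 1)) L)"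
      using Cons by (simp add: mult.assoc del: upt_Suc)
    also have "\<dots> = ?D * prod_list (map (?a (t + 1)) (j # L))"
      using entry[of "\<sigma> j" j] permutes_in_image[OF that(1), of j] Cons.prems
      by (simp add: mult.assoc del: upt_Suc)
    finally show ?case .
  qed simp
  let ?p = "\<lambda>t \<sigma>. prod_list (map (\<lambda>j. capelli_entry E t {1..n} (\<sigma> j) j) (sorted_list_of_set {1..n}))"
  have "of_int (sign \<sigma>) * ?p t \<sigma> * ?D = ?D * (of_int (sign \<sigma>) * ?p (t + 1) \<sigma>)"
    if "\<sigma> permutes {1..n}" for \<sigma>
  proof -
    have "of_int (sign \<sigma>) * ?p t \<sigma> * ?D = of_int (sign \<sigma>) * ?D * ?p (t + 1) \<sigma>"
      using prod[OF that, of "sorted_list_of_set {1..n}"]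
      by (simp only: mult.assoc set_sorted_list_of_set finite_atLeastAtMost order_refl)
    also have "of_int (sign \<sigma>) * ?D = ?D * of_int (sign \<sigma>)"
      by (rule mult_of_int_commute)
    finally show ?thesis
      by (simp only: mult.assoc)
  qed
  then show ?thesis
    unfolding capelli_det_def sum_distrib_left sum_distrib_right by (intro sum.cong) auto
qed


text \<open>
  When \<open>G g g\<close> acts on \<open>z\<close> as \<open>d\<close>, the integers by which it acts after the first
  factors \<open>x\<close> have been passed and the terms from commuting \<open>E\<close> with \<open>x\<close> add up to
  the constant shift \<open>d\<close>.
\<close>

lemma xs_y:
  fixes a :: "nat \<Rightarrow> nat"
  assumes g: "g \<in> {1..m}" and c: "c \<in> {1..n}" and a: "\<And>t. t \<in> {s..<k} \<Longrightarrow> a t \<in> {1..n}"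
    and z: "G g g * z = of_int d * z" and "s \<le> k"
  shows "xs g (map a (rev [s..<k])) * (y g c * z) =
    (\<Sum>b\<in>{s..<k}. (- 1) ^ (b - s) * ((E (a b) c + (if a b = c then of_int d else 0)) *
       (xs g (map a (rev [Suc b..<k]) @ map a (rev [s..<b])) * z)))
    + (- 1) ^ (k - s) * (y g c * (xs g (map a (rev [s..<k])) * z))"
  using \<open>s \<le> k\<close> a
proof (induction k rule: dec_induct)
  case (step k)
  let ?X = "xs g (map a (rev [s..<k]))"
  let ?R = "\<lambda>k b. xs g (map a (rev [Suc b..<k]) @ map a (rev [s..<b]))"
  let ?F = "\<lambda>b. E (a b) c + (if a b = c then of_int d else 0)"
  have ak: "a k \<in> {1..n}" and ab: "\<And>b. b \<in> {s..<k} \<Longrightarrow> a b \<in> {1..n}"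
    using step by auto
  have R: "?R (Suc k) b = x g (a k) * ?R k b" if "b \<in> {s..<k}" for b
    using that by (simp add: mult.assoc)
  \<comment> \<open>To return to its slot, x_{a b} passes the k - Suc b factors with index above
    b.\<close>
  have remove: "x g (a b) * ?R k b = (- 1) ^ (k - Suc b) * ?X" if b: "b \<in> {s..<k}" for b
  proof -
    have "set (map a (rev [Suc b..<k])) \<subseteq> {1..n}"
      using ab b by force
    then have "x g (a b) * xs g (map a (rev [Suc b..<k])) =
        (- 1) ^ (k - Suc b) * (xs g (map a (rev [Suc b..<k])) * x g (a b))"
      using x_xs[OF g ab[OF b], of "map a (rev [Suc b..<k])"] by (simp only: length_map length_rev length_upt)
    moreover have "[s..<k] = [s..<b] @ b # [Suc b..<k]"
      using b upt_add_eq_append[of s b "k - b"] by (simp add: upt_conv_Cons)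
    then have "?X = xs g (map a (rev [Suc b..<k])) * (x g (a b) * xs g (map a (rev [s..<b])))"
      by (simp add: mult.assoc)
    ultimately show ?thesis
      by (simp only: xs_simps flip: mult.assoc)
  qed
  have weight: "G g g * (xs g L * z) = of_int (d - int (length L)) * (xs g L * z)"
    if "set L \<subseteq> {1..n}" for L
    using that
  proof (induction L)
    case (Cons l L)
    have "G g g * (xs g (l # L) * z) = (x g l * G g g - x g l) * (xs g L * z)"
      using G_x[OF g, of l] Cons.prems by (simp flip: mult.assoc)
    also have "\<dots> = x g l * (G g g * (xs g L * z)) - x g l * (xs g L * z)"
      by (simp add: left_diff_distrib mult.assoc)
    also have "\<dots> = x g l * (of_int (d - int (length L)) * (xs g L * z)) - x g l * (xs g L * z)"
      using Cons by simp
    also have "\<dots> = of_int (d - int (length L)) * (x g l * (xs g L * z)) - x g l * (xs g L * z)"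
      by (metis mult.assoc mult_of_int_commute)
    finally show ?case
      by (simp add: algebra_simps)
  qed (use z in simp)
  have F: "x g (a k) * (?F b * v) = ?F b * (x g (a k) * v) - (if a k = c then x g (a b) * v else 0)"
    if "b \<in> {s..<k}" for b v
    using E_x[OF g ab[OF that] c ak]
    by (simp add: distrib_left distrib_right mult_of_int_commute flip: mult.assoc)
  have xy: "x g (a k) * (y g c * v) =
      E (a k) c * v + (if a k = c then G g g * v else 0) - y g c * (x g (a k) * v)" for v
    using x_y[OF g g ak c] by (simp add: distrib_right left_diff_distrib flip: mult.assoc)
  have sign: "x g (a k) * ((- 1) ^ l * v) = (- 1) ^ l * (x g (a k) * v)" for l v
    by (simp add: minus_one_power_iff)
  have "(\<Sum>b\<in>{s..<k}. (- 1) ^ (b - s) * (x g (a b) * (?R k b * z))) =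
      (\<Sum>b\<in>{s..<k}. - ((- 1) ^ (k - s) * (?X * z)))"
  proof (rule sum.cong[OF refl])
    fix b assume b: "b \<in> {s..<k}"
    then have "x g (a b) * (?R k b * z) = (- 1) ^ (k - Suc b) * (?X * z)"
      using remove by (simp only: flip: mult.assoc)
    moreover have "(- 1 :: 'r) ^ (b - s) * (- 1) ^ (k - Suc b) = - ((- 1) ^ (k - s))"
      using b by (auto simp: minus_one_power_iff)
    ultimately show "(- 1) ^ (b - s) * (x g (a b) * (?R k b * z)) = - ((- 1) ^ (k - s) * (?X * z))"
      by (simp only: mult_minus_left flip: mult.assoc)
  qed
  \<comment> \<open>If a k = c, commuting x past the E's contributes k - s times (-1)^(k-s)
    \<open>?X\<close> z in all, while e_{g,g} acts on \<open>?X\<close> z as d - (k - s). The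
    multiples of k - s cancel, and d remains as the diagonal constant of the new summand b =
    k.\<close>
  then have cross: "(\<Sum>b\<in>{s..<k}. (- 1) ^ (b - s) * (x g (a b) * (?R k b * z))) =
      - (of_int (int (k - s)) * ((- 1) ^ (k - s) * (?X * z)))"
    by simp
  have GX: "G g g * (?X * z) = of_int d * (?X * z) - of_int (int (k - s)) * (?X * z)"
    using weight[of "map a (rev [s..<k])"] ab by (simp add: left_diff_distrib image_subset_iff)
  have "xs g (map a (rev [s..<Suc k])) * (y g c * z) = x g (a k) * (?X * (y g c * z))"
    using step.hyps by (simp add: mult.assoc)
  also have "\<dots> = (\<Sum>b\<in>{s..<k}. (- 1) ^ (b - s) * (x g (a k) * (?F b * (?R k b * z))))
      + (- 1) ^ (k - s) * (x g (a k) * (y g c * (?X * z)))"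
    by (subst step.IH) (simp_all only: ab distrib_left sum_distrib_left sign)
  also have "\<dots> = (\<Sum>b\<in>{s..<k}. (- 1) ^ (b - s) * (?F b * (?R (Suc k) b * z)))
      - (\<Sum>b\<in>{s..<k}. (- 1) ^ (b - s) * (if a k = c then x g (a b) * (?R k b * z) else 0))
      + (- 1) ^ (k - s) * (x g (a k) * (y g c * (?X * z)))"
    unfolding sum_subtractf[symmetric] right_diff_distrib[symmetric]
    by (rule arg_cong[of _ _ "\<lambda>v. v + _"], rule sum.cong[OF refl])
      (simp only: F R mult.assoc)
  also have "(\<Sum>b\<in>{s..<k}. (- 1) ^ (b - s) * (if a k = c then x g (a b) * (?R k b * z) else 0)) =
      - (if a k = c then of_int (int (k - s)) * ((- 1) ^ (k - s) * (?X * z)) else 0)"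
    using cross by simp
  also have "(- 1) ^ (k - s) * (x g (a k) * (y g c * (?X * z))) =
      (- 1) ^ (k - s) * (?F k * (?R (Suc k) k * z))
      - (if a k = c then of_int (int (k - s)) * ((- 1) ^ (k - s) * (?X * z)) else 0)
      + (- 1) ^ (Suc k - s) * (y g c * (xs g (map a (rev [s..<Suc k])) * z))"
    using step.hyps GX unfolding xy
    by (auto simp: minus_one_power_iff algebra_simps Suc_diff_le)
  finally show ?case
    using step.hyps by (simp add: algebra_simps)
qed simp


section \<open>The determinant produced by one row\<close>

lemma of_int_mult_left_commute: "of_int k * (u * v) = u * (of_int k * v :: 'r)"
  by (metis mult.assoc mult_of_int_commute)

lemma G_ys:
  assumes g: "g \<in> {1..m}" and "set L \<subseteq> {1..n}" and w: "G g g * w = 0"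
  shows "G g g * (ys g L * w) = of_int (int (length L)) * (ys g L * w)"
  using assms(2)
proof (induction L)
  case (Cons i L)
  have "G g g * (ys g (i # L) * w) = (y g i * G g g + y g i) * (ys g L * w)"
    using G_y[OF g g g, of i] Cons.prems by (simp flip: mult.assoc)
  also have "\<dots> = y g i * (G g g * (ys g L * w)) + y g i * (ys g L * w)"
    by (simp add: distrib_right mult.assoc)
  also have "G g g * (ys g L * w) = of_int (int (length L)) * (ys g L * w)"
    using Cons by simp
  also have "y g i * (of_int (int (length L)) * (ys g L * w)) =
      of_int (int (length L)) * (y g i * (ys g L * w))"
    by (metis mult.assoc mult_of_int_commute)
  finally show ?case
    by (simp add: distrib_right mult.assoc)
qed (simp add: w)

text \<open>Every y absorbs at most one x: each term of \<open>xs_y\<close> has one y fewer to the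
  right of the x's and at most one x fewer. So some x is left over and reaches w.\<close>

lemma xs_ys_eq_0:
  assumes g: "g \<in> {1..m}" and "set L \<subseteq> {1..n}" "set L' \<subseteq> {1..n}"
    and x: "\<And>i. i \<in> {1..n} \<Longrightarrow> x g i * w = 0" and G: "G g g * w = 0"
    and "length L' < length L"
  shows "xs g L * (ys g L' * w) = 0"
  using assms(2,3,6)
proof (induction L' arbitrary: L)
  case Nil
  then obtain L1 i where L: "L = L1 @ [i]"
    by (cases L rule: rev_cases) auto
  then have "x g i * w = 0"
    using Nil.prems by (intro x) auto
  then show ?case
    unfolding L by (simp add: mult.assoc)
next
  case (Cons c L')
  define k where "k = length L"
  \<comment> \<open>\<open>xs_y\<close> numbers the factors from the right.\<close>
  define a where "a t = rev L ! t" for t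
  have L: "L = map a (rev [0..<k])"
    using map_nth[of "rev L"] by (simp add: a_def[abs_def] k_def flip: rev_map)
  have a: "a t \<in> {1..n}" if "t \<in> {0..<k}" for t
    using Cons.prems(1) that unfolding L set_map set_rev set_upt by blast
  have sub: "set (map a (rev [Suc b..<k]) @ map a (rev [0..<b])) \<subseteq> {1..n}" if "b \<in> {0..<k}" for b
    using that a by force
  have rest: "xs g (map a (rev [Suc b..<k]) @ map a (rev [0..<b])) * (ys g L' * w) = 0"
    if "b \<in> {0..<k}" for b
    using Cons.prems sub[OF that] that by (intro Cons.IH) (auto simp: k_def)
  have full: "xs g (map a (rev [0..<k])) * (ys g L' * w) = 0"
    using Cons.prems by (intro Cons.IH) (auto simp: L[symmetric])
  have "xs g (map a (rev [0..<k])) * (y g c * (ys g L' * w)) = 0"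
    using Cons.prems(2)
    by (subst xs_y[OF g _ a G_ys[OF g _ G]]) (simp_all add: rest full del: xs_simps)
  then show ?case
    unfolding L by (simp add: mult.assoc)
qed

text \<open>Repeated expansion along the first column: b is the position of the x absorbed by y_{c
  s}, and a permutation is split as \<open>transpose s b \<circ> q\<close> with q fixing s. The
  constant k - Suc t is the weight, computed in \<open>G_ys\<close>, of the y's to the right of y_{c
  t}.\<close>

lemma xs_ys:
  fixes a c :: "nat \<Rightarrow> nat"
  assumes g: "g \<in> {1..m}" and c: "\<And>t. t \<in> {s..<k} \<Longrightarrow> c t \<in> {1..n}"
    and x: "\<And>i. i \<in> {1..n} \<Longrightarrow> x g i * w = 0" and G: "G g g * w = 0" and "s \<le> k"
    and a: "\<And>t. t \<in> {s..<k} \<Longrightarrow> a t \<in> {1..n}"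
  shows "xs g (map a (rev [s..<k])) * (ys g (map c [s..<k]) * w) =
    (\<Sum>q | q permutes {s..<k}. of_int (sign q) *
       prod_list (map (\<lambda>t. E (a (q t)) (c t) +
         (if a (q t) = c t then of_int (int (k - Suc t)) else 0)) [s..<k])) * w"
  using \<open>s \<le> k\<close> a c
proof (induction s arbitrary: a rule: inc_induct)
  case base
  then show ?case by simp
next
  case (step s)
  let ?F = "\<lambda>a q t. E (a (q t)) (c t) + (if a (q t) = c t then of_int (int (k - Suc t)) else 0)"
  let ?z = "ys g (map c [Suc s..<k]) * w"
  have split: "[s..<k] = s # [Suc s..<k]"
    using step.hyps by (simp add: upt_conv_Cons)
  have cs: "c s \<in> {1..n}" and sub: "set (map c [Suc s..<k]) \<subseteq> {1..n}"
    using step by auto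
  have z: "G g g * ?z = of_int (int (k - Suc s)) * ?z"
    using G_ys[OF g sub G] by (simp del: upt_Suc)
  \<comment> \<open>This kills the last term of \<open>xs_y\<close>, where y_{c s} has moved to the
    far left: k - s factors x face only k - Suc s factors y.\<close>
  have zero: "xs g (map a (rev [s..<k])) * ?z = 0"
    using step sub by (intro xs_ys_eq_0[OF g _ sub x G]) auto
  have ys_split: "ys g (map c [s..<k]) * w = y g (c s) * ?z"
    by (simp add: split mult.assoc)
  have summand: "(- 1) ^ (b - s) * (?F a (\<lambda>_. b) s *
      (xs g (map a (rev [Suc b..<k]) @ map a (rev [s..<b])) * ?z)) =
      (\<Sum>q | q permutes {Suc s..<k}. of_int (sign (transpose s b \<circ> q)) *
        prod_list (map (?F a (transpose s b \<circ> q)) [s..<k])) * w" if b: "b \<in> {s..<k}" for b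
  proof -
    let ?a = "\<lambda>t. a (transpose s b t)"
    have a: "?a t \<in> {1..n}" if "t \<in> {Suc s..<k}" for t
      using that b step.prems(1) by (auto simp: transpose_def)
    \<comment> \<open>With b deleted, x_{a s} stands last; in the list of \<open>?a\<close> it
      occupies slot b, which is b - Suc s exchanges away. The sign of the transposition accounts for
      the remaining - 1.\<close>
    have swap: "(- 1) ^ (b - s) * xs g (map a (rev [Suc b..<k]) @ map a (rev [s..<b])) =
        of_int (sign (transpose s b)) * xs g (map ?a (rev [Suc s..<k]))"
    proof (cases "b = s")
      case False
      have "[Suc s..<k] = [Suc s..<b] @ b # [Suc b..<k]"
        using b False upt_add_eq_append[of "Suc s" b "k - b"] by (simp add: upt_conv_Cons)
      moreover have "xs g (map ?a (rev [Suc b..<k])) = xs g (map a (rev [Suc b..<k]))"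
        using b by (intro arg_cong[of _ _ "xs g"] map_cong) (auto simp: transpose_def)
      moreover have "xs g (map ?a (rev [Suc s..<b])) = xs g (map a (rev [Suc s..<b]))"
        by (intro arg_cong[of _ _ "xs g"] map_cong) (auto simp: transpose_def)
      ultimately have "xs g (map ?a (rev [Suc s..<k])) =
          xs g (map a (rev [Suc b..<k])) * (x g (a s) * xs g (map a (rev [Suc s..<b])))"
        by (simp add: mult.assoc)
      also have "x g (a s) * xs g (map a (rev [Suc s..<b])) =
          (- 1) ^ (b - Suc s) * (xs g (map a (rev [Suc s..<b])) * x g (a s))"
        using step b x_xs[of g "a s" "map a (rev [Suc s..<b])"] g
        by (simp add: image_subset_iff)
      also have "xs g (map a (rev [Suc s..<b])) * x g (a s) = xs g (map a (rev [s..<b]))"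
        using b False by (simp add: upt_conv_Cons)
      finally show ?thesis
        using b False by (auto simp: sign_swap_id minus_one_power_iff)
    qed simp
    have sign: "of_int (sign (transpose s b \<circ> q)) * prod_list (map (?F a (transpose s b \<circ> q)) [s..<k]) * w =
        of_int (sign (transpose s b)) * (?F a (\<lambda>_. b) s * (of_int (sign q) *
        prod_list (map (?F ?a q) [Suc s..<k]) * w))" if q: "q permutes {Suc s..<k}" for q
    proof -
      have "q s = s"
        using q by (auto simp: permutes_def)
      then have P: "prod_list (map (?F a (transpose s b \<circ> q)) [s..<k]) =
          ?F a (\<lambda>_. b) s * prod_list (map (?F ?a q) [Suc s..<k])"
        by (simp add: split)
      have "sign (transpose s b \<circ> q) = sign (transpose s b) * sign q"
        using q by (intro sign_compose permutation_swap_id permutes_imp_permutation) auto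
      then show ?thesis
        unfolding P by (simp only: of_int_mult mult.assoc of_int_mult_left_commute[of "sign q"])
    qed
    have "(- 1) ^ (b - s) * (?F a (\<lambda>_. b) s *
        (xs g (map a (rev [Suc b..<k]) @ map a (rev [s..<b])) * ?z)) =
        ?F a (\<lambda>_. b) s * (((- 1) ^ (b - s) *
        xs g (map a (rev [Suc b..<k]) @ map a (rev [s..<b]))) * ?z)"
      by (simp add: minus_one_power_iff mult.assoc del: xs_simps)
    also have "\<dots> = of_int (sign (transpose s b)) *
        (?F a (\<lambda>_. b) s * (xs g (map ?a (rev [Suc s..<k])) * ?z))"
      unfolding swap by (simp add: sign_swap_id del: xs_simps)
    also have "xs g (map ?a (rev [Suc s..<k])) * ?z =
        (\<Sum>q | q permutes {Suc s..<k}. of_int (sign q) * prod_list (map (?F ?a q) [Suc s..<k])) * w"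
      using a step.prems by (intro step.IH) auto
    also have "of_int (sign (transpose s b)) * (?F a (\<lambda>_. b) s *
        ((\<Sum>q | q permutes {Suc s..<k}. of_int (sign q) * prod_list (map (?F ?a q) [Suc s..<k])) * w)) =
        (\<Sum>q | q permutes {Suc s..<k}. of_int (sign (transpose s b \<circ> q)) *
          prod_list (map (?F a (transpose s b \<circ> q)) [s..<k])) * w"
      unfolding sum_distrib_left sum_distrib_right
      by (rule sum.cong[OF refl]) (simp only: mem_Collect_eq sign)
    finally show ?thesis .
  qed
  have "xs g (map a (rev [s..<k])) * (ys g (map c [s..<k]) * w) =
      (\<Sum>b\<in>{s..<k}. (- 1) ^ (b - s) * (?F a (\<lambda>_. b) s *
        (xs g (map a (rev [Suc b..<k]) @ map a (rev [s..<b])) * ?z)))"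
    using step.hyps by (subst ys_split, subst xs_y[OF g cs step.prems(1) z]) (simp_all only: zero, simp_all)
  also have "\<dots> = (\<Sum>b\<in>{s..<k}. (\<Sum>q | q permutes {Suc s..<k}. of_int (sign (transpose s b \<circ> q)) *
        prod_list (map (?F a (transpose s b \<circ> q)) [s..<k])) * w)"
    by (rule sum.cong[OF refl]) (rule summand)
  also have "\<dots> = (\<Sum>q | q permutes {s..<k}. of_int (sign q) * prod_list (map (?F a q) [s..<k])) * w"
  proof -
    have "insert s {Suc s..<k} = {s..<k}"
      using step.hyps by auto
    moreover have "s \<notin> {Suc s..<k}"
      by simp
    ultimately show ?thesis
      using sum_over_permutations_insert[of "{Suc s..<k}" s
        "\<lambda>q. of_int (sign q) * prod_list (map (?F a q) [s..<k])"]
      by (simp only: finite_atLeastLessThan simp_thms flip: sum_distrib_right)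
  qed
  finally show ?case .
qed

lemma xs_ys_full:
  assumes g: "g \<in> {1..m}" and x: "\<And>i. i \<in> {1..n} \<Longrightarrow> x g i * w = 0" and G: "G g g * w = 0"
  shows "xs g (rev [1..<Suc n]) * (ys g [1..<Suc n] * w) = capelli_det E 0 {1..n} * w"
proof -
  have "{k \<in> {1..n}. t < k} = {Suc t..n}" for t
    by auto
  then have entry: "E (\<sigma> t) t + (if \<sigma> t = t then of_int (int (Suc n - Suc t)) else 0) =
      capelli_entry E 0 {1..n} (\<sigma> t) t" for \<sigma> t
    by (simp add: capelli_entry_def)
  have "xs g (map (\<lambda>t. t) (rev [1..<Suc n])) * (ys g (map (\<lambda>t. t) [1..<Suc n]) * w) =
      (\<Sum>\<sigma> | \<sigma> permutes {1..<Suc n}. of_int (sign \<sigma>) *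
       prod_list (map (\<lambda>t. E (\<sigma> t) t +
         (if \<sigma> t = t then of_int (int (Suc n - Suc t)) else 0)) [1..<Suc n])) * w"
    by (rule xs_ys[OF g _ x G]) auto
  moreover have "sorted_list_of_set {1..n} = [1..<Suc n]"
    by (metis sorted_list_of_set_range atLeastLessThanSuc_atLeastAtMost)
  ultimately show ?thesis
    unfolding capelli_det_def entry by (simp add: atLeastLessThanSuc_atLeastAtMost del: upt_Suc)
qed

section \<open>Rows with different virtual symbols\<close>

definition kills :: "nat \<Rightarrow> 'r \<Rightarrow> bool" where
  "kills h v \<longleftrightarrow> (\<forall>g\<in>{1..m}. G g h * v = 0) \<and> (\<forall>i\<in>{1..n}. x h i * v = 0)"

text \<open>Commuting \<open>x h i\<close> past \<open>y g i\<close> leaves the mixed element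
  \<open>G g h\<close>. This is why \<open>kills\<close> asks for all first indices g and not only
  for \<open>G h h\<close>; in this form it is stable under the y's of the other rows.\<close>

lemma kills_y:
  assumes "kills h v" "g \<noteq> h" "g \<in> {1..m}" "h \<in> {1..m}" "j \<in> {1..n}"
  shows "kills h (y g j * v)"
proof -
  have "G g' h * (y g j * v) = 0" if "g' \<in> {1..m}" for g'
  proof -
    have "G g' h * (y g j * v) = y g j * (G g' h * v)"
      using G_y[of g g' h j] assms that by (simp flip: mult.assoc)
    then show ?thesis
      using assms that by (simp add: kills_def)
  qed
  moreover have "x h i * (y g j * v) = 0" if "i \<in> {1..n}" for i
  proof -
    have "x h i * (y g j * v) = (if i = j then G g h * v else 0) - y g j * (x h i * v)"
      using x_y[of h g i j] assms that by (simp add: left_diff_distrib flip: mult.assoc)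
    then show ?thesis
      using assms that by (simp add: kills_def)
  qed
  ultimately show ?thesis
    by (simp add: kills_def)
qed

lemma kills_ys:
  assumes "kills h v" "g \<noteq> h" "g \<in> {1..m}" "h \<in> {1..m}" "set L \<subseteq> {1..n}"
  shows "kills h (ys g L * v)"
  using assms(5,1-4) by (induction L) (auto simp: mult.assoc intro!: kills_y)

lemma ys_anticommute:
  assumes "g \<in> {1..m}" "h \<in> {1..m}"
  shows "ys h [1..<Suc n] * ys g [1..<Suc n] = (- 1) ^ n * (ys g [1..<Suc n] * ys h [1..<Suc n])"
proof -
  have y: "y h i * ys g [1..<Suc n] = (- 1) ^ n * (ys g [1..<Suc n] * y h i)" if "i \<in> {1..n}" for i
    using prod_list_anticommute[of "[1..<Suc n]" "y h i" "y g"] y_y[OF assms(2,1) that]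
    by (simp add: ys_def del: upt_Suc)
  have "ys h L * ys g [1..<Suc n] = (- 1) ^ (n * length L) * (ys g [1..<Suc n] * ys h L)"
    if "set L \<subseteq> {1..n}" for L
    using that
  proof (induction L)
    case (Cons i L)
    have "ys h (i # L) * ys g [1..<Suc n] = y h i * ((- 1) ^ (n * length L) * (ys g [1..<Suc n] * ys h L))"
      using Cons by (simp add: mult.assoc del: upt_Suc)
    also have "\<dots> = (- 1) ^ (n * length L) * ((y h i * ys g [1..<Suc n]) * ys h L)"
      by (simp add: minus_one_power_iff mult.assoc del: upt_Suc)
    also have "\<dots> = (- 1) ^ (n * length (i # L)) * (ys g [1..<Suc n] * ys h (i # L))"
      using y[of i] Cons.prems by (simp add: mult.assoc power_add del: upt_Suc)
        (simp add: minus_one_power_iff del: upt_Suc)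
    finally show ?case .
  qed simp
  \<comment> \<open>The exponent n * n has the parity of n.\<close>
  from this[of "[1..<Suc n]"] show ?thesis
    by (simp add: minus_one_power_iff atLeastLessThanSuc_atLeastAtMost del: upt_Suc)
qed

text \<open>The induction peels off the last row. Its x's are already the rightmost ones and its y's
  move left past the other y's, so the row becomes a determinant with shift 0 between the remaining
  x's and y's. Leaving through p rows of x's gives it the shift - p. The factor with the largest q
  thus ends up leftmost, in the order \<open>rev [0..<p]\<close>.\<close>

theorem deruyts_word:
  fixes \<alpha> :: "nat \<Rightarrow> nat"
  assumes w: "\<And>a g. a \<in> symbols m n \<Longrightarrow> g \<in> {1..m} \<Longrightarrow> e a (Virtual g) * w = 0"
    and \<alpha>: "inj_on \<alpha> {1..p}" "\<alpha> ` {1..p} \<subseteq> {1..m}"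
  shows "prod_list (map (\<lambda>i. xs (\<alpha> i) (rev [1..<Suc n])) [1..<Suc p]) *
      (prod_list (map (\<lambda>i. ys (\<alpha> i) [1..<Suc n]) [1..<Suc p]) * w) =
    (- 1) ^ (n * (p choose 2)) *
      (prod_list (map (\<lambda>q. capelli_det E (- int q) {1..n}) (rev [0..<p])) * w)"
  using \<alpha>
proof (induction p)
  case (Suc p)
  let ?X = "\<lambda>i. xs (\<alpha> i) (rev [1..<Suc n])"
  let ?Y = "\<lambda>i. ys (\<alpha> i) [1..<Suc n]"
  let ?XX = "prod_list (map ?X [1..<Suc p])"
  let ?YY = "prod_list (map ?Y [1..<Suc p])"
  let ?C = "\<lambda>t. capelli_det E t {1..n}"
  have \<alpha>_in: "\<alpha> i \<in> {1..m}" if "i \<in> {1..Suc p}" for i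
    using Suc.prems(2) that by blast
  have "?Y (Suc p) * prod_list (map ?Y L) = (- 1) ^ (n * length L) * (prod_list (map ?Y L) * ?Y (Suc p))"
    if "set L \<subseteq> {1..p}" for L
    using that
  proof (induction L)
    case (Cons i L)
    have "?Y (Suc p) * prod_list (map ?Y (i # L)) =
        (- 1) ^ n * (?Y i * (?Y (Suc p) * prod_list (map ?Y L)))"
      using ys_anticommute[of "\<alpha> i" "\<alpha> (Suc p)"] \<alpha>_in[of i] \<alpha>_in[of "Suc p"] Cons.prems
      by (simp del: upt_Suc flip: mult.assoc)
    then show ?case
      using Cons by (simp add: minus_one_power_iff mult.assoc del: upt_Suc)
  qed simp
  from this[of "[1..<Suc p]"]
  have YY: "?YY * ?Y (Suc p) = (- 1) ^ (n * p) * (?Y (Suc p) * ?YY)"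
    by (simp add: minus_one_power_iff atLeastLessThanSuc_atLeastAtMost del: upt_Suc split: if_splits)
  have kills: "kills (\<alpha> (Suc p)) (prod_list (map ?Y L) * w)" if "set L \<subseteq> {1..p}" for L
    using that
  proof (induction L)
    case Nil
    then show ?case
      using w \<alpha>_in[of "Suc p"] by (simp add: kills_def)
  next
    case (Cons i L)
    then have "\<alpha> i \<noteq> \<alpha> (Suc p)"
      using inj_onD[OF Suc.prems(1), of i "Suc p"] by auto
    then show ?case
      using Cons \<alpha>_in[of i] \<alpha>_in[of "Suc p"]
      by (auto simp: mult.assoc simp del: upt_Suc intro!: kills_ys)
  qed
  have inner: "?X (Suc p) * (?Y (Suc p) * (?YY * w)) = ?C 0 * (?YY * w)"
  proof -
    have "\<alpha> (Suc p) \<in> {1..m}"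
      by (rule \<alpha>_in) simp
    moreover have "kills (\<alpha> (Suc p)) (?YY * w)"
      by (rule kills) auto
    ultimately show ?thesis
      unfolding kills_def by (intro xs_ys_full) blast+
  qed
  have shift: "prod_list (map ?X L) * ?C t = ?C (t - int (length L)) * prod_list (map ?X L)"
    if "set L \<subseteq> {1..p}" for L t
    using that
  proof (induction L arbitrary: t)
    case (Cons i L)
    have "prod_list (map ?X (i # L)) * ?C t = ?X i * ?C (t - int (length L)) * prod_list (map ?X L)"
      using Cons by (simp add: mult.assoc del: upt_Suc)
    also have "?X i * ?C (t - int (length L)) = ?C (t - int (length (i # L))) * ?X i"
      using capelli_det_xs_full[OF \<alpha>_in[of i], of "t - int (length (i # L))"] Cons.prems
      by (simp add: algebra_simps del: upt_Suc)
    finally show ?case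
      by (simp add: mult.assoc del: upt_Suc)
  qed simp
  have "prod_list (map ?X [1..<Suc (Suc p)]) * (prod_list (map ?Y [1..<Suc (Suc p)]) * w) =
      ?XX * (?X (Suc p) * ((?YY * ?Y (Suc p)) * w))"
    by (simp add: mult.assoc)
  also have "\<dots> = (- 1) ^ (n * p) * (?XX * (?X (Suc p) * (?Y (Suc p) * (?YY * w))))"
    unfolding YY by (simp add: minus_one_power_iff mult.assoc del: upt_Suc)
  also have "\<dots> = (- 1) ^ (n * p) * (?C (- int p) * (?XX * (?YY * w)))"
    unfolding inner using shift[of "[1..<Suc p]" 0]
    by (simp add: atLeastLessThanSuc_atLeastAtMost del: upt_Suc flip: mult.assoc)
  also have "?XX * (?YY * w) = (- 1) ^ (n * (p choose 2)) *
      (prod_list (map (\<lambda>q. ?C (- int q)) (rev [0..<p])) * w)"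
    using Suc.prems by (intro Suc.IH) (auto intro: inj_on_subset)
  also have "(- 1) ^ (n * p) * (?C (- int p) * ((- 1) ^ (n * (p choose 2)) *
      (prod_list (map (\<lambda>q. ?C (- int q)) (rev [0..<p])) * w))) =
      (- 1) ^ (n * (Suc p choose 2)) *
      (prod_list (map (\<lambda>q. ?C (- int q)) (rev [0..<Suc p])) * w)"
    by (simp add: numeral_2_eq_2 distrib_left power_add mult.assoc minus_one_power_iff)
  finally show ?case .
qed (simp add: numeral_2_eq_2)

end

section \<open>Irregular words\<close>

definition word_prod :: "(symb \<Rightarrow> symb \<Rightarrow> 'r::monoid_mult) \<Rightarrow> (symb \<times> symb) list \<Rightarrow> 'r" where
  "word_prod e u = prod_list (map (\<lambda>(a, b). e a b) u)"

lemma word_prod_simps [simp]: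
  "word_prod e [] = 1" "word_prod e ((a, b) # u) = e a b * word_prod e u"
  "word_prod e (u @ v) = word_prod e u * word_prod e v"
  by (simp_all add: word_prod_def)

context gl_super
begin

abbreviation word :: "(symb \<times> symb) list \<Rightarrow> 'r" where "word \<equiv> word_prod e"

lemma e_e:
  assumes "a \<in> symbols m n" "b \<in> symbols m n" "c \<in> symbols m n" "d \<in> symbols m n"
  shows "e a b * e c d = super_sign a b c d * (e c d * e a b)
    + (if b = c then e a d else 0) - super_sign a b c d * (if a = d then e c b else 0)"
  using bracket[OF assms] by (simp add: algebra_simps)

lemma super_sign_cases: "super_sign a b c d = (1 :: 'r) \<or> super_sign a b c d = (- 1 :: 'r)"
  by (simp add: super_sign_def minus_one_power_iff)

text \<open>Such a word would lower the weight of w for g. A letter e_{a,g} moves right until it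
  meets w; an exchange keeps all letters, and the bracket terms are shorter words with the same
  excess of second indices g, which the induction on the length covers.\<close>

lemma word_kills:
  assumes w: "\<And>a g. a \<in> symbols m n \<Longrightarrow> g \<in> {1..m} \<Longrightarrow> e a (Virtual g) * w = 0"
    and g: "g \<in> {1..m}" and "set u \<subseteq> symbols m n \<times> symbols m n"
    and "length (filter (\<lambda>p. fst p = Virtual g) u) < length (filter (\<lambda>p. snd p = Virtual g) u)"
  shows "word u * w = 0"
  using assms(3,4)
proof (induction u rule: length_induct)
  case (1 u)
  let ?neg = "\<lambda>u. length (filter (\<lambda>p. fst p = Virtual g) u) < length (filter (\<lambda>p. snd p = Virtual g) u)"
  have move: "word u1 * (e a (Virtual g) * (word u2 * w)) = 0"
    if "length (u1 @ (a, Virtual g) # u2) = length u" "?neg (u1 @ (a, Virtual g) # u2)"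
      "set (u1 @ (a, Virtual g) # u2) \<subseteq> symbols m n \<times> symbols m n" for u1 a u2
    using that
  proof (induction u2 arbitrary: u1)
    case Nil
    then have "e a (Virtual g) * w = 0"
      by (intro w g) auto
    then show ?case by simp
  next
    case (Cons p u2)
    obtain c d where p: "p = (c, d)"
      by (cases p)
    have "word (u1 @ [(c, d)]) * (e a (Virtual g) * (word u2 * w)) = 0"
      using Cons.prems by (intro Cons.IH) (auto simp: p split: if_splits)
    then have moved: "word u1 * (e c d * (e a (Virtual g) * (word u2 * w))) = 0"
      by (simp add: mult.assoc)
    have left: "word u1 * (e a d * (word u2 * w)) = 0" if "Virtual g = c"
    proof -
      have "word (u1 @ (a, d) # u2) * w = 0"
        by (rule "1.IH"[rule_format]) (use Cons.prems that in \<open>auto simp: p split: if_splits\<close>)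
      then show ?thesis
        by (simp add: mult.assoc)
    qed
    have right: "word u1 * (e c (Virtual g) * (word u2 * w)) = 0" if "a = d"
    proof -
      have "word (u1 @ (c, Virtual g) # u2) * w = 0"
        by (rule "1.IH"[rule_format]) (use Cons.prems that in \<open>auto simp: p split: if_splits\<close>)
      then show ?thesis
        by (simp add: mult.assoc)
    qed
    have sym: "a \<in> symbols m n" "Virtual g \<in> symbols m n" "c \<in> symbols m n" "d \<in> symbols m n"
      using Cons.prems(3) g by (auto simp: p)
    have "e a (Virtual g) * (word (p # u2) * w) = e a (Virtual g) * e c d * (word u2 * w)"
      by (simp add: p mult.assoc)
    also have "\<dots> = super_sign a (Virtual g) c d * (e c d * (e a (Virtual g) * (word u2 * w)))
      + (if Virtual g = c then e a d * (word u2 * w) else 0)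
      - super_sign a (Virtual g) c d * (if a = d then e c (Virtual g) * (word u2 * w) else 0)"
      unfolding e_e[OF sym] by (simp add: distrib_right left_diff_distrib mult.assoc)
    finally show ?case
      using super_sign_cases[of a "Virtual g" c d] moved left right
      by (auto simp: distrib_left right_diff_distrib)
  qed
  have "filter (\<lambda>p. snd p = Virtual g) u \<noteq> []"
    using "1.prems"(2) by auto
  then obtain p where "p \<in> set u" "snd p = Virtual g"
    by (auto simp: filter_empty_conv)
  then obtain u1 u2 where "u = u1 @ (fst p, Virtual g) # u2"
    by (metis split_list prod.collapse)
  with move[of u1 "fst p" u2] "1.prems" show ?case
    by (simp add: mult.assoc)
qed

lemma G_word:
  assumes w: "G g g * w = 0" and g: "g \<in> {1..m}" and "set u \<subseteq> symbols m n \<times> symbols m n"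
  shows "G g g * (word u * w) = of_int (int (length (filter (\<lambda>p. fst p = Virtual g) u))
    - int (length (filter (\<lambda>p. snd p = Virtual g) u))) * (word u * w)"
  using assms(3)
proof (induction u)
  case (Cons p u)
  obtain a b where p: "p = (a, b)"
    by (cases p)
  let ?k = "int (length (filter (\<lambda>p. fst p = Virtual g) u)) - int (length (filter (\<lambda>p. snd p = Virtual g) u))"
  have "G g g * (word (p # u) * w) = G g g * e a b * (word u * w)"
    by (simp add: p mult.assoc)
  also have "\<dots> = e a b * (G g g * (word u * w))
      + (if Virtual g = a then e a b * (word u * w) else 0) - (if b = Virtual g then e a b * (word u * w) else 0)"
    using e_e[of "Virtual g" "Virtual g" a b] Cons.prems g
    by (simp add: p distrib_right left_diff_distrib mult.assoc)
  also have "G g g * (word u * w) = of_int ?k * (word u * w)"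
    using Cons by simp
  also have "e a b * (of_int ?k * (word u * w)) = of_int ?k * (e a b * (word u * w))"
    by (rule of_int_mult_left_commute[symmetric])
  finally show ?case
    by (auto simp: p distrib_right left_diff_distrib mult.assoc)
qed (simp add: w)

end

lemma card_nth_eq_length_filter:
  assumes "k \<le> length v"
  shows "card {j \<in> {1..k}. P (v ! (j - 1))} = length (filter P (take k v))"
proof -
  have "{j \<in> {1..k}. P (v ! (j - 1))} = Suc ` {j. j < length (take k v) \<and> P (take k v ! j)}"
  proof (intro equalityI subsetI)
    fix j assume "j \<in> {j \<in> {1..k}. P (v ! (j - 1))}"
    then show "j \<in> Suc ` {j. j < length (take k v) \<and> P (take k v ! j)}"
      using assms by (intro image_eqI[of _ _ "j - 1"]) auto
  qed (use assms in auto)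
  then show ?thesis
    by (simp add: length_filter_conv_card card_image)
qed

text \<open>Factors are numbered from the right, so the first i of them form a suffix of u. The
  factor i itself counts for the second indices but not for the first ones.\<close>

lemma irregular_split:
  assumes "irregular m u"
  obtains u1 a b u2 g where "u = u1 @ (a, b) # u2" "g \<in> {1..m}"
    "length (filter (\<lambda>p. fst p = Virtual g) u2) < length (filter (\<lambda>p. snd p = Virtual g) ((a, b) # u2))"
proof -
  obtain i g where i: "i \<in> {1..length u}" and g: "g \<in> {1..m}"
    and c: "card {j \<in> {1..<i}. fst (rev u ! (j - 1)) = Virtual g} <
      card {j \<in> {1..i}. snd (rev u ! (j - 1)) = Virtual g}"
    using assms by (auto simp: irregular_def virtual_symbols_def)
  define v where "v = rev u"
  have len: "i \<le> length v"
    using i by (simp add: v_def)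
  obtain a b where ab: "v ! (i - 1) = (a, b)"
    by (cases "v ! (i - 1)")
  have take: "take i v = take (i - 1) v @ [(a, b)]"
    using i len ab by (cases i) (simp_all add: take_Suc_conv_app_nth)
  have "{1..<i} = {1..i - 1}"
    using i by auto
  then have "length (filter (\<lambda>p. fst p = Virtual g) (take (i - 1) v)) <
      length (filter (\<lambda>p. snd p = Virtual g) (take i v))"
    using c len card_nth_eq_length_filter[of "i - 1" v "\<lambda>p. fst p = Virtual g"]
      card_nth_eq_length_filter[of i v "\<lambda>p. snd p = Virtual g"]
    by (simp add: v_def)
  then have "length (filter (\<lambda>p. fst p = Virtual g) (rev (take (i - 1) v))) <
      length (filter (\<lambda>p. snd p = Virtual g) ((a, b) # rev (take (i - 1) v)))"
    unfolding take by (auto simp flip: rev_filter split: if_splits)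
  moreover have "u = rev (drop i v) @ (a, b) # rev (take (i - 1) v)"
  proof -
    have "u = rev (take i v @ drop i v)"
      by (simp add: v_def)
    then show ?thesis
      unfolding take by simp
  qed
  ultimately show ?thesis
    using g that by blast
qed

context gl_super
begin

text \<open>If u2 has an excess of second indices g, or e_{a,g} with a \<noteq> g creates one,
  \<open>word_kills\<close> applies. There remains e_{g,g} on a suffix with g equally often on both
  sides: it acts by the weight, which is 0.\<close>

theorem irregular_kills:
  assumes w: "\<And>a g. a \<in> symbols m n \<Longrightarrow> g \<in> {1..m} \<Longrightarrow> e a (Virtual g) * w = 0"
    and u: "set u \<subseteq> symbols m n \<times> symbols m n" and "irregular m u"
  shows "word u * w = 0"
proof -
  obtain u1 a b u2 g where split: "u = u1 @ (a, b) # u2" and g: "g \<in> {1..m}"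
    and less: "length (filter (\<lambda>p. fst p = Virtual g) u2) <
      length (filter (\<lambda>p. snd p = Virtual g) ((a, b) # u2))"
    using irregular_split[OF assms(3)] by blast
  have u2: "set u2 \<subseteq> symbols m n \<times> symbols m n"
    and ab: "set ((a, b) # u2) \<subseteq> symbols m n \<times> symbols m n"
    using u split by auto
  have "e a b * (word u2 * w) = 0"
  proof (cases "length (filter (\<lambda>p. fst p = Virtual g) u2) < length (filter (\<lambda>p. snd p = Virtual g) u2)")
    case True
    then show ?thesis
      using word_kills[OF w g u2] by simp
  next
    case False
    then have b: "b = Virtual g"
      and eq: "length (filter (\<lambda>p. fst p = Virtual g) u2) = length (filter (\<lambda>p. snd p = Virtual g) u2)"
      using less by (auto split: if_splits)
    show ?thesis
    proof (cases "a = Virtual g")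
      case True
      then show ?thesis
        using G_word[OF w[of "Virtual g" g] g u2] g b eq by simp
    next
      case False
      then have "word ((a, b) # u2) * w = 0"
        using less b by (intro word_kills[OF w g ab]) auto
      then show ?thesis
        by (simp add: mult.assoc)
    qed
  qed
  then show ?thesis
    by (simp add: split mult.assoc)
qed

end

section \<open>The Fock space\<close>

text \<open>As a ring type, the operators can take the place of \<open>'r\<close> in
  \<open>gl_super\<close> and \<open>fock\<close>. The class \<open>ring_1\<close> provides a
  nonzero vector and with it 0 \<noteq> 1 among the operators. Scalars enter separately, through
  \<open>scale\<close> and \<open>scalar_endo\<close>.\<close>

typedef (overloaded) 'v endo = "{f :: 'v::ring_1 \<Rightarrow> 'v. \<forall>u v. f (u + v) = f u + f v}"
  morphisms app Endo
  by (rule exI[of _ "\<lambda>v. v"]) simp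

lemma app_add: "app f (u + v) = app f u + app f v"
  using app[of f] by simp

lemma app_Endo: "(\<And>u v. f (u + v) = f u + f v) \<Longrightarrow> app (Endo f) = f"
  by (simp add: Endo_inverse)

lemma endo_eqI: "(\<And>v. app f v = app g v) \<Longrightarrow> f = g"
  by (metis app_inject ext)

instantiation endo :: (ring_1) ring_1
begin

definition "0 = Endo (\<lambda>v. 0)"
definition "1 = Endo (\<lambda>v. v)"
definition "f + g = Endo (\<lambda>v. app f v + app g v)"
definition "f - g = Endo (\<lambda>v. app f v - app g v)"
definition "- f = Endo (\<lambda>v. - app f v)"
definition "f * g = Endo (\<lambda>v. app f (app g v))"

lemma app_simps [simp]:
  "app 0 v = 0" "app 1 v = v" "app (f + g) v = app f v + app g v"
  "app (f - g) v = app f v - app g v" "app (- f) v = - app f v" "app (f * g) v = app f (app g v)"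
  by (simp_all add: zero_endo_def one_endo_def plus_endo_def minus_endo_def uminus_endo_def
      times_endo_def app_Endo app_add algebra_simps)

instance
proof
  show "(0 :: 'a endo) \<noteq> 1"
  proof
    assume "(0 :: 'a endo) = 1"
    then have "app 0 (1 :: 'a) = app 1 1"
      by (rule arg_cong)
    then show False
      by simp
  qed
qed (rule endo_eqI, simp add: app_add algebra_simps)+

end

text \<open>
  The operators \<open>z\<close> and \<open>d\<close> are fermionic creation and annihilation operators. The module is the
  one induced from \<open>gl(n)\<close>, the \<open>e\<close> with a virtual second index acting trivially on the vacuum;
  this forces the formulas for \<open>e\<close> below.
\<close>

locale fock =
  fixes m n :: nat and z d E :: "nat \<Rightarrow> nat \<Rightarrow> 'r::ring_1"
  assumes zz: "z g i * z h j = - (z h j * z g i)"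
    and dd: "d g i * d h j = - (d h j * d g i)"
    and dz: "d g i * z h j = (if g = h \<and> i = j then 1 else 0) - z h j * d g i"
    and Ez: "E i j * z g k = z g k * E i j"
    and Ed: "E i j * d g k = d g k * E i j"
    and EE: "\<lbrakk>i \<in> {1..n}; j \<in> {1..n}; k \<in> {1..n}; l \<in> {1..n}\<rbrakk> \<Longrightarrow>
      E i j * E k l = E k l * E i j + (if j = k then E i l else 0) - (if i = l then E k j else 0)"
    and two_torsion_free: "u + u = (0::'r) \<Longrightarrow> u = 0"
begin

text \<open>The indices are transposed, and \<open>q\<close> has a minus sign, because z_{g,k}
  stands for e_{g,k} and [e_{i,j}, e_{g,k}] = - e_{g,j} if i = k and 0 otherwise.\<close>

definition N :: "nat \<Rightarrow> nat \<Rightarrow> 'r" where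
  "N i j = (\<Sum>g\<in>{1..m}. z g j * d g i)"

definition q :: "nat \<Rightarrow> nat \<Rightarrow> 'r" where
  "q i j = E i j - N i j"

fun e :: "symb \<Rightarrow> symb \<Rightarrow> 'r" where
  "e (Proper i) (Proper j) = q i j"
| "e (Virtual g) (Proper j) = z g j"
| "e (Proper i) (Virtual g) = (\<Sum>k\<in>{1..n}. q i k * d g k)"
| "e (Virtual h) (Virtual g) = (\<Sum>k\<in>{1..n}. z h k * d g k)"

section \<open>Commutation relations of the Fock operators\<close>

lemma zz_left: "z g i * (z h j * u) = - (z h j * (z g i * u))"
  unfolding mult.assoc[symmetric] zz[of g i h j] by simp

lemma N_z:
  assumes "g \<in> {1..m}"
  shows "N i j * z g k = z g k * N i j + (if i = k then z g j else 0)"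
proof -
  have "N i j * z g k = (\<Sum>h\<in>{1..m}. z h j * (d h i * z g k))"
    by (simp add: N_def sum_distrib_right mult.assoc)
  also have "\<dots> = (\<Sum>h\<in>{1..m}. (if h = g then (if i = k then z h j else 0) else 0) + z g k * (z h j * d h i))"
  proof (intro sum.cong refl)
    fix h
    have "z h j * (d h i * z g k) = z h j * (if h = g \<and> i = k then 1 else 0) - z h j * z g k * d h i"
      by (simp add: dz[of h i] right_diff_distrib mult.assoc)
    then show "z h j * (d h i * z g k) = (if h = g then (if i = k then z h j else 0) else 0) + z g k * (z h j * d h i)"
      by (simp add: zz_left[of h j g k] mult.assoc)
  qed
  finally show ?thesis
    using assms by (simp add: N_def sum.distrib sum_distrib_left)
qed

lemma d_N:
  assumes "g \<in> {1..m}"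
  shows "d g k * N i j = N i j * d g k + (if k = j then d g i else 0)"
proof -
  have "d g k * N i j = (\<Sum>h\<in>{1..m}. (d g k * z h j) * d h i)"
    by (simp add: N_def sum_distrib_left mult.assoc)
  also have "\<dots> = (\<Sum>h\<in>{1..m}. (if g = h then (if k = j then d h i else 0) else 0) + z h j * d h i * d g k)"
  proof (intro sum.cong refl)
    fix h
    have "d g k * z h j * d h i = (if g = h \<and> k = j then 1 else 0) * d h i - z h j * (d g k * d h i)"
      by (simp add: dz[of g k] left_diff_distrib mult.assoc)
    then show "d g k * z h j * d h i = (if g = h then (if k = j then d h i else 0) else 0) + z h j * d h i * d g k"
      by (simp add: dd[of g k h i] mult.assoc)
  qed
  finally show ?thesis
    using assms by (simp add: N_def sum.distrib sum_distrib_right)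
qed

lemma E_N: "E i j * N k l = N k l * E i j"
  unfolding N_def sum_distrib_left sum_distrib_right
proof (rule sum.cong[OF refl])
  fix g
  have "E i j * (z g l * d g k) = z g l * (E i j * d g k)"
    by (simp add: Ez flip: mult.assoc)
  then show "E i j * (z g l * d g k) = z g l * d g k * E i j"
    by (simp add: Ed mult.assoc)
qed

lemma N_N: "N i j * N k l = N k l * N i j + (if i = l then N k j else 0) - (if k = j then N i l else 0)"
proof -
  have "N i j * N k l = (\<Sum>g\<in>{1..m}. (N i j * z g l) * d g k)"
    by (simp add: N_def[of k l] sum_distrib_left mult.assoc)
  also have "\<dots> = (\<Sum>g\<in>{1..m}. z g l * d g k * N i j + ((if i = l then z g j * d g k else 0)
      - (if k = j then z g l * d g i else 0)))"
  proof (rule sum.cong[OF refl])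
    fix g assume g: "g \<in> {1..m}"
    have "N i j * z g l * d g k = z g l * (N i j * d g k) + (if i = l then z g j * d g k else 0)"
      by (simp add: N_z[OF g] distrib_right mult.assoc)
    also have "N i j * d g k = d g k * N i j - (if k = j then d g i else 0)"
      by (simp add: d_N[OF g])
    finally show "N i j * z g l * d g k = z g l * d g k * N i j + ((if i = l then z g j * d g k else 0)
      - (if k = j then z g l * d g i else 0))"
      by (simp add: right_diff_distrib mult.assoc)
  qed
  also have "\<dots> = N k l * N i j + ((if i = l then N k j else 0) - (if k = j then N i l else 0))"
    by (simp add: N_def sum.distrib sum_subtractf sum_distrib_right)
  finally show ?thesis by simp
qed

lemma q_z:
  assumes "g \<in> {1..m}"
  shows "q i j * z g k = z g k * q i j - (if i = k then z g j else 0)"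
  by (simp add: q_def left_diff_distrib right_diff_distrib Ez N_z[OF assms])

lemma d_q:
  assumes "g \<in> {1..m}"
  shows "d g k * q i j = q i j * d g k - (if k = j then d g i else 0)"
  by (simp add: q_def left_diff_distrib right_diff_distrib Ed d_N[OF assms])

lemma q_q:
  assumes "i \<in> {1..n}" "j \<in> {1..n}" "k \<in> {1..n}" "l \<in> {1..n}"
  shows "q i j * q k l = q k l * q i j + (if j = k then q i l else 0) - (if i = l then q k j else 0)"
proof -
  have "q i j * q k l = E i j * E k l - E i j * N k l - N i j * E k l + N i j * N k l"
    by (simp add: q_def left_diff_distrib right_diff_distrib)
  also have "\<dots> = E i j * E k l - N k l * E i j - E k l * N i j + N i j * N k l"
    by (simp add: E_N)
  also have "\<dots> = q k l * q i j + (if j = k then q i l else 0) - (if i = l then q k j else 0)"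
    unfolding EE[OF assms] N_N[of i j k l] by (simp add: q_def left_diff_distrib right_diff_distrib)
  finally show ?thesis .
qed

abbreviation xx :: "nat \<Rightarrow> nat \<Rightarrow> 'r" where "xx g i \<equiv> e (Proper i) (Virtual g)"
abbreviation gg :: "nat \<Rightarrow> nat \<Rightarrow> 'r" where "gg h g \<equiv> e (Virtual h) (Virtual g)"

lemma gg_z: "gg h g * z k j = z k j * gg h g + (if g = k then if j \<in> {1..n} then z h j else 0 else 0)"
proof -
  have "gg h g * z k j = (\<Sum>l\<in>{1..n}. z h l * (d g l * z k j))"
    by (simp add: sum_distrib_right mult.assoc)
  also have "\<dots> = (\<Sum>l\<in>{1..n}. z k j * (z h l * d g l) + (if l = j then if g = k then z h l else 0 else 0))"
  proof (intro sum.cong refl)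
    fix l
    have "z h l * (d g l * z k j) = z h l * (if g = k \<and> l = j then 1 else 0) - z h l * z k j * d g l"
      by (simp add: dz[of g l] right_diff_distrib mult.assoc)
    then show "z h l * (d g l * z k j) = z k j * (z h l * d g l) + (if l = j then if g = k then z h l else 0 else 0)"
      by (simp add: zz_left[of h l k j] mult.assoc)
  qed
  finally show ?thesis
    by (simp add: sum.distrib sum_distrib_left)
qed

lemma gg_d: "gg h g * d k j = d k j * gg h g - (if h = k then if j \<in> {1..n} then d g j else 0 else 0)"
proof -
  have "d k j * gg h g = (\<Sum>l\<in>{1..n}. (d k j * z h l) * d g l)"
    by (simp add: sum_distrib_left mult.assoc)
  also have "\<dots> = (\<Sum>l\<in>{1..n}. z h l * d g l * d k j + (if l = j then if h = k then d g l else 0 else 0))"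
  proof (intro sum.cong refl)
    fix l
    have "d k j * z h l * d g l = (if k = h \<and> j = l then 1 else 0) * d g l - z h l * (d k j * d g l)"
      by (simp add: dz[of k j] left_diff_distrib mult.assoc)
    also have "z h l * (d k j * d g l) = - (z h l * d g l * d k j)"
      by (simp only: dd[of k j g l] mult_minus_right mult.assoc)
    finally show "d k j * z h l * d g l = z h l * d g l * d k j + (if l = j then if h = k then d g l else 0 else 0)"
      by auto
  qed
  finally show ?thesis
    by (simp add: sum.distrib sum_distrib_right)
qed

lemma gg_gg: "gg a g * gg b h = gg b h * gg a g + (if g = b then gg a h else 0) - (if a = h then gg b g else 0)"
proof -
  have "gg a g * gg b h = (\<Sum>k\<in>{1..n}. (gg a g * z b k) * d h k)"
    by (simp only: e.simps(4)[of b] sum_distrib_left mult.assoc)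
  also have "\<dots> = (\<Sum>k\<in>{1..n}. z b k * d h k * gg a g + ((if g = b then z a k * d h k else 0)
      - (if a = h then z b k * d g k else 0)))"
  proof (rule sum.cong[OF refl])
    fix k assume "k \<in> {1..n}"
    then show "gg a g * z b k * d h k = z b k * d h k * gg a g + ((if g = b then z a k * d h k else 0)
      - (if a = h then z b k * d g k else 0))"
      by (simp add: gg_z distrib_right mult.assoc gg_d right_diff_distrib del: e.simps)
  qed
  also have "\<dots> = gg b h * gg a g + ((if g = b then gg a h else 0) - (if a = h then gg b g else 0))"
    by (simp add: sum.distrib sum_subtractf sum_distrib_right)
  finally show ?thesis by simp
qed

lemma gg_q:
  assumes "i \<in> {1..n}" "j \<in> {1..n}" "g \<in> {1..m}" "h \<in> {1..m}"
  shows "gg h g * q i j = q i j * gg h g"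
proof -
  have "gg h g * q i j = (\<Sum>k\<in>{1..n}. z h k * (d g k * q i j))"
    by (simp add: sum_distrib_right mult.assoc)
  also have "\<dots> = (\<Sum>k\<in>{1..n}. q i j * (z h k * d g k) +
      ((if i = k then z h j * d g k else 0) - (if k = j then z h k * d g i else 0)))"
  proof (intro sum.cong refl)
    fix k
    have "z h k * (d g k * q i j) = (z h k * q i j) * d g k - (if k = j then z h k * d g i else 0)"
      by (simp add: d_q[OF assms(3)] right_diff_distrib mult.assoc)
    also have "z h k * q i j = q i j * z h k + (if i = k then z h j else 0)"
      by (simp add: q_z[OF assms(4)])
    finally show "z h k * (d g k * q i j) = q i j * (z h k * d g k) +
      ((if i = k then z h j * d g k else 0) - (if k = j then z h k * d g i else 0))"
      by (simp add: distrib_right mult.assoc)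
  qed
  also have "\<dots> = q i j * gg h g"
    using assms by (simp add: sum.distrib sum_subtractf sum_distrib_left)
  finally show ?thesis .
qed

text \<open>In \<open>xx\<close> it matters that q stands to the left of d: z, on its way to the
  left, produces \<open>q l j\<close> at d and \<open>gg h g\<close> at q, the two terms of the
  bracket.\<close>

lemma xx_z:
  assumes "l \<in> {1..n}" "j \<in> {1..n}" "g \<in> {1..m}" "h \<in> {1..m}"
  shows "xx g l * z h j = (if g = h then q l j else 0) + (if l = j then gg h g else 0) - z h j * xx g l"
proof -
  have "xx g l * z h j = (\<Sum>k\<in>{1..n}. q l k * (d g k * z h j))"
    by (simp add: sum_distrib_right mult.assoc)
  also have "\<dots> = (\<Sum>k\<in>{1..n}. (if k = j then if g = h then q l k else 0 else 0)
      + ((if l = j then z h k * d g k else 0) - z h j * (q l k * d g k)))"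
  proof (intro sum.cong refl)
    fix k
    have "q l k * (d g k * z h j) = (if k = j then if g = h then q l k else 0 else 0) - q l k * z h j * d g k"
      by (simp add: dz[of g k] right_diff_distrib mult.assoc)
    then show "q l k * (d g k * z h j) = (if k = j then if g = h then q l k else 0 else 0)
      + ((if l = j then z h k * d g k else 0) - z h j * (q l k * d g k))"
      by (simp add: q_z[OF assms(4)] left_diff_distrib mult.assoc)
  qed
  finally show ?thesis
    using assms by (simp add: sum.distrib sum_subtractf sum_distrib_left)
qed

lemma xx_q:
  assumes "l \<in> {1..n}" "i \<in> {1..n}" "j \<in> {1..n}" "g \<in> {1..m}"
  shows "xx g l * q i j = q i j * xx g l - (if l = j then xx g i else 0)"
proof -
  have "xx g l * q i j = (\<Sum>k\<in>{1..n}. q l k * (d g k * q i j))"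
    by (simp add: sum_distrib_right mult.assoc)
  also have "\<dots> = (\<Sum>k\<in>{1..n}. q i j * (q l k * d g k) - (if l = j then q i k * d g k else 0)
      + ((if k = i then q l j * d g k else 0) - (if k = j then q l k * d g i else 0)))"
  proof (rule sum.cong[OF refl])
    fix k assume k: "k \<in> {1..n}"
    have "q l k * (d g k * q i j) = q l k * q i j * d g k - (if k = j then q l k * d g i else 0)"
      by (simp add: d_q[OF assms(4)] right_diff_distrib mult.assoc)
    then show "q l k * (d g k * q i j) = q i j * (q l k * d g k) - (if l = j then q i k * d g k else 0)
      + ((if k = i then q l j * d g k else 0) - (if k = j then q l k * d g i else 0))"
      by (simp add: q_q[OF assms(1) k assms(2,3)] left_diff_distrib distrib_right mult.assoc)
  qed
  also have "\<dots> = q i j * xx g l - (if l = j then xx g i else 0)"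
    using assms by (simp add: sum.distrib sum_subtractf sum_distrib_left)
  finally show ?thesis .
qed

text \<open>As q and d do not commute, there is an extra term quadratic in d; it cancels in
  \<open>xx_gg\<close> and \<open>xx_xx\<close>.\<close>

lemma xx_d:
  assumes "g \<in> {1..m}" "h \<in> {1..m}" "k \<in> {1..n}"
  shows "xx g l * d h k = - (d h k * xx g l) - d h l * d g k"
proof -
  have "d h k * xx g l = (\<Sum>j\<in>{1..n}. (d h k * q l j) * d g j)"
    by (simp add: sum_distrib_left mult.assoc)
  also have "\<dots> = (\<Sum>j\<in>{1..n}. - (q l j * d g j * d h k) - (if j = k then d h l * d g j else 0))"
  proof (intro sum.cong refl)
    fix j
    have "d h k * q l j * d g j = q l j * (d h k * d g j) - (if j = k then d h l * d g j else 0)"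
      by (simp add: d_q[OF assms(2)] left_diff_distrib mult.assoc)
    then show "d h k * q l j * d g j = - (q l j * d g j * d h k) - (if j = k then d h l * d g j else 0)"
      by (simp add: dd[of h k g j] mult.assoc)
  qed
  also have "\<dots> = - (xx g l * d h k) - d h l * d g k"
    using assms by (simp add: sum_subtractf sum_negf sum_distrib_right)
  finally show ?thesis
    by simp
qed

lemma xx_gg:
  assumes "l \<in> {1..n}" "g \<in> {1..m}" "h \<in> {1..m}" "k \<in> {1..m}"
  shows "xx g l * gg k h = gg k h * xx g l + (if g = k then xx h l else 0)"
proof -
  have "xx g l * gg k h = (\<Sum>j\<in>{1..n}. (xx g l * z k j) * d h j)"
    by (simp only: e.simps(4)[of k] sum_distrib_left mult.assoc)
  also have "\<dots> = (\<Sum>j\<in>{1..n}. (if g = k then q l j * d h j else 0) + (if l = j then gg k g * d h j else 0)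
      + (z k j * d h j * xx g l - z k j * (d g j * d h l)))"
  proof (rule sum.cong[OF refl])
    fix j assume j: "j \<in> {1..n}"
    have "xx g l * z k j * d h j = (if g = k then q l j * d h j else 0) + (if l = j then gg k g * d h j else 0)
        - z k j * (xx g l * d h j)"
      by (simp add: xx_z[OF assms(1) j assms(2,4)] distrib_right left_diff_distrib mult.assoc del: e.simps)
    then show "xx g l * z k j * d h j = (if g = k then q l j * d h j else 0) + (if l = j then gg k g * d h j else 0)
      + (z k j * d h j * xx g l - z k j * (d g j * d h l))"
      by (simp add: xx_d[OF assms(2,3) j] dd[of h l g j] right_diff_distrib mult.assoc del: e.simps)
  qed
  also have "\<dots> = (if g = k then xx h l else 0) + gg k g * d h l + (gg k h * xx g l - gg k g * d h l)"
    using assms by (simp add: sum.distrib sum_subtractf sum_distrib_right mult.assoc)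
  finally show ?thesis by simp
qed

lemma xx_xx:
  assumes "l \<in> {1..n}" "i \<in> {1..n}" "g \<in> {1..m}" "h \<in> {1..m}"
  shows "xx g l * xx h i = - (xx h i * xx g l)"
proof -
  have "xx g l * xx h i = (\<Sum>k\<in>{1..n}. (xx g l * q i k) * d h k)"
    by (simp only: e.simps(3)[of i] sum_distrib_left mult.assoc)
  also have "\<dots> = (\<Sum>k\<in>{1..n}. - (q i k * d h k * xx g l) + q i k * d g k * d h l
      - (if l = k then xx g i * d h k else 0))"
  proof (rule sum.cong[OF refl])
    fix k assume k: "k \<in> {1..n}"
    have "xx g l * q i k * d h k = q i k * (xx g l * d h k) - (if l = k then xx g i * d h k else 0)"
      by (simp add: xx_q[OF assms(1,2) k assms(3)] left_diff_distrib mult.assoc del: e.simps)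
    then show "xx g l * q i k * d h k = - (q i k * d h k * xx g l) + q i k * d g k * d h l
      - (if l = k then xx g i * d h k else 0)"
      by (simp add: xx_d[OF assms(3,4) k] dd[of h l g k] right_diff_distrib mult.assoc del: e.simps)
  qed
  also have "\<dots> = - (xx h i * xx g l) + xx g i * d h l - xx g i * d h l"
    using assms by (simp add: sum.distrib sum_subtractf sum_negf sum_distrib_right)
  finally show ?thesis by simp
qed

section \<open>The superbracket relations for all pairs of generators\<close>

definition has_bracket :: "symb \<Rightarrow> symb \<Rightarrow> symb \<Rightarrow> symb \<Rightarrow> bool" where
  "has_bracket a b c c' \<longleftrightarrow> e a b * e c c' - super_sign a b c c' * (e c c' * e a b) =
      (if b = c then e a c' else 0) - super_sign a b c c' * (if a = c' then e c b else 0)"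

text \<open>Multiplication by minus the sign exchanges the two factors. Of the sixteen patterns of
  virtual and proper indices, ten remain to be checked.\<close>

lemma has_bracket_sym:
  assumes "has_bracket c c' a b"
  shows "has_bracket a b c c'"
proof -
  have sign: "super_sign c c' a b = (super_sign a b c c' :: 'r)"
    by (simp add: super_sign_def mult.commute)
  have assm: "e c c' * e a b - super_sign a b c c' * (e a b * e c c') =
      (if a = c' then e c b else 0) - super_sign a b c c' * (if b = c then e a c' else 0)"
    using assms unfolding has_bracket_def sign eq_commute[of c' a] eq_commute[of c b] .
  show ?thesis
  proof (cases "super_sign a b c c' = (1 :: 'r)")
    case True
    from assm have "e c c' * e a b - e a b * e c c' = (if a = c' then e c b else 0) - (if b = c then e a c' else 0)"
      unfolding True by simp
    from arg_cong[OF this, of uminus] show ?thesis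
      unfolding has_bracket_def True by simp
  next
    case False
    then have s: "super_sign a b c c' = (- 1 :: 'r)"
      by (auto simp: super_sign_def minus_one_power_iff split: if_splits)
    from assm show ?thesis
      unfolding has_bracket_def s by (simp add: add.commute)
  qed
qed

lemma has_bracket_cases:
  assumes "a \<in> symbols m n" "b \<in> symbols m n" "c \<in> symbols m n" "c' \<in> symbols m n"
  shows "has_bracket a b c c'"
proof -
  have 1: "has_bracket (Proper i) (Proper j) (Proper k) (Proper l)"
    if "i \<in> {1..n}" "j \<in> {1..n}" "k \<in> {1..n}" "l \<in> {1..n}" for i j k l
    using q_q[OF that] by (simp only: has_bracket_def e.simps super_sign_simps symb.inject) simp
  have 2: "has_bracket (Virtual g) (Proper j) (Virtual h) (Proper l)" for g j h l
    using zz[of g j h l] by (simp only: has_bracket_def e.simps super_sign_simps symb.distinct) simp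
  have 3: "has_bracket (Proper i) (Proper j) (Virtual h) (Proper l)"
    if "h \<in> {1..m}" for i j h l
    using q_z[OF that, of i j l] by (simp only: has_bracket_def e.simps super_sign_simps symb.inject symb.distinct) simp
  have 4: "has_bracket (Virtual a) (Virtual g) (Virtual b) (Virtual h)" for a g b h
    using gg_gg[of a g b h] by (simp only: has_bracket_def super_sign_simps symb.inject) simp
  have 5: "has_bracket (Virtual a) (Virtual g) (Virtual b) (Proper j)" if "j \<in> {1..n}" for a g b j
    using gg_z[of a g b j] that by (simp only: has_bracket_def e.simps(1,2) super_sign_simps symb.inject symb.distinct) simp
  have 6: "has_bracket (Virtual a) (Virtual g) (Proper i) (Proper j)"
    if "i \<in> {1..n}" "j \<in> {1..n}" "g \<in> {1..m}" "a \<in> {1..m}" for a g i j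
    using gg_q[OF that] by (simp only: has_bracket_def e.simps(1,2) super_sign_simps symb.inject symb.distinct) simp
  have 7: "has_bracket (Proper l) (Virtual g) (Virtual h) (Proper j)"
    if "l \<in> {1..n}" "j \<in> {1..n}" "g \<in> {1..m}" "h \<in> {1..m}" for l g h j
    using xx_z[OF that] by (simp only: has_bracket_def e.simps(1,2) super_sign_simps symb.inject symb.distinct) simp
  have 8: "has_bracket (Proper l) (Virtual g) (Proper i) (Proper j)"
    if "l \<in> {1..n}" "i \<in> {1..n}" "j \<in> {1..n}" "g \<in> {1..m}" for l g i j
    using xx_q[OF that] by (simp only: has_bracket_def e.simps(1,2) super_sign_simps symb.inject symb.distinct) simp
  have 9: "has_bracket (Proper l) (Virtual g) (Virtual k) (Virtual h)"
    if "l \<in> {1..n}" "g \<in> {1..m}" "h \<in> {1..m}" "k \<in> {1..m}" for l g h k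
    using xx_gg[OF that] by (simp only: has_bracket_def super_sign_simps symb.inject symb.distinct) simp
  have 10: "has_bracket (Proper l) (Virtual g) (Proper i) (Virtual h)"
    if "l \<in> {1..n}" "i \<in> {1..n}" "g \<in> {1..m}" "h \<in> {1..m}" for l g i h
    using xx_xx[OF that] by (simp only: has_bracket_def super_sign_simps symb.inject symb.distinct) simp
  show ?thesis
    using assms
    by (cases a; cases b; cases c; cases c')
      (simp_all only: in_symbols_iff 1 2 3 4 5 6 7 8 9 10 has_bracket_sym)
qed

sublocale gl: gl_super m n e
proof
  show "e a b * e c c' - super_sign a b c c' * (e c c' * e a b) =
      (if b = c then e a c' else 0) - super_sign a b c c' * (if a = c' then e c b else 0)"
    if "a \<in> symbols m n" "b \<in> symbols m n" "c \<in> symbols m n" "c' \<in> symbols m n" for a b c c'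
    using has_bracket_cases[OF that] unfolding has_bracket_def .
qed (rule two_torsion_free)

end

text \<open>
  Infinite sets \<open>S\<close> do no harm below, as \<open>{l \<in> S. l < k}\<close> is finite for all \<open>S\<close>.
\<close>

definition crossing_sign :: "nat \<Rightarrow> nat set \<Rightarrow> 'r::ring_1" where
  "crossing_sign k S = (- 1) ^ card {l \<in> S. l < k}"

lemma crossing_sign_insert:
  assumes "l \<notin> S"
  shows "crossing_sign k (insert l S) = (if l < k then - crossing_sign k S else crossing_sign k S)"
proof -
  have "{j \<in> insert l S. j < k} = (if l < k then insert l {j \<in> S. j < k} else {j \<in> S. j < k})"
    by auto
  moreover have "finite {j \<in> S. j < k}"
    by (rule finite_subset[of _ "{..<k}"]) auto
  ultimately show ?thesis
    using assms by (simp add: crossing_sign_def)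
qed

lemma crossing_sign_remove:
  assumes "l \<in> S"
  shows "crossing_sign k (S - {l}) = (if l < k then - crossing_sign k S else crossing_sign k S :: 'r::ring_1)"
  using crossing_sign_insert[of l "S - {l}" k, where 'a = 'r] assms
  by (simp add: insert_absorb split: if_splits)

lemma crossing_sign_square: "crossing_sign k S * (crossing_sign k S * u) = u"
  by (simp add: crossing_sign_def minus_one_power_iff)

lemma crossing_sign_commute: "v * (crossing_sign k S * u) = crossing_sign k S * (v * u)"
  by (simp add: crossing_sign_def minus_one_power_iff)

text \<open>Jordan-Wigner form: f S is the coefficient of the exterior monomial with the generators
  of S in increasing order, and \<open>crossing_sign\<close> is the price of moving generator k past
  the smaller ones.\<close>

definition create :: "nat \<Rightarrow> (nat set \<Rightarrow> 'r::ring_1) endo" where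
  "create k = Endo (\<lambda>f S. if k \<in> S then crossing_sign k S * f (S - {k}) else 0)"

definition annihilate :: "nat \<Rightarrow> (nat set \<Rightarrow> 'r::ring_1) endo" where
  "annihilate k = Endo (\<lambda>f S. if k \<in> S then 0 else crossing_sign k S * f (insert k S))"

definition scale :: "'r \<Rightarrow> (nat set \<Rightarrow> 'r::ring_1) endo" where
  "scale r = Endo (\<lambda>f S. r * f S)"

text \<open>The vacuum in the guise of a ring element, so that \<open>a * vacuum\<close> records the
  effect of a on it; as a projection it commutes with the coefficients.\<close>

definition vacuum :: "(nat set \<Rightarrow> 'r::ring_1) endo" where
  "vacuum = Endo (\<lambda>f S. if S = {} then f {} else 0)"

lemma app_fock_ops:
  "app (create k) f S = (if k \<in> S then crossing_sign k S * f (S - {k}) else 0)"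
  "app (annihilate k) f S = (if k \<in> S then 0 else crossing_sign k S * f (insert k S))"
  "app (scale r) f S = r * f S"
  "app vacuum f S = (if S = {} then f {} else 0)"
  unfolding create_def annihilate_def scale_def vacuum_def
  by (subst app_Endo; force simp: distrib_left)+

lemma create_create: "create k * create l = - (create l * create k)"
proof (intro endo_eqI ext)
  fix f and S :: "nat set"
  show "app (create k * create l) f S = app (- (create l * create k)) f S"
  proof (cases "k \<in> S \<and> l \<in> S \<and> k \<noteq> l")
    case True
    then show ?thesis
      by (auto simp: app_fock_ops crossing_sign_remove Diff_insert2[symmetric]
          crossing_sign_commute[of "crossing_sign k S" l S] insert_commute[of k l])
  qed (auto simp: app_fock_ops)
qed

lemma annihilate_annihilate: "annihilate k * annihilate l = - (annihilate l * annihilate k)"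
proof (intro endo_eqI ext)
  fix f and S :: "nat set"
  show "app (annihilate k * annihilate l) f S = app (- (annihilate l * annihilate k)) f S"
  proof (cases "k \<notin> S \<and> l \<notin> S \<and> k \<noteq> l")
    case True
    then show ?thesis
      by (auto simp: app_fock_ops crossing_sign_insert insert_commute[of k l]
          crossing_sign_commute[of "crossing_sign k S" l S])
  qed (auto simp: app_fock_ops)
qed

lemma annihilate_create:
  "annihilate k * create l = (if k = l then 1 else 0) - create l * annihilate k"
proof (intro endo_eqI ext)
  fix f and S :: "nat set"
  show "app (annihilate k * create l) f S = app ((if k = l then 1 else 0) - create l * annihilate k) f S"
  proof (cases "k = l")
    case True
    then show ?thesis
      by (auto simp: app_fock_ops crossing_sign_insert crossing_sign_remove crossing_sign_square insert_absorb)
  next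
    case False
    then show ?thesis
      by (auto simp: app_fock_ops crossing_sign_insert crossing_sign_remove insert_Diff_if
          crossing_sign_commute[of "crossing_sign k S" l S])
  qed
qed

lemma scale_commute:
  "scale r * create k = create k * scale r"
  "scale r * annihilate k = annihilate k * scale r"
  "scale r * vacuum = vacuum * scale r"
  by (auto intro!: endo_eqI ext simp: app_fock_ops crossing_sign_commute[of r])

lemma scale_hom:
  "scale (r + s) = scale r + scale s" "scale (r - s) = scale r - scale s"
  "scale (r * s) = scale r * scale s" "scale 1 = 1" "scale 0 = 0"
  by (auto intro!: endo_eqI ext simp: app_fock_ops algebra_simps)

lemma annihilate_vacuum: "annihilate k * vacuum = 0"
  by (auto intro!: endo_eqI ext simp: app_fock_ops)

lemma scale_vacuum_eq_0D:
  assumes "scale r * vacuum = 0"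
  shows "r = 0"
proof -
  have "app (scale r * vacuum) (\<lambda>_. 1) {} = r"
    by (simp add: app_fock_ops)
  then show ?thesis
    by (simp add: assms)
qed

lemma endo_two_torsion_free:
  assumes "\<And>v :: 'v::ring_1. v + v = 0 \<Longrightarrow> v = 0" and "u + u = (0 :: 'v endo)"
  shows "u = 0"
proof (rule endo_eqI)
  fix v
  have "app u v + app u v = app (u + u) v"
    by (simp only: app_simps)
  also have "\<dots> = 0"
    by (simp add: assms(2))
  finally show "app u v = app 0 v"
    unfolding app_simps by (rule assms(1))
qed

text \<open>\<open>create\<close> and \<open>annihilate\<close> have one index in a linear order;
  the injection \<open>prod_encode\<close> numbers the pairs (g, i).\<close>

lemma fock_operators:
  fixes E :: "nat \<Rightarrow> nat \<Rightarrow> 'r::ring_1"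
  assumes "\<And>i j k l. \<lbrakk>i \<in> {1..n}; j \<in> {1..n}; k \<in> {1..n}; l \<in> {1..n}\<rbrakk> \<Longrightarrow>
      E i j * E k l = E k l * E i j + (if j = k then E i l else 0) - (if i = l then E k j else 0)"
    and torsion: "\<And>u :: 'r. u + u = 0 \<Longrightarrow> u = 0"
  shows "fock n (\<lambda>g i. create (prod_encode (g, i))) (\<lambda>g i. annihilate (prod_encode (g, i)))
    (\<lambda>i j. scale (E i j))"
proof
  fix u :: "(nat set \<Rightarrow> 'r) endo"
  assume "u + u = 0"
  moreover have "v = 0" if "v + v = 0" for v :: "nat set \<Rightarrow> 'r"
  proof
    fix S
    have "v S + v S = 0"
      using fun_cong[OF that, of S] by (simp only: plus_fun_apply zero_fun_apply)
    then show "v S = 0 S"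
      unfolding zero_fun_apply by (rule torsion)
  qed
  ultimately show "u = 0"
    by (rule endo_two_torsion_free[rotated])
next
  fix i j k l assume "i \<in> {1..n}" "j \<in> {1..n}" "k \<in> {1..n}" "l \<in> {1..n}"
  from assms(1)[OF this] show "scale (E i j) * scale (E k l) = scale (E k l) * scale (E i j) +
      (if j = k then scale (E i l) else 0) - (if i = l then scale (E k j) else 0)"
    by (simp add: scale_hom(1,2,5) flip: scale_hom(3))
qed (rule create_create annihilate_annihilate scale_commute | simp add: annihilate_create prod_encode_eq)+

section \<open>The free algebra and its quotients\<close>

lemma poly_mapping_sum_single: "(\<Sum>w\<in>Poly_Mapping.keys f. Poly_Mapping.single w (Poly_Mapping.lookup f w)) = f"
  by (rule poly_mapping_eqI) (simp add: lookup_sum lookup_single when_def in_keys_iff)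

lemma poly_mapping_induct_single:
  fixes f :: "'a \<Rightarrow>\<^sub>0 'b::comm_monoid_add"
  assumes "P 0" "\<And>f g. P f \<Longrightarrow> P g \<Longrightarrow> P (f + g)" "\<And>w. w \<in> Poly_Mapping.keys f \<Longrightarrow> P (Poly_Mapping.single w (Poly_Mapping.lookup f w))"
  shows "P f"
proof -
  have "P (\<Sum>w\<in>K. Poly_Mapping.single w (Poly_Mapping.lookup f w))" if "finite K" "K \<subseteq> Poly_Mapping.keys f" for K
    using that by (induction K) (auto intro: assms)
  from this[of "Poly_Mapping.keys f"] show ?thesis
    by (simp add: poly_mapping_sum_single)
qed

lemma free_scalar_add: "free_scalar (c + d) = free_scalar c + free_scalar d"
  and free_scalar_mult: "free_scalar (c * d) = free_scalar c * free_scalar d"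
  and free_scalar_1: "free_scalar 1 = 1"
  and free_scalar_0: "free_scalar 0 = 0"
  by (simp_all add: free_scalar_def single_add mult_single)

lemma free_scalar_of_int: "free_scalar (of_int k) = of_int k"
  by (simp add: free_scalar_def)

lemma free_scalar_commute: "free_scalar c * f = f * free_scalar c"
proof (rule poly_mapping_induct_single[of "\<lambda>f. free_scalar c * f = f * free_scalar c"])
  show "free_scalar c * Poly_Mapping.single w (Poly_Mapping.lookup f w) = Poly_Mapping.single w (Poly_Mapping.lookup f w) * free_scalar c" for w
    by (simp add: free_scalar_def mult_single mult.commute)
qed (simp_all add: algebra_simps)

lemma single_eq_free_scalar: "Poly_Mapping.single w c = free_scalar c * Poly_Mapping.single w 1"
  by (simp add: free_scalar_def mult_single)

lemma single_eq_word_prod: "Poly_Mapping.single w 1 = word_prod free_gen (letters w)"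
proof -
  have "Poly_Mapping.single (FWord u) 1 = word_prod free_gen u" for u
  proof (induction u)
    case Nil
    then show ?case
      by (simp flip: zero_fword_def single_one)
  next
    case (Cons p u)
    have "FWord (p # u) = FWord [p] + FWord u"
      by (simp add: plus_fword_def)
    then have "Poly_Mapping.single (FWord (p # u)) 1 = Poly_Mapping.single (FWord [p]) 1 * Poly_Mapping.single (FWord u) (1 :: complex)"
      by (simp add: mult_single)
    then show ?case
      using Cons by (cases p) (simp add: free_gen_def)
  qed
  from this[of "letters w"] show ?thesis
    by simp
qed

section \<open>Evaluation homomorphisms of the free algebra\<close>

definition eval_free :: "(complex \<Rightarrow> 'r::ring_1) \<Rightarrow> (symb \<Rightarrow> symb \<Rightarrow> 'r) \<Rightarrow> free_elem \<Rightarrow> 'r" where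
  "eval_free \<kappa> e f = (\<Sum>w\<in>Poly_Mapping.keys f. \<kappa> (Poly_Mapping.lookup f w) * word_prod e (letters w))"

text \<open>The universal property of the free algebra. The target is merely a ring, so \<kappa>
  supplies the scalars, and its values must commute with the images of the generators.\<close>

locale free_eval =
  fixes \<kappa> :: "complex \<Rightarrow> 'r::ring_1" and e :: "symb \<Rightarrow> symb \<Rightarrow> 'r"
  assumes \<kappa>_add: "\<kappa> (c + d) = \<kappa> c + \<kappa> d"
    and \<kappa>_mult: "\<kappa> (c * d) = \<kappa> c * \<kappa> d"
    and \<kappa>_one: "\<kappa> 1 = 1"
    and \<kappa>_e: "\<kappa> c * e a b = e a b * \<kappa> c"
begin

abbreviation eval :: "free_elem \<Rightarrow> 'r" where "eval \<equiv> eval_free \<kappa> e"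

lemma \<kappa>_zero [simp]: "\<kappa> 0 = 0"
  using \<kappa>_add[of 0 0] by simp

lemma \<kappa>_word: "\<kappa> c * word_prod e u = word_prod e u * \<kappa> c"
  unfolding word_prod_def by (rule prod_list_commute) (auto simp: \<kappa>_e)

lemma eval_superset:
  assumes "finite K" "Poly_Mapping.keys f \<subseteq> K"
  shows "eval f = (\<Sum>w\<in>K. \<kappa> (Poly_Mapping.lookup f w) * word_prod e (letters w))"
  unfolding eval_free_def using assms
  by (intro sum.mono_neutral_left) (auto simp: in_keys_iff)

lemma eval_add: "eval (f + g) = eval f + eval g"
proof -
  have "Poly_Mapping.keys (f + g) \<subseteq> Poly_Mapping.keys f \<union> Poly_Mapping.keys g"
    by (rule keys_add)
  then show ?thesis
    by (subst (1 2 3) eval_superset[of "Poly_Mapping.keys f \<union> Poly_Mapping.keys g"])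
      (auto simp: lookup_add \<kappa>_add distrib_right sum.distrib)
qed

lemma eval_zero [simp]: "eval 0 = 0"
  by (simp add: eval_free_def)

lemma eval_single: "eval (Poly_Mapping.single w c) = \<kappa> c * word_prod e (letters w)"
  by (cases "c = 0") (simp_all add: eval_free_def)

lemma eval_mult: "eval (f * g) = eval f * eval g"
proof (rule poly_mapping_induct_single[of "\<lambda>f. eval (f * g) = eval f * eval g"])
  fix w
  show "eval (Poly_Mapping.single w (Poly_Mapping.lookup f w) * g) = eval (Poly_Mapping.single w (Poly_Mapping.lookup f w)) * eval g"
  proof (rule poly_mapping_induct_single[of "\<lambda>g. eval (Poly_Mapping.single w (Poly_Mapping.lookup f w) * g) = eval (Poly_Mapping.single w (Poly_Mapping.lookup f w)) * eval g"])
    fix v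
    show "eval (Poly_Mapping.single w (Poly_Mapping.lookup f w) * Poly_Mapping.single v (Poly_Mapping.lookup g v)) =
        eval (Poly_Mapping.single w (Poly_Mapping.lookup f w)) * eval (Poly_Mapping.single v (Poly_Mapping.lookup g v))"
    proof -
      have "word_prod e (letters (w + v)) = word_prod e (letters w) * word_prod e (letters v)"
        by (simp add: plus_fword_def)
      then have "eval (Poly_Mapping.single w (Poly_Mapping.lookup f w) * Poly_Mapping.single v (Poly_Mapping.lookup g v)) =
          \<kappa> (Poly_Mapping.lookup f w) * (\<kappa> (Poly_Mapping.lookup g v) * word_prod e (letters w)) * word_prod e (letters v)"
        by (simp add: mult_single eval_single \<kappa>_mult mult.assoc)
      then show ?thesis
        unfolding \<kappa>_word by (simp add: eval_single mult.assoc)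
    qed
  qed (simp_all add: distrib_left eval_add)
qed (simp_all add: distrib_right eval_add)

lemma eval_one [simp]: "eval 1 = 1"
proof -
  have "letters (0 :: (symb \<times> symb) fword) = []"
    by (simp add: zero_fword_def)
  then show ?thesis
    using eval_single[of 0 1] by (simp add: \<kappa>_one)
qed

lemma eval_minus: "eval (f - g) = eval f - eval g"
  using eval_add[of "f - g" g] by simp

lemma eval_uminus: "eval (- f) = - eval f"
  using eval_minus[of 0 f] by simp

lemma eval_sum: "eval (sum f A) = (\<Sum>i\<in>A. eval (f i))"
  by (induction A rule: infinite_finite_induct) (simp_all add: eval_add)

lemma eval_prod_list: "eval (prod_list L) = prod_list (map eval L)"
  by (induction L) (simp_all add: eval_mult)

lemma eval_of_int: "eval (of_int k) = of_int k"
proof -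
  have nat: "eval (of_nat l) = of_nat l" for l
    by (induction l) (simp_all add: eval_add)
  show ?thesis
    by (cases k) (simp_all add: nat eval_minus eval_uminus)
qed

lemma eval_gen: "eval (free_gen a b) = e a b"
  by (simp add: free_gen_def eval_single \<kappa>_one)

lemma eval_scalar: "eval (free_scalar c) = \<kappa> c"
  by (simp add: free_scalar_def eval_single zero_fword_def)

lemma eval_capelli_det: "eval (capelli_det E t I) = capelli_det (\<lambda>i j. eval (E i j)) t I"
proof -
  have "eval (capelli_entry E t I i j) = capelli_entry (\<lambda>i j. eval (E i j)) t I i j" for i j
    by (simp only: capelli_entry_def eval_add eval_of_int eval_zero if_distrib[of eval])
  then show ?thesis
    by (simp only: capelli_det_def eval_sum eval_mult eval_of_int eval_prod_list map_map o_def)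
qed

end

section \<open>Free subalgebras on a set of symbols\<close>

definition free_carrier :: "symb set \<Rightarrow> free_elem set" where
  "free_carrier S = {f. \<forall>w\<in>Poly_Mapping.keys f. set (letters w) \<subseteq> S \<times> S}"

lemma free_carrier_add: "f \<in> free_carrier S \<Longrightarrow> g \<in> free_carrier S \<Longrightarrow> f + g \<in> free_carrier S"
  using keys_add[of f g] by (auto simp: free_carrier_def)

lemma free_carrier_mult: "f \<in> free_carrier S \<Longrightarrow> g \<in> free_carrier S \<Longrightarrow> f * g \<in> free_carrier S"
  using keys_mult[of f g] by (fastforce simp: free_carrier_def plus_fword_def)

lemma free_carrier_scalar: "free_scalar c \<in> free_carrier S"
  by (simp add: free_carrier_def free_scalar_def zero_fword_def)

lemma free_carrier_of_int: "of_int k \<in> free_carrier S"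
  by (metis free_carrier_scalar free_scalar_of_int)

lemma free_carrier_0: "0 \<in> free_carrier S"
  by (simp add: free_carrier_def)

lemma free_carrier_1: "1 \<in> free_carrier S"
  using free_carrier_scalar[of 1 S] by (simp add: free_scalar_1)

lemma free_carrier_uminus: "f \<in> free_carrier S \<Longrightarrow> - f \<in> free_carrier S"
  using free_carrier_mult[OF free_carrier_of_int[of "- 1" S]] by simp

lemma free_carrier_minus: "f \<in> free_carrier S \<Longrightarrow> g \<in> free_carrier S \<Longrightarrow> f - g \<in> free_carrier S"
  using free_carrier_add[of f S "- g"] free_carrier_uminus by simp

lemma free_carrier_gen: "a \<in> S \<Longrightarrow> b \<in> S \<Longrightarrow> free_gen a b \<in> free_carrier S"
  by (simp add: free_carrier_def free_gen_def)

lemma free_carrier_sum: "(\<And>i. i \<in> A \<Longrightarrow> f i \<in> free_carrier S) \<Longrightarrow> sum f A \<in> free_carrier S"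
  by (induction A rule: infinite_finite_induct) (simp_all add: free_carrier_0 free_carrier_add)

lemma free_carrier_prod_list: "set L \<subseteq> free_carrier S \<Longrightarrow> prod_list L \<in> free_carrier S"
  by (induction L) (simp_all add: free_carrier_1 free_carrier_mult)

lemma free_carrier_word: "set u \<subseteq> S \<times> S \<Longrightarrow> word_prod free_gen u \<in> free_carrier S"
  unfolding word_prod_def by (rule free_carrier_prod_list) (auto intro: free_carrier_gen)

lemma free_carrier_mono: "S \<subseteq> T \<Longrightarrow> free_carrier S \<subseteq> free_carrier T"
  unfolding free_carrier_def by blast

lemma free_carrier_induct [consumes 1, case_names scalar gen add mult]:
  assumes "f \<in> free_carrier S"
    and scalar: "\<And>c. P (free_scalar c)"
    and gen: "\<And>a b. a \<in> S \<Longrightarrow> b \<in> S \<Longrightarrow> P (free_gen a b)"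
    and add: "\<And>f g. f \<in> free_carrier S \<Longrightarrow> g \<in> free_carrier S \<Longrightarrow> P f \<Longrightarrow> P g \<Longrightarrow> P (f + g)"
    and mult: "\<And>f g. f \<in> free_carrier S \<Longrightarrow> g \<in> free_carrier S \<Longrightarrow> P f \<Longrightarrow> P g \<Longrightarrow> P (f * g)"
  shows "P f"
proof -
  let ?Q = "\<lambda>f. f \<in> free_carrier S \<and> P f"
  have word: "?Q (word_prod free_gen u)" if "set u \<subseteq> S \<times> S" for u
    using that
  proof (induction u)
    case Nil
    then show ?case
      using scalar[of 1] by (simp add: free_scalar_1 free_carrier_1)
  next
    case (Cons p u)
    then show ?case
      by (cases p) (auto intro: mult gen free_carrier_gen free_carrier_mult)
  qed
  have "?Q f"
  proof (rule poly_mapping_induct_single[of ?Q])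
    show "?Q 0"
      using scalar[of 0] by (simp add: free_scalar_0 free_carrier_0)
    show "?Q (Poly_Mapping.single w (Poly_Mapping.lookup f w))" if "w \<in> Poly_Mapping.keys f" for w
    proof -
      have "set (letters w) \<subseteq> S \<times> S"
        using that assms(1) unfolding free_carrier_def by blast
      from word[OF this] have "?Q (free_scalar (Poly_Mapping.lookup f w) * word_prod free_gen (letters w))"
        by (auto intro: mult scalar free_carrier_mult free_carrier_scalar)
      then show ?thesis
        unfolding single_eq_free_scalar[of w "Poly_Mapping.lookup f w"] single_eq_word_prod .
    qed
  qed (auto intro: add free_carrier_add)
  then show ?thesis ..
qed

section \<open>Linear projections and quotient modules\<close>

interpretation free_space: vector_space "\<lambda>c x. free_scalar c * (x :: free_elem)"
  by unfold_locales (simp_all add: free_scalar_add free_scalar_mult free_scalar_1 distrib_left distrib_right mult.assoc)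

interpretation free_space_pair: vector_space_pair "\<lambda>c x. free_scalar c * (x :: free_elem)"
  "\<lambda>c x. free_scalar c * (x :: free_elem)" ..

text \<open>On C the kernel of \<pi> is J, so the image of \<pi> is a model of C / J within the same
  type.\<close>

definition free_projection :: "free_elem set \<Rightarrow> free_elem set \<Rightarrow> (free_elem \<Rightarrow> free_elem) \<Rightarrow> bool" where
  "free_projection J C \<pi> \<longleftrightarrow>
     (\<forall>x y. \<pi> (x + y) = \<pi> x + \<pi> y) \<and> (\<forall>c x. \<pi> (free_scalar c * x) = free_scalar c * \<pi> x) \<and>
     (\<forall>x. \<pi> (\<pi> x) = \<pi> x) \<and> (\<forall>x. \<pi> x \<in> C) \<and> (\<forall>x\<in>C. x - \<pi> x \<in> J) \<and> (\<forall>x\<in>J. \<pi> x = 0)"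

text \<open>A basis of J is extended to one of C; \<pi> kills the former and fixes the added
  vectors.\<close>

lemma free_projection_exists:
  assumes J: "free_space.subspace J" and C: "free_space.subspace C" and "J \<subseteq> C"
  shows "\<exists>\<pi>. free_projection J C \<pi>"
proof -
  obtain B where B: "B \<subseteq> J" "free_space.independent B" "J \<subseteq> free_space.span B"
    using free_space.maximal_independent_subset by blast
  obtain B' where B': "B \<subseteq> B'" "B' \<subseteq> C" "free_space.independent B'" "C \<subseteq> free_space.span B'"
    using free_space.maximal_independent_subset_extend[of B C] B(1,2) \<open>J \<subseteq> C\<close> by blast
  let ?f = "\<lambda>b. if b \<in> B then 0 else b"
  let ?\<pi> = "free_space_pair.construct B' ?f"
  interpret p: Vector_Spaces.linear "\<lambda>c x. free_scalar c * (x :: free_elem)" "\<lambda>c x. free_scalar c * (x :: free_elem)" ?\<pi>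
    by (rule free_space_pair.linear_construct) fact
  have basis: "?\<pi> b = ?f b" if "b \<in> B'" for b
    by (rule free_space_pair.construct_basis) fact+
  have "?f ` B' \<subseteq> C"
    using B'(2) free_space.subspace_0[OF C] by auto
  then have "free_space.span (?f ` B') \<subseteq> C"
    by (rule free_space.span_minimal) (rule C)
  then have range: "?\<pi> x \<in> C" for x
    using free_space_pair.construct_in_span[OF B'(3)] by blast
  have diff: "x - ?\<pi> x \<in> J" if "x \<in> C" for x
  proof -
    have "x \<in> free_space.span B'"
      using that B'(4) by blast
    then show ?thesis
    proof (induction rule: free_space.span_induct_alt)
      case base
      then show ?case
        using free_space.subspace_0[OF J] by (simp add: p.zero)
    next
      case (step c b y)
      have "b - ?\<pi> b \<in> J"
        using basis[OF step(1)] B(1) free_space.subspace_0[OF J] by auto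
      then have "free_scalar c * (b - ?\<pi> b) + (y - ?\<pi> y) \<in> J"
        using step(2) J by (simp add: free_space.subspace_def)
      then show ?case
        by (simp add: p.add p.scale algebra_simps)
    qed
  qed
  have zero: "?\<pi> x = 0" if "x \<in> J" for x
  proof -
    have "x \<in> free_space.span B"
      using that B(3) by blast
    then show ?thesis
      by (induction rule: free_space.span_induct_alt)
        (use B'(1) basis in \<open>auto simp: p.zero p.add p.scale\<close>)
  qed
  have "?\<pi> x = x" if "x \<in> free_space.span (?f ` B')" for x
    using that
    by (induction rule: free_space.span_induct_alt) (auto simp: p.zero p.add p.scale basis)
  then have idem: "?\<pi> (?\<pi> x) = ?\<pi> x" for x
    using free_space_pair.construct_in_span[OF B'(3)] by blast
  show ?thesis
    using idem p.add p.scale range diff zero by (intro exI[of _ ?\<pi>]) (simp add: free_projection_def)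
qed

definition scalar_endo :: "complex \<Rightarrow> free_elem endo" where
  "scalar_endo c = Endo (\<lambda>v. free_scalar c * v)"

lemma app_scalar_endo: "app (scalar_endo c) v = free_scalar c * v"
  by (simp add: scalar_endo_def app_Endo distrib_left)

lemma free_elem_two_torsion_free:
  fixes x :: free_elem
  assumes "x + x = 0"
  shows "x = 0"
proof (rule poly_mapping_eqI)
  fix w
  have "Poly_Mapping.lookup (x + x) w = 0"
    using assms by simp
  then show "Poly_Mapping.lookup x w = Poly_Mapping.lookup 0 w"
    by (simp add: lookup_add)
qed

text \<open>
  The quotient of the free algebra by \<open>J\<close> is realized on a complement of \<open>J\<close>, so that it
  becomes an actual representation of the Lie superalgebra on the type \<^typ>\<open>free_elem\<close>.
\<close>

locale free_quotient =
  fixes m n :: nat and J :: "free_elem set"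
  assumes J_sub: "J \<subseteq> free_carrier (symbols m n)"
    and J_add: "x \<in> J \<Longrightarrow> y \<in> J \<Longrightarrow> x + y \<in> J"
    and J_left: "x \<in> free_carrier (symbols m n) \<Longrightarrow> y \<in> J \<Longrightarrow> x * y \<in> J"
    and J_relators: "r \<in> env_relators m n \<Longrightarrow> x \<in> free_carrier (symbols m n) \<Longrightarrow> r * x \<in> J"
    and J_0: "0 \<in> J"
begin

abbreviation "C \<equiv> free_carrier (symbols m n)"

lemma J_subspace: "free_space.subspace J"
  using J_add J_left J_0 free_carrier_scalar by (auto simp: free_space.subspace_def)

lemma C_subspace: "free_space.subspace C"
  by (simp add: free_space.subspace_def free_carrier_0 free_carrier_add free_carrier_mult free_carrier_scalar)

definition \<pi> :: "free_elem \<Rightarrow> free_elem" where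
  "\<pi> = (SOME \<pi>. free_projection J C \<pi>)"

lemma projection_\<pi>: "free_projection J C \<pi>"
  using someI_ex[OF free_projection_exists[OF J_subspace C_subspace J_sub]] unfolding \<pi>_def .

lemma \<pi>_add: "\<pi> (x + y) = \<pi> x + \<pi> y"
  and \<pi>_scalar: "\<pi> (free_scalar c * x) = free_scalar c * \<pi> x"
  and \<pi>_\<pi>: "\<pi> (\<pi> x) = \<pi> x"
  and \<pi>_C: "\<pi> x \<in> C"
  and \<pi>_diff: "x \<in> C \<Longrightarrow> x - \<pi> x \<in> J"
  and \<pi>_J: "x \<in> J \<Longrightarrow> \<pi> x = 0"
  using projection_\<pi> unfolding free_projection_def by blast+

lemma \<pi>_0 [simp]: "\<pi> 0 = 0"
  using \<pi>_J[OF J_0] .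

lemma \<pi>_minus: "\<pi> (x - y) = \<pi> x - \<pi> y"
  using \<pi>_add[of "x - y" y] by simp

lemma \<pi>_eq_0_iff: "x \<in> C \<Longrightarrow> \<pi> x = 0 \<longleftrightarrow> x \<in> J"
  using \<pi>_diff[of x] \<pi>_J[of x] by auto

lemma \<pi>_mult_\<pi>:
  assumes "x \<in> C" "y \<in> C"
  shows "\<pi> (x * \<pi> y) = \<pi> (x * y)"
proof -
  have "\<pi> (x * (y - \<pi> y)) = 0"
    using assms by (intro \<pi>_J J_left \<pi>_diff)
  then show ?thesis
    by (simp add: right_diff_distrib \<pi>_minus)
qed

text \<open>The outer \<pi> reduces modulo J; the inner one extends the action from the complement
  to the whole type, by 0 on the kernel of \<pi>.\<close>

definition rep :: "symb \<Rightarrow> symb \<Rightarrow> free_elem endo" where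
  "rep a b = Endo (\<lambda>v. \<pi> (free_gen a b * \<pi> v))"

lemma app_rep: "app (rep a b) v = \<pi> (free_gen a b * \<pi> v)"
  by (simp add: rep_def app_Endo \<pi>_add distrib_left)

lemma app_rep_rep:
  assumes "a \<in> symbols m n" "b \<in> symbols m n" "c \<in> symbols m n" "d \<in> symbols m n"
  shows "app (rep a b * rep c d) v = \<pi> (free_gen a b * free_gen c d * \<pi> v)"
  using assms by (simp add: app_rep \<pi>_\<pi> \<pi>_mult_\<pi> free_carrier_gen free_carrier_mult \<pi>_C mult.assoc)

sublocale rep: gl_super m n rep
proof
  fix a b c d
  assume in_symbols: "a \<in> symbols m n" "b \<in> symbols m n" "c \<in> symbols m n" "d \<in> symbols m n"
  show "rep a b * rep c d - super_sign a b c d * (rep c d * rep a b) =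
    (if b = c then rep a d else 0) - super_sign a b c d * (if a = d then rep c b else 0)"
  proof (rule endo_eqI)
    fix v
    have "free_gen a b * free_gen c d - bracket_sign a b c d * (free_gen c d * free_gen a b)
        - gl_bracket a b c d \<in> env_relators m n"
      using in_symbols unfolding env_relators_def by blast
    \<comment> \<open>J is closed under multiplication from the left; that relators act as 0 on C /
      J is the separate assumption \<open>J_relators\<close>.\<close>
    from \<pi>_J[OF J_relators[OF this \<pi>_C]]
    have "\<pi> ((free_gen a b * free_gen c d - bracket_sign a b c d * (free_gen c d * free_gen a b)
        - gl_bracket a b c d) * \<pi> v) = 0" .
    then have rel: "\<pi> (free_gen a b * free_gen c d * \<pi> v)
        - \<pi> (bracket_sign a b c d * (free_gen c d * free_gen a b) * \<pi> v)
        - \<pi> ((if b = c then free_gen a d else 0) * \<pi> v)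
        + \<pi> (bracket_sign a b c d * (if a = d then free_gen c b else 0) * \<pi> v) = 0"
      by (simp add: gl_bracket_def left_diff_distrib \<pi>_minus)
    have neg: "\<pi> (- x) = - \<pi> x" for x
      using \<pi>_minus[of 0 x] by simp
    have ifs: "app (if b = c then rep a d else 0) v = \<pi> ((if b = c then free_gen a d else 0) * \<pi> v)"
      "app (if a = d then rep c b else 0) v = \<pi> ((if a = d then free_gen c b else 0) * \<pi> v)"
      by (simp_all add: app_rep)
    note products = app_rep_rep[OF in_symbols, of v] app_rep_rep[OF in_symbols(3,4,1,2), of v]
    consider "bracket_sign a b c d = 1" "super_sign a b c d = (1 :: free_elem endo)"
      | "bracket_sign a b c d = - 1" "super_sign a b c d = (- 1 :: free_elem endo)"
      by (cases "even ((parity a + parity b) * (parity c + parity d))")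
        (simp_all add: bracket_sign_def super_sign_def)
    then show "app (rep a b * rep c d - super_sign a b c d * (rep c d * rep a b)) v =
      app ((if b = c then rep a d else 0) - super_sign a b c d * (if a = d then rep c b else 0)) v"
    proof cases
      case 1
      show ?thesis
        using rel unfolding 1 mult_1_left app_simps(4) products ifs by (simp add: algebra_simps)
    next
      case 2
      show ?thesis
        using rel unfolding 2 mult_minus_left mult_1_left app_simps(4,5) products ifs neg by (simp add: algebra_simps)
    qed
  qed
next
  show "u = 0" if "u + u = 0" for u :: "free_elem endo"
    using free_elem_two_torsion_free that by (rule endo_two_torsion_free)
qed

lemma scalar_endo_rep: "scalar_endo c * rep a b = rep a b * scalar_endo c"
proof (rule endo_eqI)
  fix v
  have "free_gen a b * (free_scalar c * \<pi> v) = free_scalar c * (free_gen a b * \<pi> v)"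
    by (simp only: free_scalar_commute[of c "free_gen a b"] flip: mult.assoc)
  then show "app (scalar_endo c * rep a b) v = app (rep a b * scalar_endo c) v"
    by (simp only: app_simps app_scalar_endo app_rep \<pi>_scalar)
qed

lemma scalar_endo_hom:
  "scalar_endo (c + d) = scalar_endo c + scalar_endo d"
  "scalar_endo (c * d) = scalar_endo c * scalar_endo d"
  "scalar_endo 1 = 1"
  by (rule endo_eqI, simp only: app_simps app_scalar_endo free_scalar_add free_scalar_mult
      free_scalar_1 distrib_right mult.assoc mult_1_left)+

sublocale rep: free_eval scalar_endo rep
  by unfold_locales (rule scalar_endo_hom scalar_endo_rep)+

text \<open>Restricted to the image of \<pi>, because \<open>scalar_endo\<close> acts on the whole
  type and the identity is not reduced modulo J.\<close>

lemma app_eval: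
  assumes "x \<in> C"
  shows "app (rep.eval x) (\<pi> y) = \<pi> (x * \<pi> y)"
  using assms
proof (induction arbitrary: y rule: free_carrier_induct)
  case (scalar c)
  then show ?case
    by (simp add: rep.eval_scalar app_scalar_endo \<pi>_scalar \<pi>_\<pi>)
next
  case (gen a b)
  then show ?case
    by (simp add: rep.eval_gen app_rep \<pi>_\<pi>)
next
  case (add f g)
  then show ?case
    by (simp add: rep.eval_add \<pi>_add distrib_right)
next
  case (mult f g)
  then show ?case
    by (simp add: rep.eval_mult \<pi>_mult_\<pi> free_carrier_mult \<pi>_C mult.assoc)
qed

lemma app_eval_1: "x \<in> C \<Longrightarrow> app (rep.eval x) (\<pi> 1) = \<pi> x"
  by (simp add: app_eval \<pi>_mult_\<pi> free_carrier_1)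

end

section \<open>The enveloping algebra\<close>

lemma carrier_free_alg [simp]: "carrier (free_alg m n) = free_carrier (symbols m n)"
  by (simp add: free_alg_def free_carrier_def)

lemma free_alg_ops [simp]:
  "x \<otimes>\<^bsub>free_alg m n\<^esub> y = x * y" "x \<oplus>\<^bsub>free_alg m n\<^esub> y = x + y"
  "\<one>\<^bsub>free_alg m n\<^esub> = 1" "\<zero>\<^bsub>free_alg m n\<^esub> = 0"
  by (simp_all add: free_alg_def)

lemma ring_free_alg: "ring (free_alg m n)"
proof (rule ringI)
  show "abelian_group (free_alg m n)"
  proof (rule abelian_groupI)
    show "\<exists>y\<in>carrier (free_alg m n). y \<oplus>\<^bsub>free_alg m n\<^esub> x = \<zero>\<^bsub>free_alg m n\<^esub>"
      if "x \<in> carrier (free_alg m n)" for x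
      using that by (intro bexI[of _ "- x"]) (simp_all add: free_carrier_uminus)
  qed (simp_all add: free_carrier_add free_carrier_0 algebra_simps)
  show "monoid (free_alg m n)"
    by (rule monoidI) (simp_all add: free_carrier_mult free_carrier_1 mult.assoc)
qed (simp_all add: algebra_simps)

lemma bracket_sign_eq: "bracket_sign a b c d = of_int (super_sign a b c d)"
  by (simp add: bracket_sign_def super_sign_def)

lemma of_int_super_sign: "of_int (super_sign a b c d) = super_sign a b c d"
  by (simp add: super_sign_def)

lemma env_relators_subset: "env_relators m n \<subseteq> free_carrier (symbols m n)"
  unfolding env_relators_def gl_bracket_def bracket_sign_eq
  by (clarify, intro free_carrier_minus free_carrier_mult free_carrier_of_int)
    (simp_all add: free_carrier_gen free_carrier_0)

lemma (in ring_hom_ring) hom_add_pow_int: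
  assumes "x \<in> carrier R"
  shows "h ([(k::int)] \<cdot>\<^bsub>R\<^esub> x) = [k] \<cdot>\<^bsub>S\<^esub> h x"
proof -
  have "group_hom (add_monoid R) (add_monoid S) h"
    using a_group_hom .
  from group_hom.hom_int_pow[OF this, of x k] show ?thesis
    using assms by (simp add: add_pow_def)
qed

lemma free_alg_add_pow:
  assumes "x \<in> free_carrier (symbols m n)"
  shows "[(k::int)] \<cdot>\<^bsub>free_alg m n\<^esub> x = of_int k * x"
proof -
  interpret ring "free_alg m n"
    by (rule ring_free_alg)
  have nat: "[(l::nat)] \<cdot>\<^bsub>free_alg m n\<^esub> x = of_nat l * x" for l
    by (induction l) (simp_all add: algebra_simps)
  have neg: "\<ominus>\<^bsub>free_alg m n\<^esub> y = - y" if "y \<in> free_carrier (symbols m n)" for y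
    using that by (intro minus_equality) (simp_all add: free_carrier_uminus)
  show ?thesis
  proof (cases "0 \<le> k")
    case True
    then show ?thesis
      using add_pow_int_ge[OF True, of "free_alg m n" x] nat[of "nat k"] by simp
  next
    case False
    then have "[k] \<cdot>\<^bsub>free_alg m n\<^esub> x = \<ominus>\<^bsub>free_alg m n\<^esub> (of_nat (nat (- k)) * x)"
      using add_pow_int_lt[of k "free_alg m n" x] nat[of "nat (- k)"] by simp
    also have "\<dots> = - (of_nat (nat (- k)) * x)"
    proof (rule neg)
      have "of_int (int l) * x \<in> free_carrier (symbols m n)" for l
        by (intro free_carrier_mult free_carrier_of_int assms)
      then show "of_nat (nat (- k)) * x \<in> free_carrier (symbols m n)"
        by (simp only: of_int_of_nat_eq)
    qed
    finally show ?thesis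
      using False by simp
  qed
qed

locale envelope =
  fixes m n :: nat
begin

abbreviation "U \<equiv> Ugl m n"
abbreviation "cl \<equiv> env_class m n"
abbreviation "I \<equiv> env_ideal m n"
abbreviation "C \<equiv> free_carrier (symbols m n)"
abbreviation "C0 \<equiv> free_carrier (proper_symbols n)"

sublocale FA: ring "free_alg m n"
  by (rule ring_free_alg)

sublocale I: ideal I "free_alg m n"
  unfolding env_ideal_def by (rule FA.genideal_ideal) (simp add: env_relators_subset)

sublocale cl: ring_hom_ring "free_alg m n" U cl
  using I.rcos_ring_hom_ring unfolding Ugl_def env_class_def[abs_def] .

lemma I_subset: "I \<subseteq> C"
  using I.a_subset by simp

lemma cl_eq_zero_iff: "x \<in> C \<Longrightarrow> cl x = \<zero>\<^bsub>U\<^esub> \<longleftrightarrow> x \<in> I"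
proof -
  assume x: "x \<in> C"
  have "\<zero>\<^bsub>U\<^esub> = I"
    by (simp add: Ugl_def FactRing_def)
  then show ?thesis
    using I.a_rcos_self[of x] I.a_rcos_const[of x] x by (auto simp: env_class_def)
qed

lemma cl_closed: "x \<in> C \<Longrightarrow> cl x \<in> carrier U"
  using cl.hom_closed by simp

lemma cl_add: "x \<in> C \<Longrightarrow> y \<in> C \<Longrightarrow> cl (x + y) = cl x \<oplus>\<^bsub>U\<^esub> cl y"
  using cl.hom_add[of x y] by simp

lemma cl_mult: "x \<in> C \<Longrightarrow> y \<in> C \<Longrightarrow> cl (x * y) = cl x \<otimes>\<^bsub>U\<^esub> cl y"
  using cl.hom_mult[of x y] by simp

lemma cl_one: "cl 1 = \<one>\<^bsub>U\<^esub>"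
  using cl.hom_one by simp

lemma cl_zero: "cl 0 = \<zero>\<^bsub>U\<^esub>"
  using cl.hom_zero by simp

lemma cl_uminus: "x \<in> C \<Longrightarrow> cl (- x) = \<ominus>\<^bsub>U\<^esub> cl x"
  by (metis cl.S.minus_equality cl_add cl_closed cl_zero free_carrier_uminus add.left_inverse)

lemma cl_minus: "x \<in> C \<Longrightarrow> y \<in> C \<Longrightarrow> cl (x - y) = cl x \<ominus>\<^bsub>U\<^esub> cl y"
  using cl_add[of x "- y"] by (simp add: cl_uminus free_carrier_uminus a_minus_def)

lemma cl_of_int: "x \<in> C \<Longrightarrow> cl (of_int k * x) = [k] \<cdot>\<^bsub>U\<^esub> cl x"
  using cl.hom_add_pow_int[of x k] by (simp add: free_alg_add_pow)

lemma cl_sum: "(\<And>i. i \<in> A \<Longrightarrow> f i \<in> C) \<Longrightarrow> cl (sum f A) = (\<Oplus>\<^bsub>U\<^esub>i\<in>A. cl (f i))"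
proof (induction A rule: infinite_finite_induct)
  case (insert i A)
  then show ?case
    using cl.S.finsum_insert[OF insert(1,2), of "\<lambda>i. cl (f i)"]
    by (simp add: cl_add cl_closed free_carrier_sum Pi_def)
qed (simp_all add: cl_zero)

lemma cl_prod_list: "set L \<subseteq> C \<Longrightarrow> cl (prod_list L) = list_mult U (map cl L)"
  by (induction L) (simp_all add: list_mult_def cl_one cl_mult free_carrier_prod_list)

lemma carrier_U: "carrier U = cl ` C"
  unfolding Ugl_def env_class_def[abs_def] by (auto simp: FactRing_def A_RCOSETS_def')

lemma e_word_eq: "set u \<subseteq> symbols m n \<times> symbols m n \<Longrightarrow> e_word m n u = cl (word_prod free_gen u)"
  unfolding word_prod_def
  by (subst cl_prod_list)
    (auto simp: e_word_def env_gen_def case_prod_unfold comp_def intro!: free_carrier_gen)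

lemma C0_subset: "C0 \<subseteq> C"
  by (rule free_carrier_mono) (auto simp: symbols_def)

lemma C0_D: "x \<in> C0 \<Longrightarrow> x \<in> C"
  using C0_subset by blast

lemma Ugl_proper_eq: "Ugl_proper m n = cl ` C0"
proof
  let ?H = "range (\<lambda>c. cl (free_scalar c)) \<union>
    {env_gen m n a b | a b. a \<in> proper_symbols n \<and> b \<in> proper_symbols n}"
  show "Ugl_proper m n \<subseteq> cl ` C0"
  proof
    fix u assume "u \<in> Ugl_proper m n"
    then have "u \<in> generate_ring U ?H"
      by (simp add: Ugl_proper_def)
    then show "u \<in> cl ` C0"
    proof (induction rule: generate_ring.induct)
      case one
      then show ?case
        using cl_one free_carrier_1 by (metis image_eqI)
    next
      case (incl h)
      then show ?case
        by (auto simp: env_gen_def intro!: imageI free_carrier_scalar free_carrier_gen)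
    next
      case (a_inv h)
      then obtain x where x: "x \<in> C0" "h = cl x"
        by blast
      then have "\<ominus>\<^bsub>U\<^esub> h = cl (- x)"
        by (simp add: cl_uminus C0_D)
      then show ?case
        using x free_carrier_uminus by blast
    next
      case (eng_add h1 h2)
      then obtain x y where x: "x \<in> C0" "h1 = cl x" and y: "y \<in> C0" "h2 = cl y"
        by blast
      then have "h1 \<oplus>\<^bsub>U\<^esub> h2 = cl (x + y)"
        by (simp add: cl_add C0_D)
      then show ?case
        using x y free_carrier_add by blast
    next
      case (eng_mult h1 h2)
      then obtain x y where x: "x \<in> C0" "h1 = cl x" and y: "y \<in> C0" "h2 = cl y"
        by blast
      then have "h1 \<otimes>\<^bsub>U\<^esub> h2 = cl (x * y)"
        by (simp add: cl_mult C0_D)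
      then show ?case
        using x y free_carrier_mult by blast
    qed
  qed
  show "cl ` C0 \<subseteq> Ugl_proper m n"
  proof
    fix u assume "u \<in> cl ` C0"
    then obtain x where "x \<in> C0" "u = cl x"
      by blast
    from this(1) have "cl x \<in> generate_ring U ?H"
    proof (induction rule: free_carrier_induct)
      case (add f g)
      then show ?case
        by (simp add: cl_add C0_D generate_ring.eng_add)
    next
      case (mult f g)
      then show ?case
        by (simp add: cl_mult C0_D generate_ring.eng_mult)
    qed (auto intro!: generate_ring.incl simp: env_gen_def)
    then show "u \<in> Ugl_proper m n"
      by (simp add: Ugl_proper_def \<open>u = cl x\<close>)
  qed
qed


section \<open>The left ideal of irregular products\<close>

abbreviation "irregular_classes \<equiv>
  {e_word m n u | u. set u \<subseteq> symbols m n \<times> symbols m n \<and> irregular m u}"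

lemma Irr_eq: "Irr m n = \<Inter>{L. left_ideal L U \<and> irregular_classes \<subseteq> L}"
  unfolding Irr_def hull_def by simp

lemma irregular_in_Irr:
  "set u \<subseteq> symbols m n \<times> symbols m n \<Longrightarrow> irregular m u \<Longrightarrow> cl (word_prod free_gen u) \<in> Irr m n"
  unfolding Irr_eq using e_word_eq[of u] by force

lemma Irr_minimal: "left_ideal L U \<Longrightarrow> irregular_classes \<subseteq> L \<Longrightarrow> Irr m n \<subseteq> L"
  unfolding Irr_eq by blast

lemma Irr_add: "u \<in> Irr m n \<Longrightarrow> v \<in> Irr m n \<Longrightarrow> u \<oplus>\<^bsub>U\<^esub> v \<in> Irr m n"
  unfolding Irr_eq left_ideal_def by (auto intro: additive_subgroup.a_closed)

lemma Irr_zero: "\<zero>\<^bsub>U\<^esub> \<in> Irr m n"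
  unfolding Irr_eq left_ideal_def by (auto intro: additive_subgroup.zero_closed)

lemma Irr_mult: "u \<in> carrier U \<Longrightarrow> v \<in> Irr m n \<Longrightarrow> u \<otimes>\<^bsub>U\<^esub> v \<in> Irr m n"
  unfolding Irr_eq left_ideal_def by auto

text \<open>Taking preimages in the free algebra brings U/Irr (the quotient by J) and U (the
  quotient by I) under the one locale \<open>free_quotient\<close>.\<close>

definition J :: "free_elem set" where
  "J = {x \<in> C. cl x \<in> Irr m n}"

lemma relator_mult_I: "r \<in> env_relators m n \<Longrightarrow> x \<in> C \<Longrightarrow> r * x \<in> I"
  using FA.genideal_self[of "env_relators m n"] env_relators_subset I.I_r_closed[of r x]
  by (auto simp: env_ideal_def)

lemma I_subset_J: "I \<subseteq> J"
proof
  fix x assume "x \<in> I"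
  then have "x \<in> C"
    using I_subset by blast
  moreover from this \<open>x \<in> I\<close> have "cl x = \<zero>\<^bsub>U\<^esub>"
    by (simp only: cl_eq_zero_iff)
  ultimately show "x \<in> J"
    by (simp add: J_def Irr_zero)
qed

sublocale quot_J: free_quotient m n J
proof
  show "r * x \<in> J" if "r \<in> env_relators m n" "x \<in> C" for r x
    using relator_mult_I[OF that] I_subset_J by blast
qed (auto simp: J_def free_carrier_add free_carrier_mult free_carrier_0 cl_add cl_mult cl_zero cl_closed
    intro: Irr_add Irr_mult Irr_zero)

sublocale quot_I: free_quotient m n I
proof
  show "x + y \<in> I" if "x \<in> I" "y \<in> I" for x y
    using I.a_closed that by simp
  show "x * y \<in> I" if "x \<in> C" "y \<in> I" for x y
    using I.I_l_closed[of y x] that by simp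
  show "0 \<in> I"
    using I.zero_closed by simp
qed (use I_subset relator_mult_I in auto)

text \<open>The one-letter word is irregular: it has one second index g and no first index to its
  right.\<close>

lemma gen_virtual_in_J:
  assumes "a \<in> symbols m n" "g \<in> {1..m}"
  shows "free_gen a (Virtual g) \<in> J"
proof -
  have "{j. j = Suc 0 \<and> snd ([(a, Virtual g)] ! (j - Suc 0)) = Virtual g} = {1}"
    by auto
  then have "irregular m [(a, Virtual g)]"
    using assms(2) unfolding irregular_def virtual_symbols_def
    by (intro bexI[of _ 1] bexI[of _ "Virtual g"]) (auto simp: card_gt_0_iff)
  with irregular_in_Irr[of "[(a, Virtual g)]"] assms show ?thesis
    by (simp add: J_def free_carrier_gen)
qed

text \<open>The coefficients are operators on U(gl(m|n)), realized as the quotient by I, and are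
  multiplied from the left by the operators of e_{i,j}. This represents the subalgebra U(gl(n))
  faithfully, as \<open>C0_J_subset_I\<close> requires.\<close>

abbreviation (input) "fz \<equiv> \<lambda>g i. create (prod_encode (g, i)) :: (nat set \<Rightarrow> free_elem endo) endo"
abbreviation (input) "fd \<equiv> \<lambda>g i. annihilate (prod_encode (g, i)) :: (nat set \<Rightarrow> free_elem endo) endo"
abbreviation (input) "fE \<equiv> \<lambda>i j. scale (quot_I.rep (Proper i) (Proper j))"

sublocale F: fock m n fz fd fE
proof (rule fock_operators)
  fix i j k l assume "i \<in> {1..n}" "j \<in> {1..n}" "k \<in> {1..n}" "l \<in> {1..n}"
  then show "quot_I.rep (Proper i) (Proper j) * quot_I.rep (Proper k) (Proper l) =
      quot_I.rep (Proper k) (Proper l) * quot_I.rep (Proper i) (Proper j)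
      + (if j = k then quot_I.rep (Proper i) (Proper l) else 0)
      - (if i = l then quot_I.rep (Proper k) (Proper j) else 0)"
    using quot_I.rep.e_e[of "Proper i" "Proper j" "Proper k" "Proper l"] by simp
qed (rule quot_I.rep.two_torsion_free)

lemma scale_e: "scale (scalar_endo c) * F.e a b = F.e a b * scale (scalar_endo c)"
proof -
  let ?k = "scale (scalar_endo c) :: (nat set \<Rightarrow> free_elem endo) endo"
  have mult: "?k * (u * v) = u * v * ?k" if "?k * u = u * ?k" "?k * v = v * ?k" for u v
  proof -
    have "?k * (u * v) = u * (?k * v)"
      unfolding mult.assoc[symmetric] that(1) ..
    then show ?thesis
      by (simp only: that(2) mult.assoc)
  qed
  have sum: "?k * sum f A = sum f A * ?k" if "\<And>i. i \<in> A \<Longrightarrow> ?k * f i = f i * ?k"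
    for f :: "nat \<Rightarrow> (nat set \<Rightarrow> free_elem endo) endo" and A
    unfolding sum_distrib_left sum_distrib_right by (rule sum.cong[OF refl]) (rule that)
  have E: "?k * fE i j = fE i j * ?k" for i j
    by (simp only: quot_I.rep.\<kappa>_e flip: scale_hom(3))
  have q: "?k * F.q i j = F.q i j * ?k" for i j
    unfolding F.q_def F.N_def left_diff_distrib right_diff_distrib
    by (intro arg_cong2[of _ _ _ _ "(-)"] E sum mult scale_commute)
  show ?thesis
    by (cases a; cases b) (simp only: F.e.simps, intro q sum mult scale_commute)+
qed

sublocale F: free_eval "\<lambda>c. scale (scalar_endo c)" F.e
  by unfold_locales (simp_all add: quot_I.scalar_endo_hom scale_hom scale_e)


section \<open>The vacuum and the uniqueness of the devirtualization\<close>

lemma e_vacuum: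
  assumes "a \<in> symbols m n" "g \<in> {1..m}"
  shows "F.e a (Virtual g) * vacuum = 0"
  using assms by (cases a) (simp_all add: sum_distrib_right mult.assoc annihilate_vacuum)

lemma eval_I:
  assumes "x \<in> I"
  shows "F.eval x = 0"
proof -
  have "ideal {x \<in> C. F.eval x = 0} (free_alg m n)"
  proof (rule idealI[OF FA.ring_axioms])
    show "subgroup {x \<in> C. F.eval x = 0} (add_monoid (free_alg m n))"
    proof (rule FA.add.subgroupI)
      show "\<ominus>\<^bsub>free_alg m n\<^esub> x \<in> {x \<in> C. F.eval x = 0}" if "x \<in> {x \<in> C. F.eval x = 0}" for x
      proof -
        have "\<ominus>\<^bsub>free_alg m n\<^esub> x = - x"
          using that by (intro FA.minus_equality) (simp_all add: free_carrier_uminus)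
        then show ?thesis
          using that by (simp add: F.eval_uminus free_carrier_uminus)
      qed
      show "{x \<in> C. F.eval x = 0} \<noteq> {}"
        using free_carrier_0 F.eval_zero by blast
    qed (auto simp: F.eval_add free_carrier_add)
  qed (auto simp: F.eval_mult free_carrier_mult)
  moreover have "F.eval r = 0" if "r \<in> env_relators m n" for r
  proof -
    obtain a b c d where r: "r = free_gen a b * free_gen c d
        - bracket_sign a b c d * (free_gen c d * free_gen a b) - gl_bracket a b c d"
      and abcd: "a \<in> symbols m n" "b \<in> symbols m n" "c \<in> symbols m n" "d \<in> symbols m n"
      using \<open>r \<in> env_relators m n\<close> unfolding env_relators_def by blast
    have sign: "F.eval (bracket_sign a b c d) = super_sign a b c d"
      unfolding bracket_sign_eq F.eval_of_int by (rule of_int_super_sign)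
    show ?thesis
      using F.gl.bracket[OF abcd]
      by (simp add: r gl_bracket_def F.eval_minus F.eval_mult F.eval_gen sign if_distrib[of F.eval] del: F.e.simps)
  qed
  ultimately have "I \<subseteq> {x \<in> C. F.eval x = 0}"
    unfolding env_ideal_def using env_relators_subset by (intro FA.genideal_minimal) auto
  then show ?thesis
    using assms by blast
qed

text \<open>The classes that annihilate the vacuum form a left ideal, which contains the irregular
  words by \<open>irregular_kills\<close> and hence all of \<open>Irr\<close>. The choice of
  representatives does not matter because evaluation vanishes on I.\<close>

lemma eval_J_vacuum:
  assumes "x \<in> J"
  shows "F.eval x * vacuum = 0"
proof -
  define K where "K = {x \<in> C. F.eval x * vacuum = 0}"
  have "left_ideal (cl ` K) U"
    unfolding left_ideal_def
  proof (intro conjI ballI)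
    show "additive_subgroup (cl ` K) U"
    proof (intro additive_subgroup.intro cl.S.add.subgroupI)
      show "\<ominus>\<^bsub>U\<^esub> u \<in> cl ` K" if "u \<in> cl ` K" for u
      proof -
        obtain x where "x \<in> K" "u = cl x"
          using \<open>u \<in> cl ` K\<close> by blast
        then have "- x \<in> K" "\<ominus>\<^bsub>U\<^esub> u = cl (- x)"
          by (simp_all add: K_def free_carrier_uminus F.eval_uminus cl_uminus)
        then show ?thesis by blast
      qed
      show "u \<oplus>\<^bsub>U\<^esub> v \<in> cl ` K" if "u \<in> cl ` K" "v \<in> cl ` K" for u v
      proof -
        obtain x y where "x \<in> K" "u = cl x" "y \<in> K" "v = cl y"
          using \<open>u \<in> cl ` K\<close> \<open>v \<in> cl ` K\<close> by blast
        then have "x + y \<in> K" "u \<oplus>\<^bsub>U\<^esub> v = cl (x + y)"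
          by (simp_all add: K_def free_carrier_add F.eval_add cl_add distrib_right)
        then show ?thesis by blast
      qed
      show "cl ` K \<subseteq> carrier U"
        by (auto simp: K_def cl_closed)
      have "0 \<in> K"
        by (simp add: K_def free_carrier_0)
      then show "cl ` K \<noteq> {}"
        by blast
    qed
  next
    fix r v assume "r \<in> carrier U" "v \<in> cl ` K"
    then obtain x y where "x \<in> C" "r = cl x" "y \<in> K" "v = cl y"
      by (auto simp: carrier_U)
    then have "x * y \<in> K" "r \<otimes>\<^bsub>U\<^esub> v = cl (x * y)"
      by (simp_all add: K_def free_carrier_mult F.eval_mult cl_mult mult.assoc)
    then show "r \<otimes>\<^bsub>U\<^esub> v \<in> cl ` K"
      by blast
  qed
  moreover have "irregular_classes \<subseteq> cl ` K"
  proof clarify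
    fix u assume u: "set u \<subseteq> symbols m n \<times> symbols m n" "irregular m u"
    have "F.eval (word_prod free_gen u) = word_prod F.e u"
      by (simp add: word_prod_def F.eval_prod_list F.eval_gen case_prod_unfold comp_def)
    then have "word_prod free_gen u \<in> K"
      using F.gl.irregular_kills[OF e_vacuum u] free_carrier_word[OF u(1)] by (simp add: K_def)
    then show "e_word m n u \<in> cl ` K"
      using e_word_eq[OF u(1)] by blast
  qed
  ultimately have "Irr m n \<subseteq> cl ` K"
    by (rule Irr_minimal)
  then obtain y where y: "y \<in> K" "cl x = cl y" and x: "x \<in> C"
    using assms by (auto simp: J_def)
  then have "cl (x - y) = \<zero>\<^bsub>U\<^esub>"
    by (simp add: K_def cl_minus cl_closed cl.S.minus_eq cl.S.r_neg)
  then have "x - y \<in> I"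
    using x y(1) cl_eq_zero_iff[of "x - y"] by (simp add: K_def free_carrier_minus)
  from eval_I[OF this] have "F.eval x = F.eval y"
    by (simp add: F.eval_minus)
  then show ?thesis
    using y(1) by (simp add: K_def)
qed

text \<open>The part \<open>N\<close> of a proper generator ends in annihilation operators, so only
  the coefficient part survives on the vacuum. Coefficients commute with \<open>vacuum\<close>,
  which carries this over to products.\<close>

lemma eval_C0_vacuum:
  assumes "x \<in> C0"
  shows "F.eval x * vacuum = scale (quot_I.rep.eval x) * vacuum"
  using assms
proof (induction rule: free_carrier_induct)
  case (scalar c)
  then show ?case
    by (simp add: F.eval_scalar quot_I.rep.eval_scalar)
next
  case (gen a b)
  then obtain i j where "a = Proper i" "b = Proper j"
    by (auto simp: proper_symbols_def)
  then show ?case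
    by (simp add: F.eval_gen quot_I.rep.eval_gen F.q_def F.N_def left_diff_distrib sum_distrib_right
        mult.assoc annihilate_vacuum)
next
  case (add f g)
  then show ?case
    by (simp add: F.eval_add quot_I.rep.eval_add scale_hom distrib_right)
next
  case (mult f g)
  have "F.eval (f * g) * vacuum = F.eval f * (scale (quot_I.rep.eval g) * vacuum)"
    by (simp add: F.eval_mult mult.assoc mult.IH)
  also have "\<dots> = (F.eval f * vacuum) * scale (quot_I.rep.eval g)"
    by (simp add: scale_commute mult.assoc)
  also have "\<dots> = scale (quot_I.rep.eval f) * (vacuum * scale (quot_I.rep.eval g))"
    by (simp only: mult.IH mult.assoc)
  also have "\<dots> = scale (quot_I.rep.eval (f * g)) * vacuum"
    by (simp only: quot_I.rep.eval_mult scale_hom(3) mult.assoc flip: scale_commute(3))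
  finally show ?case .
qed

text \<open>The coefficient operator of x vanishes, yet it sends the unit \<pi> 1 to the class of x
  modulo I. So the sum of U(gl(n)) and \<open>Irr\<close> is direct.\<close>

lemma C0_J_subset_I:
  assumes "x \<in> C0" "x \<in> J"
  shows "x \<in> I"
proof -
  have "scale (quot_I.rep.eval x) * vacuum = 0"
    using eval_C0_vacuum[OF assms(1)] eval_J_vacuum[OF assms(2)] by simp
  then have "quot_I.rep.eval x = 0"
    by (rule scale_vacuum_eq_0D)
  then have "quot_I.\<pi> x = 0"
    using quot_I.app_eval_1[OF C0_D[OF assms(1)]] by simp
  then show ?thesis
    using quot_I.\<pi>_eq_0_iff[OF C0_D[OF assms(1)]] by simp
qed

text \<open>Two candidates for the \<open>THE\<close> in \<open>devirt\<close> differ by an element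
  of U(gl(n)) that lies in \<open>Irr\<close>, hence by 0.\<close>

lemma devirt_eq:
  assumes "x \<in> C" "y \<in> C0" "x - y \<in> J"
  shows "devirt m n (cl x) = cl y"
  unfolding devirt_def
proof (rule the_equality)
  show "cl y \<in> Ugl_proper m n \<and> cl x \<ominus>\<^bsub>U\<^esub> cl y \<in> Irr m n"
    using assms by (simp add: Ugl_proper_eq J_def cl_minus C0_D)
next
  fix u assume u: "u \<in> Ugl_proper m n \<and> cl x \<ominus>\<^bsub>U\<^esub> u \<in> Irr m n"
  then obtain y' where y': "y' \<in> C0" "u = cl y'"
    by (auto simp: Ugl_proper_eq)
  then have "x - y' \<in> J"
    using u assms(1) by (simp add: J_def cl_minus C0_D free_carrier_minus)
  then have "(x - y') - (x - y) \<in> J"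
    using assms(3) quot_J.J_add[of "x - y'" "- (x - y)"]
      quot_J.J_left[OF free_carrier_of_int[of "- 1"], of "x - y"] by simp
  then have "y - y' \<in> I"
    using assms(2) y'(1) by (intro C0_J_subset_I) (simp_all add: free_carrier_minus)
  then have "cl y \<ominus>\<^bsub>U\<^esub> cl y' = \<zero>\<^bsub>U\<^esub>"
    using assms(2) y'(1) cl_eq_zero_iff[of "y - y'"] by (simp add: cl_minus C0_D free_carrier_minus)
  then show "u = cl y"
    using assms(2) y' cl.S.r_right_minus_eq[of "cl y" "cl y'"] by (simp add: cl_closed C0_D)
qed

end

text \<open>Conjugation with the increasing enumeration f of I turns permutations of I into
  permutations of positions and keeps the sign. The element in position s has k - s larger ones in
  I, so the diagonals match.\<close>

lemma capelli_det_reindex: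
  fixes E :: "nat \<Rightarrow> nat \<Rightarrow> 'r::ring_1"
  assumes I: "finite I" and k: "card I = k"
  defines "f \<equiv> \<lambda>r. sorted_list_of_set I ! (r - 1)"
  shows "capelli_det E 0 I = (\<Sum>\<sigma> | \<sigma> permutes {1..k}. of_int (sign \<sigma>) *
    prod_list (map (\<lambda>s. E (f (\<sigma> s)) (f s) + (if \<sigma> s = s then of_int (int (k - s)) else 0)) [1..<Suc k]))"
proof -
  let ?L = "sorted_list_of_set I"
  have len: "length ?L = k"
    using k by simp
  have L: "?L = map f [1..<Suc k]"
    by (rule nth_equalityI) (simp_all add: f_def k del: upt_Suc)
  have less: "f r < f s \<longleftrightarrow> r < s" if "r \<in> {1..k}" "s \<in> {1..k}" for r s
  proof -
    have mono: "f r < f s" if "r \<in> {1..k}" "s \<in> {1..k}" "r < s" for r s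
      using that sorted_wrt_nth_less[OF strict_sorted_list_of_set[of I], of "r - 1" "s - 1"]
      by (auto simp: f_def k intro: diff_less_mono)
    show ?thesis
      using mono[OF that] mono[OF that(2,1)] by (metis linorder_neqE_nat not_less_iff_gr_or_eq)
  qed
  have bij: "bij_betw f {1..k} I"
  proof -
    have "inj_on f {1..k}"
      by (metis inj_onI less linorder_neqE_nat less_irrefl)
    moreover have "f ` {1..k} = set ?L"
      unfolding L by (simp add: atLeastLessThanSuc_atLeastAtMost del: upt_Suc)
    ultimately show ?thesis
      using I by (simp add: bij_betw_def)
  qed
  then have inj: "inj_on f {1..k}" and image: "f ` {1..k} = I"
    by (simp_all add: bij_betw_def)
  define g where "g = inv_into {1..k} f"
  have g: "bij_betw g I {1..k}"
    unfolding g_def by (rule bij_betw_inv_into[OF bij])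
  have gf: "g (f r) = r" if "r \<in> {1..k}" for r
    unfolding g_def using inj that by (rule inv_into_f_f)
  have fg: "f (g i) = i" if "i \<in> I" for i
    unfolding g_def using that image by (simp add: f_inv_into_f)
  have above: "card {j \<in> I. f s < j} = k - s" if "s \<in> {1..k}" for s
  proof -
    have "{j \<in> I. f s < j} = f ` {Suc s..k}"
      using less[OF that] that by (auto simp flip: image)
    then show ?thesis
      using inj that by (simp add: card_image inj_on_subset)
  qed
  show ?thesis
    unfolding capelli_det_def
  proof (rule sum.reindex_bij_witness[where i = "map_permutation {1..k} f" and j = "map_permutation I g"])
    fix \<sigma> assume "\<sigma> \<in> {\<sigma>. \<sigma> permutes I}"
    then have \<sigma>: "\<sigma> permutes I" by simp
    show "map_permutation {1..k} f (map_permutation I g \<sigma>) = \<sigma>"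
      using g \<sigma> fg by (rule map_permutation_compose_inv)
    show "map_permutation I g \<sigma> \<in> {\<sigma>. \<sigma> permutes {1..k}}"
      using map_permutation_permutes[OF g \<sigma>] by simp
    have sign: "sign (map_permutation I g \<sigma>) = sign \<sigma>"
      using g \<sigma> I by (intro sign_map_permutation) (auto simp: bij_betw_def)
    have entries: "map (\<lambda>s. E (f (map_permutation I g \<sigma> s)) (f s) +
          (if map_permutation I g \<sigma> s = s then of_int (int (k - s)) else 0)) [1..<Suc k] =
        map (\<lambda>s. capelli_entry E 0 I (\<sigma> (f s)) (f s)) [1..<Suc k]"
    proof (rule map_cong[OF refl])
      fix s assume "s \<in> set [1..<Suc k]"
      then have s: "s \<in> {1..k}" by auto
      then have fs: "f s \<in> I"
        using image by blast
      then have \<sigma>fs: "\<sigma> (f s) \<in> I"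
        using permutes_in_image[OF \<sigma>] by simp
      have "map_permutation I g \<sigma> (g (f s)) = g (\<sigma> (f s))"
        using g fs by (intro map_permutation_apply) (auto simp: bij_betw_def)
      then have app: "map_permutation I g \<sigma> s = g (\<sigma> (f s))"
        by (simp only: gf[OF s])
      have "g (\<sigma> (f s)) = s \<longleftrightarrow> \<sigma> (f s) = f s"
        using fg[OF \<sigma>fs] gf[OF s] by metis
      then show "E (f (map_permutation I g \<sigma> s)) (f s) +
          (if map_permutation I g \<sigma> s = s then of_int (int (k - s)) else 0) =
          capelli_entry E 0 I (\<sigma> (f s)) (f s)"
        by (simp add: app fg[OF \<sigma>fs] capelli_entry_def above[OF s])
    qed
    show "of_int (sign (map_permutation I g \<sigma>)) *
        prod_list (map (\<lambda>s. E (f (map_permutation I g \<sigma> s)) (f s) +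
          (if map_permutation I g \<sigma> s = s then of_int (int (k - s)) else 0)) [1..<Suc k]) =
      of_int (sign \<sigma>) * prod_list (map (\<lambda>j. capelli_entry E 0 I (\<sigma> j) j) ?L)"
      unfolding sign L entries by (simp only: map_map comp_def)
  next
    fix \<sigma> assume "\<sigma> \<in> {\<sigma>. \<sigma> permutes {1..k}}"
    then have \<sigma>: "\<sigma> permutes {1..k}" by simp
    show "map_permutation I g (map_permutation {1..k} f \<sigma>) = \<sigma>"
      using bij \<sigma> gf by (rule map_permutation_compose_inv)
    show "map_permutation {1..k} f \<sigma> \<in> {\<sigma>. \<sigma> permutes I}"
      using map_permutation_permutes[OF bij \<sigma>] by simp
  qed
qed

section \<open>Capelli elements as classes of determinants in the free algebra\<close>

context envelope
begin

abbreviation "fgen \<equiv> \<lambda>i j. free_gen (Proper i) (Proper j)"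

lemma capelli_det_C0:
  assumes "K \<subseteq> {1..n}"
  shows "capelli_det fgen t K \<in> C0"
  unfolding capelli_det_def
proof (intro free_carrier_sum free_carrier_mult free_carrier_of_int free_carrier_prod_list)
  fix \<sigma> assume "\<sigma> \<in> {\<sigma>. \<sigma> permutes K}"
  then have \<sigma>: "\<sigma> permutes K"
    by simp
  have "finite K"
    using assms finite_subset by blast
  have "capelli_entry fgen t K (\<sigma> j) j \<in> C0" if "j \<in> K" for j
  proof -
    have "\<sigma> j \<in> K"
      using permutes_in_image[OF \<sigma>] that by simp
    then have "free_gen (Proper (\<sigma> j)) (Proper j) \<in> C0"
      using assms that by (intro free_carrier_gen) (auto simp: proper_symbols_def)
    then show ?thesis
      unfolding capelli_entry_def
      by (intro free_carrier_add) (simp_all only: free_carrier_of_int free_carrier_0 split: if_split, simp)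
  qed
  then show "set (map (\<lambda>j. capelli_entry fgen t K (\<sigma> j) j) (sorted_list_of_set K)) \<subseteq> C0"
    using \<open>finite K\<close> by auto
qed

lemma cl_capelli_det:
  assumes "K \<subseteq> {1..n}" and k: "card K = k"
  shows "cl (capelli_det fgen 0 K) = cdet U k (capelli_matrix m n K)"
proof -
  define f where "f r = sorted_list_of_set K ! (r - 1)" for r
  have fin: "finite K"
    using assms finite_subset by blast
  have f: "f r \<in> K" if "r \<in> {1..k}" for r
  proof -
    have "f r \<in> set (sorted_list_of_set K)"
      unfolding f_def using that k by (intro nth_mem) auto
    then show ?thesis
      using fin by simp
  qed
  let ?A = "\<lambda>r s. fgen (f r) (f s) + (if r = s then of_int (int (k - s)) else 0)"
  have A: "?A r s \<in> C \<and> cl (?A r s) = capelli_matrix m n K r s"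
    if "r \<in> {1..k}" "s \<in> {1..k}" for r s
  proof -
    have gen: "fgen (f r) (f s) \<in> C"
      using f[OF that(1)] f[OF that(2)] assms(1) by (intro free_carrier_gen) auto
    define d :: free_elem where "d = (if r = s then of_int (int (k - s)) else 0)"
    have "d \<in> C"
      unfolding d_def by (simp only: free_carrier_of_int free_carrier_0 split: if_split) simp
    \<comment> \<open>\<open>capelli_matrix\<close> takes a natural multiple and the row index; on
      the diagonal r = s both forms agree.\<close>
    moreover have "cl d = (if r = s then [(card K - r)] \<cdot>\<^bsub>U\<^esub> \<one>\<^bsub>U\<^esub> else \<zero>\<^bsub>U\<^esub>)"
      using cl_of_int[OF free_carrier_1, of "int (k - s)"] add_pow_int_ge[of "int (k - s)" U]
      by (simp add: d_def cl_one cl_zero k)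
    ultimately show ?thesis
      unfolding d_def[symmetric] capelli_matrix_def env_gen_def f_def[symmetric]
      using gen by (simp only: cl_add free_carrier_add)
  qed
  have prod: "cl (prod_list (map (\<lambda>s. ?A (\<sigma> s) s) [1..<Suc k])) =
      list_mult U (map (\<lambda>s. capelli_matrix m n K (\<sigma> s) s) [1..<Suc k]) \<and>
      prod_list (map (\<lambda>s. ?A (\<sigma> s) s) [1..<Suc k]) \<in> C" if "\<sigma> permutes {1..k}" for \<sigma>
  proof -
    have A\<sigma>: "?A (\<sigma> s) s \<in> C \<and> cl (?A (\<sigma> s) s) = capelli_matrix m n K (\<sigma> s) s"
      if "s \<in> set [1..<Suc k]" for s
      using that permutes_in_image[OF \<open>\<sigma> permutes {1..k}\<close>, of s] by (intro A) auto
    then have sub: "set (map (\<lambda>s. ?A (\<sigma> s) s) [1..<Suc k]) \<subseteq> C"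
      unfolding set_map by blast
    have "map cl (map (\<lambda>s. ?A (\<sigma> s) s) [1..<Suc k]) = map (\<lambda>s. capelli_matrix m n K (\<sigma> s) s) [1..<Suc k]"
      unfolding map_map comp_def using A\<sigma> by (intro map_cong[OF refl]) blast
    then show ?thesis
      using cl_prod_list[OF sub] free_carrier_prod_list[OF sub] by (simp only: simp_thms)
  qed
  let ?P = "\<lambda>\<sigma>. prod_list (map (\<lambda>s. ?A (\<sigma> s) s) [1..<Suc k])"
  let ?Q = "\<lambda>\<sigma>. list_mult U (map (\<lambda>s. capelli_matrix m n K (\<sigma> s) s) [1..<Suc k])"
  have in_C: "of_int (sign \<sigma>) * ?P \<sigma> \<in> C" if "\<sigma> \<in> {\<sigma>. \<sigma> permutes {1..k}}" for \<sigma>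
    using prod[of \<sigma>] that by (intro free_carrier_mult free_carrier_of_int) (simp only: mem_Collect_eq)
  have eq: "cl (of_int (sign \<sigma>) * ?P \<sigma>) = [sign \<sigma>] \<cdot>\<^bsub>U\<^esub> ?Q \<sigma>"
    if "\<sigma> \<in> {\<sigma>. \<sigma> permutes {1..k}}" for \<sigma>
    using prod[of \<sigma>] that by (simp only: cl_of_int mem_Collect_eq)
  have "cl (capelli_det fgen 0 K) = cl (\<Sum>\<sigma> | \<sigma> permutes {1..k}. of_int (sign \<sigma>) * ?P \<sigma>)"
    unfolding capelli_det_reindex[OF fin k] f_def ..
  also have "\<dots> = (\<Oplus>\<^bsub>U\<^esub>\<sigma>\<in>{\<sigma>. \<sigma> permutes {1..k}}. cl (of_int (sign \<sigma>) * ?P \<sigma>))"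
    by (rule cl_sum) (rule in_C)
  also have "\<dots> = (\<Oplus>\<^bsub>U\<^esub>\<sigma>\<in>{\<sigma>. \<sigma> permutes {1..k}}. [sign \<sigma>] \<cdot>\<^bsub>U\<^esub> ?Q \<sigma>)"
  proof (rule cl.S.finsum_cong'[OF refl])
    show "(\<lambda>\<sigma>. [sign \<sigma>] \<cdot>\<^bsub>U\<^esub> ?Q \<sigma>) \<in> {\<sigma>. \<sigma> permutes {1..k}} \<rightarrow> carrier U"
    proof
      fix \<sigma> assume \<sigma>: "\<sigma> \<in> {\<sigma>. \<sigma> permutes {1..k}}"
      show "[sign \<sigma>] \<cdot>\<^bsub>U\<^esub> ?Q \<sigma> \<in> carrier U"
        unfolding eq[OF \<sigma>, symmetric] by (rule cl_closed) (rule in_C[OF \<sigma>])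
    qed
  qed (rule eq)
  finally show ?thesis
    unfolding cdet_def .
qed

definition free_capelli :: "nat \<Rightarrow> free_elem" where
  "free_capelli j = (\<Sum>K | K \<subseteq> {1..n} \<and> card K = j. capelli_det fgen 0 K)"

lemma free_capelli_C0: "free_capelli j \<in> C0"
  unfolding free_capelli_def by (rule free_carrier_sum, rule capelli_det_C0) blast

lemma cl_free_capelli: "cl (free_capelli j) = capelli_elem m n j"
proof (cases "j = 0")
  case True
  \<comment> \<open>For j = 0 only the empty determinant occurs, and its value 1 matches the
    convention in \<open>capelli_elem\<close>.\<close>
  have "{K. K \<subseteq> {1..n} \<and> card K = 0} = {{}}"
    by (auto dest: finite_subset[OF _ finite_atLeastAtMost])
  moreover have "capelli_det fgen 0 {} = 1"
    by (simp add: capelli_det_def)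
  ultimately show ?thesis
    by (simp add: True free_capelli_def capelli_elem_def cl_one)
next
  case False
  have "cl (free_capelli j) = (\<Oplus>\<^bsub>U\<^esub>K\<in>{K. K \<subseteq> {1..n} \<and> card K = j}. cl (capelli_det fgen 0 K))"
    unfolding free_capelli_def by (rule cl_sum, rule C0_D, rule capelli_det_C0) blast
  also have "\<dots> = (\<Oplus>\<^bsub>U\<^esub>K\<in>{K. K \<subseteq> {1..n} \<and> card K = j}. cdet U j (capelli_matrix m n K))"
  proof (rule cl.S.finsum_cong'[OF refl])
    show "(\<lambda>K. cdet U j (capelli_matrix m n K)) \<in> {K. K \<subseteq> {1..n} \<and> card K = j} \<rightarrow> carrier U"
    proof
      fix K assume "K \<in> {K. K \<subseteq> {1..n} \<and> card K = j}"
      then have K: "K \<subseteq> {1..n}" "card K = j"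
        by blast+
      show "cdet U j (capelli_matrix m n K) \<in> carrier U"
        unfolding cl_capelli_det[OF K, symmetric] by (intro cl_closed C0_D capelli_det_C0 K)
    qed
  qed (use cl_capelli_det in blast)
  finally show ?thesis
    using False by (simp add: capelli_elem_def)
qed

lemma cl_C_elem: "cl (capelli_det fgen (- int q) {1..n}) = C_elem m n q"
proof -
  let ?c = "\<lambda>j. (- 1) ^ (n - j) * falling_factorial q (n - j)"
  have in_C: "of_int (?c j) * free_capelli j \<in> C" for j
    by (intro free_carrier_mult free_carrier_of_int C0_D free_capelli_C0)
  have eq: "cl (of_int (?c j) * free_capelli j) = [?c j] \<cdot>\<^bsub>U\<^esub> capelli_elem m n j" for j
    by (simp only: cl_of_int C0_D free_capelli_C0 cl_free_capelli)
  have "cl (capelli_det fgen (- int q) {1..n}) = (\<Oplus>\<^bsub>U\<^esub>j\<in>{0..n}. cl (of_int (?c j) * free_capelli j))"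
    unfolding capelli_det_neg_card free_capelli_def[symmetric] by (rule cl_sum) (rule in_C)
  then show ?thesis
    unfolding C_elem_def eq .
qed

end

section \<open>The word of the bitableau and its devirtualization\<close>

lemma word_prod_concat: "word_prod e (concat us) = prod_list (map (word_prod e) us)"
  by (induction us) simp_all

lemma deruyts_bitableau_word:
  "bitableau_word \<alpha> (replicate p (rev [1..<Suc n])) (replicate p [1..<Suc n]) =
    concat (map (\<lambda>i. map (\<lambda>s. (Proper s, Virtual (\<alpha> i))) (rev [1..<Suc n])) [1..<Suc p])
    @ concat (map (\<lambda>i. map (\<lambda>s. (Virtual (\<alpha> i), Proper s)) [1..<Suc n]) [1..<Suc p])"
proof -
  have "replicate p L ! (i - 1) = L" if "i \<in> set [1..<Suc p]" for i and L :: "nat list"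
    using that by auto
  then show ?thesis
    unfolding bitableau_word_def length_replicate
    by (intro arg_cong2[of _ _ _ _ "(@)"] arg_cong[of _ _ concat] map_cong refl) simp_all
qed

theorem corollary3:
  fixes m n p :: nat and \<alpha> :: "nat \<Rightarrow> nat"
  assumes "n \<ge> 1" and "p \<ge> 1"
    and "inj_on \<alpha> {1..p}" and "\<alpha> ` {1..p} \<subseteq> {1..m}"
  shows "capelli_deruyts m n \<alpha> p =
    [((- 1 :: int) ^ (n * (p choose 2)))] \<cdot>\<^bsub>Ugl m n\<^esub>
      list_mult (Ugl m n) (map (C_elem m n) (rev [0..<p]))"
proof -
  interpret envelope m n .
  define u where "u = bitableau_word \<alpha> (replicate p (rev [1..<Suc n])) (replicate p [1..<Suc n])"
  define L where "L = map (\<lambda>q. capelli_det fgen (- int q) {1..n}) (rev [0..<p])"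
  define y where "y = of_int ((- 1) ^ (n * (p choose 2))) * prod_list L"
  have u: "set u \<subseteq> symbols m n \<times> symbols m n"
  proof -
    have "1 \<le> \<alpha> i \<and> \<alpha> i \<le> m" if "1 \<le> i" "i < Suc p" for i
      using assms(4) that by (metis atLeastAtMost_iff image_subset_iff less_Suc_eq_le)
    then show ?thesis
      unfolding u_def deruyts_bitableau_word by (auto simp del: upt_Suc)
  qed
  have L: "set L \<subseteq> C0"
    unfolding L_def by (auto intro: capelli_det_C0)
  then have y: "y \<in> C0"
    unfolding y_def by (intro free_carrier_mult free_carrier_of_int free_carrier_prod_list)
  \<comment> \<open>\<open>deruyts_word\<close> takes w from the ring of operators. This one has
    rank one: it multiplies \<pi> 1 by the coefficient of the empty word. That coefficient is 1 for
    the vector 1, so evaluation at 1 gives equations for the unit of U/Irr.\<close>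
  define w where "w = Endo (\<lambda>v. free_scalar (Poly_Mapping.lookup v 0) * quot_J.\<pi> 1)"
  have app_w: "app w v = free_scalar (Poly_Mapping.lookup v 0) * quot_J.\<pi> 1" for v
    unfolding w_def by (subst app_Endo) (simp_all add: lookup_add free_scalar_add distrib_right)
  have app_w_1: "app w 1 = quot_J.\<pi> 1"
    by (simp add: app_w free_scalar_1)
  have w: "quot_J.rep a (Virtual g) * w = 0" if "a \<in> symbols m n" "g \<in> {1..m}" for a g
  proof (rule endo_eqI)
    fix v
    have gen: "free_gen a (Virtual g) \<in> C"
      using that by (simp add: free_carrier_gen)
    have "app (quot_J.rep a (Virtual g)) (quot_J.\<pi> 1) = 0"
      using quot_J.app_eval_1[OF gen] quot_J.\<pi>_J[OF gen_virtual_in_J[OF that]]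
      by (simp add: quot_J.rep.eval_gen)
    moreover have "app (quot_J.rep a (Virtual g)) (free_scalar c * z) =
        free_scalar c * app (quot_J.rep a (Virtual g)) z" for c z
      using arg_cong[OF quot_J.scalar_endo_rep[of c a "Virtual g"], of "\<lambda>f. app f z"]
      by (simp add: app_scalar_endo)
    ultimately show "app (quot_J.rep a (Virtual g) * w) v = app 0 v"
      by (simp add: app_w)
  qed
  have "word_prod quot_J.rep u =
      prod_list (map (\<lambda>i. quot_J.rep.xs (\<alpha> i) (rev [1..<Suc n])) [1..<Suc p]) *
      prod_list (map (\<lambda>i. quot_J.rep.ys (\<alpha> i) [1..<Suc n]) [1..<Suc p])"
    unfolding u_def deruyts_bitableau_word word_prod_simps word_prod_concat
    by (simp add: word_prod_def quot_J.rep.xs_def quot_J.rep.ys_def comp_def del: upt_Suc)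
  then have "word_prod quot_J.rep u * w = quot_J.rep.eval y * w"
    using quot_J.rep.deruyts_word[OF w assms(3,4)]
      quot_J.rep.eval_of_int[of "(- 1) ^ (n * (p choose 2))"]
    by (simp add: y_def L_def quot_J.rep.eval_mult quot_J.rep.eval_of_int quot_J.rep.eval_prod_list
        quot_J.rep.eval_capelli_det quot_J.rep.eval_gen comp_def mult.assoc del: upt_Suc)
  moreover have "quot_J.rep.eval (word_prod free_gen u) = word_prod quot_J.rep u"
    by (simp add: word_prod_def quot_J.rep.eval_prod_list quot_J.rep.eval_gen case_prod_unfold comp_def)
  ultimately have "app (quot_J.rep.eval (word_prod free_gen u) * w) 1 = app (quot_J.rep.eval y * w) 1"
    by (simp only:)
  then have "quot_J.\<pi> (word_prod free_gen u) = quot_J.\<pi> y"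
    using y u by (simp add: app_w_1 quot_J.app_eval_1 free_carrier_word C0_D)
  then have "word_prod free_gen u - y \<in> J"
    using y u quot_J.\<pi>_eq_0_iff[of "word_prod free_gen u - y"]
    by (simp add: quot_J.\<pi>_minus free_carrier_minus free_carrier_word C0_D)
  then have "devirt m n (cl (word_prod free_gen u)) = cl y"
    using y u by (intro devirt_eq free_carrier_word)
  also have "cl y = [((- 1 :: int) ^ (n * (p choose 2)))] \<cdot>\<^bsub>U\<^esub> list_mult U (map cl L)"
    using L C0_subset unfolding y_def
    by (simp only: cl_of_int cl_prod_list free_carrier_prod_list order_trans)
  also have "map cl L = map (C_elem m n) (rev [0..<p])"
    unfolding L_def map_map comp_def cl_C_elem ..
  finally show ?thesis
    unfolding capelli_deruyts_def capelli_bitableau_def u_def[symmetric] e_word_eq[OF u] .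
qed

end
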